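(* Let $\mathbb{F}$ be a field of odd characteristic $p$, let $n,s$ be positive integers, let $q=p^n$, and let $\pi$ be a nonzero element of the prime field $\mathbb{F}_p$. Then the elements \[ e_{j,k,a}=(1+x^{(p^s)})^a\,x^{(k+1)}y^{(j+1)}, \] for $0\le a<p$, $-1\le k<p^s-1$ and $-1\le j<q-1$, with $(j,k,a)\neq(-1,-1,0)$ and $(j,k,a)\neq(q-2,p^s-2,p-1)$, form a graded basis of the simple graded Hamiltonian algebra $H(2;(s+1,n))^{(2)}$ over the integers modulo $(q-1)p^{s+1}$, where $e_{j,k,a}$ has degree $(1-q)\bigl((a+j\pi)p^s+k\bigr)-j \pmod{(q-1)p^{s+1}}$. Let $L$ be the loop algebra of $H(2;(s+1,n))^{(2)}$ with respect to this grading. Then $L$ is thin, with second diamond in degree $q$. The diamonds of $L$ (with fake diamonds counted as diamonds) occur in all degrees of the form $t(q-1)+1$ (with $t\ge0$ an integer), with the diamond type (of the diamonds past the first) being finite exactly when $t\equiv1\pmod{p^{s}}$, and infinite otherwise. Those finite types, in order of increasing degree, follow an arithmetic progression contained in the prime field $\mathbb{F}_p$. The diamond in degree $(q-1)(p^s+1)+1$ has type $\nu=-1+1/\pi$.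
   Context: **Divided powers.** $\mathcal{O}(2;(n_1,n_2))$ is the associative commutative $\mathbb{F}$-algebra with basis the monomials $x^{(i)}y^{(j)}$, $0\le i<p^{n_1}$, $0\le j<p^{n_2}$, and multiplication $x^{(i)}y^{(j)}\cdot x^{(k)}y^{(l)}=\binom{i+k}{i}\binom{j+l}{j}x^{(i+k)}y^{(j+l)}$. Divided powers with a negative exponent, or with exponent at least $p^{n_1}$ for $x$ (respectively at least $p^{n_2}$ for $y$), are read as $0$. Here $x^{(0)}=y^{(0)}=1$. **The graded Hamiltonian algebra.** $H(2;(n_1,n_2))^{(2)}$ is identified with the span of the monomials $x^{(i)}y^{(j)}$ of $\mathcal{O}(2;(n_1,n_2))$ with $(i,j)\ne(0,0)$ and $(i,j)\neq(p^{n_1}-1,p^{n_2}-1)$, with the Lie bracket determined bilinearly by \[ \{x^{(i)}y^{(j)},x^{(k)}y^{(l)}\}=x^{(i)}y^{(j-1)}x^{(k-1)}y^{(l)}-x^{(i-1)}y^{(j)}x^{(k)}y^{(l-1)}, \] where everything is computed modulo the constants $\mathbb{F}\cdot 1$ (that is, the monomial $x^{(0)}y^{(0)}=1$ is set equal to $0$). In odd characteristic it is a simple Lie algebra of dimension $p^{n_1+n_2}-2$. In the theorem $n_1=s+1$, $n_2=n$. **Notation for the basis.** $(1+x^{(p^s)})^{a}=\sum_{i=0}^{a}\binom{a}{i}\,i!\,x^{(ip^s)}$ is the ordinary $a$-th power, and the product with $x^{(k+1)}y^{(j+1)}$ is taken in $\mathcal{O}(2;(s+1,n))$; the elements $e_{j,k,a}$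 are read modulo the constants $\mathbb{F}\cdot1$. In the degree formula, $\pi\in\mathbb{F}_p$ is represented by any integer (so $(a+j\pi)p^s$ is well defined modulo $p^{s+1}$). "Graded basis over $\mathbb{Z}/N\mathbb{Z}$" means: a basis such that the spans of the basis elements of each given degree form a $\mathbb{Z}/N\mathbb{Z}$-grading of the Lie algebra. **Loop algebra.** If $S=\bigoplus_{k\in\mathbb{Z}/N\mathbb{Z}}S_k$ is a finite-dimensional graded Lie algebra over $\mathbb{F}$ and $T$ is an indeterminate, the loop algebra of $S$ with respect to this grading is the Lie subalgebra of $S\otimes\mathbb{F}[T]$ generated by $S_{\bar 1}\otimes T$. It is graded over the positive integers by the power of $T$. **Thin Lie algebras and diamonds.** A thin Lie algebra is an infinite-dimensional graded Lie algebra $L=\bigoplus_{k\ge1}L_k$ over $\mathbb{F}$ with $\dim L_1=2$, satisfying the covering property $L_{i+1}=[u,L_1]$ for all $0\ne u\in L_i$ and all $i\ge1$, and having at least one two-dimensional component besides $L_1$. The homogeneous components of a thin Lie algebra have dimension one or two; those of dimension two are called (genuine) diamonds; $L_1$ is the first diamond, and diamonds are numbered in order of increasing degree. **Diamond types.** Iterated brackets are left-normed: $[a,b,c]=[[a,b],c]$. Let $L$ be thin with second diamond $L_q$. Fix generators $X,Y$ of $L$ spanning $L_1$ as follows: $Y\neq0$ with $[L_2,Y]=0$, and $X\in L_1\setminus\langle Y\rangle$ such that $[V,X,X]=0=[V,Y,Y]$ and $[V,Y,X]=-2[V,X,Y]$ for $0\neq V\in L_{q-1}$. If $q>3$ such $X,Y$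 are unique up to scalar multiples; if $q=3$ one only asks that generators $X,Y$ spanning $L_1$ be chosen so that these last relations hold (without $[L_2,Y]=0$), and types refer to such a choice. Let $L_i$ be a diamond with $i>1$ and let $V$ be a nonzero element of the one-dimensional component $L_{i-1}$. The diamond $L_i$ has finite type $\mu\in\mathbb{F}$ if \[ [V,Y,Y]=0=[V,X,X],\qquad (1-\mu)[V,X,Y]=\mu[V,Y,X], \] and has infinite type ($\infty$) if $[V,Y,Y]=0=[V,X,X]$ and $-[V,X,Y]=[V,Y,X]$. The first diamond $L_1$ is not assigned a type. **Fake diamonds.** By the covering property, a component $L_i$ (with $i>1$) such that, for a nonzero element $V$ of the one-dimensional component $L_{i-1}$, the relations $[V,Y,Y]=0=[V,X,X]$ and $(1-\mu)[V,X,Y]=\mu[V,Y,X]$ hold with $\mu=0$ or $\mu=1$ is one-dimensional (with $[V,X]=0$, respectively $[V,Y]=0$). By convention, a one-dimensional component $L_i$ (here with $i\equiv1\pmod{q-1}$, so that it fits into the sequence of diamonds at regular distances $q-1$) for which these relations hold with $\mu=0$ or $\mu=1$ is called a fake diamond of type $0$ or $1$ and is counted among the diamonds of $L$. *)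

theory Defs
  imports
    "HOL-Computational_Algebra.Polynomial"
    "HOL-Number_Theory.Cong"
    "HOL-Library.Function_Algebras"
begin

section \<open>Lie algebras as subspaces of an ambient vector space\<close>

locale lie_algebra = vector_space scale
  for scale :: "'a::field \<Rightarrow> 'v::ab_group_add \<Rightarrow> 'v" +
  fixes bracket :: "'v \<Rightarrow> 'v \<Rightarrow> 'v" and V :: "'v set"
  assumes subspace_V: "subspace V"
    and bracket_closed: "x \<in> V \<Longrightarrow> y \<in> V \<Longrightarrow> bracket x y \<in> V"
    and bracket_add_left:
      "x \<in> V \<Longrightarrow> y \<in> V \<Longrightarrow> z \<in> V \<Longrightarrow> bracket (x + y) z = bracket x z + bracket y z"
    and bracket_add_right:
      "x \<in> V \<Longrightarrow> y \<in> V \<Longrightarrow> z \<in> V \<Longrightarrow> bracket x (y + z) = bracket x y + bracket x z"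
    and bracket_scale_left:
      "x \<in> V \<Longrightarrow> y \<in> V \<Longrightarrow> bracket (scale c x) y = scale c (bracket x y)"
    and bracket_scale_right:
      "x \<in> V \<Longrightarrow> y \<in> V \<Longrightarrow> bracket x (scale c y) = scale c (bracket x y)"
    and bracket_alternating: "x \<in> V \<Longrightarrow> bracket x x = 0"
    and jacobi:
      "x \<in> V \<Longrightarrow> y \<in> V \<Longrightarrow> z \<in> V \<Longrightarrow>
        bracket (bracket x y) z + bracket (bracket y z) x + bracket (bracket z x) y = 0"

definition lie_subalgebra ::
  "('a::field \<Rightarrow> 'v::ab_group_add \<Rightarrow> 'v) \<Rightarrow> ('v \<Rightarrow> 'v \<Rightarrow> 'v) \<Rightarrow> 'v set \<Rightarrow> 'v set \<Rightarrow> bool" where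
  "lie_subalgebra scale bracket V W \<longleftrightarrow>
     W \<subseteq> V \<and> module.subspace scale W \<and> (\<forall>x\<in>W. \<forall>y\<in>W. bracket x y \<in> W)"

definition generated_lie_subalgebra ::
  "('a::field \<Rightarrow> 'v::ab_group_add \<Rightarrow> 'v) \<Rightarrow> ('v \<Rightarrow> 'v \<Rightarrow> 'v) \<Rightarrow> 'v set \<Rightarrow> 'v set \<Rightarrow> 'v set" where
  "generated_lie_subalgebra scale bracket V G = \<Inter>{W. lie_subalgebra scale bracket V W \<and> G \<subseteq> W}"

definition internal_direct_sum ::
  "('a::field \<Rightarrow> 'v::ab_group_add \<Rightarrow> 'v) \<Rightarrow> 'i set \<Rightarrow> ('i \<Rightarrow> 'v set) \<Rightarrow> 'v set \<Rightarrow> bool" where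
  "internal_direct_sum scale I M V \<longleftrightarrow>
     (\<forall>i\<in>I. module.subspace scale (M i)) \<and>
     module.span scale (\<Union>i\<in>I. M i) = V \<and>
     (\<forall>J f. finite J \<and> J \<subseteq> I \<and> (\<forall>i\<in>J. f i \<in> M i) \<and> (\<Sum>i\<in>J. f i) = 0 \<longrightarrow> (\<forall>i\<in>J. f i = 0))"

text \<open>The degrees range over a set \<open>I\<close> with addition \<open>add\<close>, so that gradings over the positive
  integers and over the integers modulo \<open>N\<close> are both instances.\<close>

definition lie_grading ::
  "('a::field \<Rightarrow> 'v::ab_group_add \<Rightarrow> 'v) \<Rightarrow> ('v \<Rightarrow> 'v \<Rightarrow> 'v) \<Rightarrow> 'v set \<Rightarrow>
     'i set \<Rightarrow> ('i \<Rightarrow> 'i \<Rightarrow> 'i) \<Rightarrow> ('i \<Rightarrow> 'v set) \<Rightarrow> bool" where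
  "lie_grading scale bracket V I add M \<longleftrightarrow>
     lie_algebra scale bracket V \<and>
     internal_direct_sum scale I M V \<and>
     (\<forall>i\<in>I. \<forall>j\<in>I. \<forall>x\<in>M i. \<forall>y\<in>M j. bracket x y \<in> M (add i j))"

text \<open>The spans of the members of a family \<open>e\<close> of given degree modulo \<open>N\<close>.\<close>

definition degree_span ::
  "('a::field \<Rightarrow> 'v::ab_group_add \<Rightarrow> 'v) \<Rightarrow> nat \<Rightarrow> 'b set \<Rightarrow> ('b \<Rightarrow> 'v) \<Rightarrow> ('b \<Rightarrow> int) \<Rightarrow> int \<Rightarrow> 'v set" where
  "degree_span scale N B e deg d = module.span scale {e b | b. b \<in> B \<and> [deg b = d] (mod int N)}"

definition graded_basis ::
  "('a::field \<Rightarrow> 'v::ab_group_add \<Rightarrow> 'v) \<Rightarrow> ('v \<Rightarrow> 'v \<Rightarrow> 'v) \<Rightarrow> 'v set \<Rightarrow>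
     nat \<Rightarrow> 'b set \<Rightarrow> ('b \<Rightarrow> 'v) \<Rightarrow> ('b \<Rightarrow> int) \<Rightarrow> bool" where
  "graded_basis scale bracket V N B e deg \<longleftrightarrow>
     inj_on e B \<and> \<not> module.dependent scale (e ` B) \<and> module.span scale (e ` B) = V \<and>
     lie_grading scale bracket V {0..<int N} (\<lambda>i j. (i + j) mod int N) (degree_span scale N B e deg)"

section \<open>Loop algebras\<close>

text \<open>\<open>V \<otimes> F[T]\<close> is realised as the space of polynomials in \<open>T\<close> with coefficients in \<open>V\<close>;
  \<open>v \<otimes> T\<^sup>k\<close> is \<open>monom v k\<close>.\<close>

definition poly_extension :: "'v::zero set \<Rightarrow> 'v poly set" where
  "poly_extension V = {f. \<forall>i. coeff f i \<in> V}"

definition poly_scale :: "('a \<Rightarrow> 'v::zero \<Rightarrow> 'v) \<Rightarrow> 'a \<Rightarrow> 'v poly \<Rightarrow> 'v poly" where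
  "poly_scale scale c f = map_poly (scale c) f"

definition poly_bracket ::
  "('v::ab_group_add \<Rightarrow> 'v \<Rightarrow> 'v) \<Rightarrow> 'v poly \<Rightarrow> 'v poly \<Rightarrow> 'v poly" where
  "poly_bracket bracket f g =
     (\<Sum>i\<le>degree f. \<Sum>j\<le>degree g. monom (bracket (coeff f i) (coeff g j)) (i + j))"

text \<open>\<open>V1\<close> is the component of degree 1 of a grading of \<open>V\<close> over the integers modulo \<open>N\<close>.\<close>

definition loop_algebra ::
  "('a::field \<Rightarrow> 'v::ab_group_add \<Rightarrow> 'v) \<Rightarrow> ('v \<Rightarrow> 'v \<Rightarrow> 'v) \<Rightarrow> 'v set \<Rightarrow> 'v set \<Rightarrow> 'v poly set" where
  "loop_algebra scale bracket V V1 =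
     generated_lie_subalgebra (poly_scale scale) (poly_bracket bracket) (poly_extension V)
       ((\<lambda>v. monom v 1) ` V1)"

definition loop_component :: "'v::zero poly set \<Rightarrow> nat \<Rightarrow> 'v poly set" where
  "loop_component L k = L \<inter> range (\<lambda>v. monom v k)"

section \<open>Thin Lie algebras and diamonds\<close>

definition thin ::
  "('a::field \<Rightarrow> 'v::ab_group_add \<Rightarrow> 'v) \<Rightarrow> ('v \<Rightarrow> 'v \<Rightarrow> 'v) \<Rightarrow> 'v set \<Rightarrow> (nat \<Rightarrow> 'v set) \<Rightarrow> bool" where
  "thin scale bracket L M \<longleftrightarrow>
     lie_grading scale bracket L {1..} (+) M \<and>
     (\<nexists>B. finite B \<and> L \<subseteq> module.span scale B) \<and>
     vector_space.dim scale (M 1) = 2 \<and>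
     (\<forall>i\<ge>1. \<forall>u\<in>M i. u \<noteq> 0 \<longrightarrow> M (i + 1) = bracket u ` M 1) \<and>
     (\<exists>i>1. vector_space.dim scale (M i) = 2)"

definition second_diamond ::
  "('a::field \<Rightarrow> 'v::ab_group_add \<Rightarrow> 'v) \<Rightarrow> (nat \<Rightarrow> 'v set) \<Rightarrow> nat \<Rightarrow> bool" where
  "second_diamond scale M q \<longleftrightarrow>
     q > 1 \<and> vector_space.dim scale (M q) = 2 \<and>
     (\<forall>i. 1 < i \<and> i < q \<longrightarrow> vector_space.dim scale (M i) \<noteq> 2)"

text \<open>For \<open>q > 3\<close> the generators \<open>X\<close> and \<open>Y\<close> are unique up to scalars.  For \<open>q = 3\<close> the
  condition \<open>[L\<^sub>2, Y] = 0\<close> is dropped, and then \<open>X\<close> and \<open>Y\<close> may also be interchanged, which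
  replaces each finite type \<open>\<mu>\<close> by \<open>1 - \<mu>\<close>.\<close>

definition diamond_generators ::
  "('a::field \<Rightarrow> 'v::ab_group_add \<Rightarrow> 'v) \<Rightarrow> ('v \<Rightarrow> 'v \<Rightarrow> 'v) \<Rightarrow> (nat \<Rightarrow> 'v set) \<Rightarrow> nat \<Rightarrow>
     'v \<Rightarrow> 'v \<Rightarrow> bool" where
  "diamond_generators scale bracket M q X Y \<longleftrightarrow>
     X \<in> M 1 \<and> Y \<in> M 1 \<and> module.span scale {X, Y} = M 1 \<and>
     Y \<noteq> 0 \<and> X \<notin> module.span scale {Y} \<and>
     (q > 3 \<longrightarrow> (\<forall>W\<in>M 2. bracket W Y = 0)) \<and>
     (\<forall>V\<in>M (q - 1). V \<noteq> 0 \<longrightarrow>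
        bracket (bracket V X) X = 0 \<and> bracket (bracket V Y) Y = 0 \<and>
        bracket (bracket V Y) X = scale (- 2) (bracket (bracket V X) Y))"

definition finite_type_relations ::
  "('a::field \<Rightarrow> 'v::ab_group_add \<Rightarrow> 'v) \<Rightarrow> ('v \<Rightarrow> 'v \<Rightarrow> 'v) \<Rightarrow> (nat \<Rightarrow> 'v set) \<Rightarrow>
     'v \<Rightarrow> 'v \<Rightarrow> nat \<Rightarrow> 'a \<Rightarrow> bool" where
  "finite_type_relations scale bracket M X Y i \<mu> \<longleftrightarrow>
     i > 1 \<and> vector_space.dim scale (M (i - 1)) = 1 \<and>
     (\<forall>V\<in>M (i - 1). V \<noteq> 0 \<longrightarrow>
        bracket (bracket V Y) Y = 0 \<and> bracket (bracket V X) X = 0 \<and>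
        scale (1 - \<mu>) (bracket (bracket V X) Y) = scale \<mu> (bracket (bracket V Y) X))"

definition fake_diamond ::
  "('a::field \<Rightarrow> 'v::ab_group_add \<Rightarrow> 'v) \<Rightarrow> ('v \<Rightarrow> 'v \<Rightarrow> 'v) \<Rightarrow> (nat \<Rightarrow> 'v set) \<Rightarrow> nat \<Rightarrow>
     'v \<Rightarrow> 'v \<Rightarrow> nat \<Rightarrow> 'a \<Rightarrow> bool" where
  "fake_diamond scale bracket M q X Y i \<mu> \<longleftrightarrow>
     vector_space.dim scale (M i) = 1 \<and> [i = 1] (mod (q - 1)) \<and> \<mu> \<in> {0, 1} \<and>
     finite_type_relations scale bracket M X Y i \<mu>"

definition is_diamond ::
  "('a::field \<Rightarrow> 'v::ab_group_add \<Rightarrow> 'v) \<Rightarrow> ('v \<Rightarrow> 'v \<Rightarrow> 'v) \<Rightarrow> (nat \<Rightarrow> 'v set) \<Rightarrow> nat \<Rightarrow>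
     'v \<Rightarrow> 'v \<Rightarrow> nat \<Rightarrow> bool" where
  "is_diamond scale bracket M q X Y i \<longleftrightarrow>
     i \<ge> 1 \<and> (vector_space.dim scale (M i) = 2 \<or> (\<exists>\<mu>. fake_diamond scale bracket M q X Y i \<mu>))"

definition has_finite_type ::
  "('a::field \<Rightarrow> 'v::ab_group_add \<Rightarrow> 'v) \<Rightarrow> ('v \<Rightarrow> 'v \<Rightarrow> 'v) \<Rightarrow> (nat \<Rightarrow> 'v set) \<Rightarrow> nat \<Rightarrow>
     'v \<Rightarrow> 'v \<Rightarrow> nat \<Rightarrow> 'a \<Rightarrow> bool" where
  "has_finite_type scale bracket M q X Y i \<mu> \<longleftrightarrow>
     (vector_space.dim scale (M i) = 2 \<and> finite_type_relations scale bracket M X Y i \<mu>) \<or>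
     fake_diamond scale bracket M q X Y i \<mu>"

definition has_infinite_type ::
  "('a::field \<Rightarrow> 'v::ab_group_add \<Rightarrow> 'v) \<Rightarrow> ('v \<Rightarrow> 'v \<Rightarrow> 'v) \<Rightarrow> (nat \<Rightarrow> 'v set) \<Rightarrow>
     'v \<Rightarrow> 'v \<Rightarrow> nat \<Rightarrow> bool" where
  "has_infinite_type scale bracket M X Y i \<longleftrightarrow>
     i > 1 \<and> vector_space.dim scale (M i) = 2 \<and> vector_space.dim scale (M (i - 1)) = 1 \<and>
     (\<forall>V\<in>M (i - 1). V \<noteq> 0 \<longrightarrow>
        bracket (bracket V Y) Y = 0 \<and> bracket (bracket V X) X = 0 \<and>
        - bracket (bracket V X) Y = bracket (bracket V Y) X)"

section \<open>Divided powers and the graded Hamiltonian algebra\<close>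

text \<open>An element of the divided power algebra is given by its coefficient function:
  \<open>f i j\<close> is the coefficient of the monomial \<open>x^(i) y^(j)\<close>.  Exponents are integers in \<open>dp_monom\<close>, which
  is \<open>0\<close> when they are out of range.\<close>

definition fun_scale :: "'a::field \<Rightarrow> (nat \<Rightarrow> nat \<Rightarrow> 'a) \<Rightarrow> nat \<Rightarrow> nat \<Rightarrow> 'a" where
  "fun_scale c f = (\<lambda>i j. c * f i j)"

definition dp_monom :: "nat \<Rightarrow> nat \<Rightarrow> int \<Rightarrow> int \<Rightarrow> nat \<Rightarrow> nat \<Rightarrow> 'a::field" where
  "dp_monom n1 n2 i j =
     (\<lambda>a b. if int a = i \<and> int b = j \<and> a < CHAR('a) ^ n1 \<and> b < CHAR('a) ^ n2 then 1 else 0)"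

definition dp_mult ::
  "nat \<Rightarrow> nat \<Rightarrow> (nat \<Rightarrow> nat \<Rightarrow> 'a::field) \<Rightarrow> (nat \<Rightarrow> nat \<Rightarrow> 'a) \<Rightarrow> nat \<Rightarrow> nat \<Rightarrow> 'a" where
  "dp_mult n1 n2 f g =
     (\<Sum>i<CHAR('a) ^ n1. \<Sum>j<CHAR('a) ^ n2. \<Sum>k<CHAR('a) ^ n1. \<Sum>l<CHAR('a) ^ n2.
        fun_scale (f i j * g k l * of_nat ((i + k) choose i) * of_nat ((j + l) choose j))
          (dp_monom n1 n2 (int i + int k) (int j + int l)))"

definition dp_power ::
  "nat \<Rightarrow> nat \<Rightarrow> (nat \<Rightarrow> nat \<Rightarrow> 'a::field) \<Rightarrow> nat \<Rightarrow> nat \<Rightarrow> nat \<Rightarrow> 'a" where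
  "dp_power n1 n2 f a = (dp_mult n1 n2 f ^^ a) (dp_monom n1 n2 0 0)"

text \<open>The representative modulo the constants that has constant term \<open>0\<close>.\<close>

definition mod_constants :: "(nat \<Rightarrow> nat \<Rightarrow> 'a::field) \<Rightarrow> nat \<Rightarrow> nat \<Rightarrow> 'a" where
  "mod_constants f = (\<lambda>i j. if i = 0 \<and> j = 0 then 0 else f i j)"

definition hamiltonian_algebra :: "nat \<Rightarrow> nat \<Rightarrow> (nat \<Rightarrow> nat \<Rightarrow> 'a::field) set" where
  "hamiltonian_algebra n1 n2 = module.span fun_scale
     {dp_monom n1 n2 (int i) (int j) | i j. i < CHAR('a) ^ n1 \<and> j < CHAR('a) ^ n2 \<and>
        (i, j) \<noteq> (0, 0) \<and> (i, j) \<noteq> (CHAR('a) ^ n1 - 1, CHAR('a) ^ n2 - 1)}"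

definition hamiltonian_bracket ::
  "nat \<Rightarrow> nat \<Rightarrow> (nat \<Rightarrow> nat \<Rightarrow> 'a::field) \<Rightarrow> (nat \<Rightarrow> nat \<Rightarrow> 'a) \<Rightarrow> nat \<Rightarrow> nat \<Rightarrow> 'a" where
  "hamiltonian_bracket n1 n2 f g = mod_constants
     (\<Sum>i<CHAR('a) ^ n1. \<Sum>j<CHAR('a) ^ n2. \<Sum>k<CHAR('a) ^ n1. \<Sum>l<CHAR('a) ^ n2.
        fun_scale (f i j * g k l)
          (dp_mult n1 n2 (dp_monom n1 n2 (int i) (int j - 1)) (dp_monom n1 n2 (int k - 1) (int l)) -
           dp_mult n1 n2 (dp_monom n1 n2 (int i - 1) (int j)) (dp_monom n1 n2 (int k) (int l - 1))))"

text \<open>The indices \<open>(j, k, a)\<close>, elements and degrees of the alternative basis; \<open>m\<close> is an integer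
  representing \<open>\<pi>\<close>.\<close>

definition ham_index :: "nat \<Rightarrow> nat \<Rightarrow> nat \<Rightarrow> (int \<times> int \<times> nat) set" where
  "ham_index p s n =
     {(j, k, a). a < p \<and> -1 \<le> k \<and> k < int p ^ s - 1 \<and> -1 \<le> j \<and> j < int p ^ n - 1}
       - {(-1, -1, 0), (int p ^ n - 2, int p ^ s - 2, p - 1)}"

definition ham_element :: "nat \<Rightarrow> nat \<Rightarrow> int \<times> int \<times> nat \<Rightarrow> nat \<Rightarrow> nat \<Rightarrow> 'a::field" where
  "ham_element s n = (\<lambda>(j, k, a). mod_constants
     (dp_mult (s + 1) n
        (dp_power (s + 1) n
           (dp_monom (s + 1) n 0 0 + dp_monom (s + 1) n (int CHAR('a) ^ s) 0) a)
        (dp_monom (s + 1) n (k + 1) (j + 1))))"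

definition ham_degree :: "nat \<Rightarrow> nat \<Rightarrow> nat \<Rightarrow> int \<Rightarrow> int \<times> int \<times> nat \<Rightarrow> int" where
  "ham_degree p s n m = (\<lambda>(j, k, a).
     (1 - int p ^ n) * ((int a + j * m) * int p ^ s + k) - j)"

text \<open>In positive characteristic the prime subfield is the image of the integers.\<close>

definition prime_subfield :: "'a::field set" where
  "prime_subfield = range of_int"

end

theory Submission
  imports Defs
begin

text \<open>
  The Hamiltonian bracket is the Poisson bracket of the divided power algebra, which in
  characteristic \<open>p\<close> is a subalgebra of the ring of all series in divided powers, since exponents
  that are out of range come with binomial coefficients that vanish.  Writing the Poisson bracket
  as a divergence shows that the top monomial never occurs in it.

  With \<open>w = p\<^sup>s\<close> and \<open>E = 1 + x^(w)\<close> one has \<open>E\<^sup>p = 1\<close>, so exponents of \<open>E\<close> are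
  integers modulo \<open>p\<close>, and \<open>D\<^sub>x E = x^(w - 1)\<close>.  Degree 1 is spanned by \<open>X = E\<^sup>\<pi> x\<close> and
  \<open>Y = E^(2\<pi>) y^(q - 1)\<close>: bracketing with \<open>X\<close> lowers the exponent of \<open>y\<close>, and bracketing with
  \<open>Y\<close> vanishes except on elements with \<open>y\<close>-exponent 0 or 1, where it restores a high
  \<open>y\<close>-exponent and lowers the exponent of \<open>x\<close>.  Hence the components of the loop algebra form a
  chain of one-dimensional components with diamonds at regular distance \<open>q - 1\<close>.  Once in \<open>w\<close>
  diamonds the exponent of \<open>x\<close> passes from 0 to \<open>w - 1\<close>, the derivative hits \<open>E\<close> instead of \<open>x\<close> and
  contributes its exponent as a coefficient: this produces the finite types and, when the
  coefficient vanishes, the fake diamonds.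
\<close>

section \<open>Chains of diamonds\<close>

text \<open>A diamond is governed by two scalars. If V spans the component before diamond number t,
  then [V,X,Y] and [V,Y,X] are -a_t and b_t times one and the same vector, while [V,X,X] and [V,Y,Y]
  vanish. Where a_t = b_t the type is infinite; where b_t = a_t + \<pi> it is -a_t/\<pi>, so that a
  linear decrease of a_t becomes an arithmetic progression of types. The two kinds of fake diamond
  reflect the two monomials missing from the Hamiltonian algebra: a_t = 0 when the vector without y
  is the constant 1, b_t = 0 when the vector with y^(q - 1) would involve the top monomial. The
  brackets with X and Y are the axioms of a locale used twice: in the Hamiltonian algebra, where
  components recur modulo N, and in the loop algebra, where they do not. These axioms concern
  brackets with degree one only; that arbitrary components multiply as a grading requires is taken
  from the graded basis. The defining relations determine X and Y up to scalars and, for q = 3,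
  exchange, and an exchange replaces \<mu> by 1 - \<mu>; both cases are carried through.\<close>

lemma (in module) span_pair: "span {x, y} = {scale c x + scale d y | c d. True}"
proof -
  have "v \<in> span {x, y} \<longleftrightarrow> (\<exists>c d. v = scale c x + scale d y)" for v
    by (auto simp: span_insert span_singleton algebra_simps image_iff)
  then show ?thesis by auto
qed

text \<open>For c = \<pi> this is, up to sign, the factor in [A_t, Y]; for c = 2 \<pi> it is the
  factor in the bracket of Y with the vector just before diamond t. It can differ from 1 only once
  in w diamonds, when the x-exponent is 0 and the derivative falls on a power of E.\<close>

definition chain_coeff :: "nat \<Rightarrow> 'a::field \<Rightarrow> nat \<Rightarrow> 'a" where
  "chain_coeff w c t = (if t mod w = 1 then c - of_nat (t div w) else 1)"

text \<open>Quotient t and remainder u of i - 1 modulo q - 1 locate a degree: u = 0 is diamond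
  number t, and u > 0 is the u-th line after it. Degree 0 gets the zero space because the loop
  algebra lives in positive degrees.\<close>

definition chain_component ::
  "('a::field \<Rightarrow> 'v::ab_group_add \<Rightarrow> 'v) \<Rightarrow> nat \<Rightarrow> (nat \<Rightarrow> 'v) \<Rightarrow> (nat \<Rightarrow> 'v) \<Rightarrow> (nat \<Rightarrow> nat \<Rightarrow> 'v) \<Rightarrow>
     nat \<Rightarrow> 'v set" where
  "chain_component scale q A B C i =
     (if i = 0 then {0}
      else if (i - 1) mod (q - 1) = 0
      then module.span scale {A ((i - 1) div (q - 1)), B ((i - 1) div (q - 1))}
      else module.span scale {C ((i - 1) div (q - 1)) ((i - 1) mod (q - 1))})"

text \<open>A fake diamond occurs in degree \<open>t (q - 1) + 1\<close> where \<open>chain_coeff w \<pi> t\<close> or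
  \<open>chain_coeff w (2 * \<pi>) t\<close> vanishes.\<close>

locale diamond_chain = lie_algebra scale bracket V
  for scale :: "'a::field \<Rightarrow> 'v::ab_group_add \<Rightarrow> 'v" and bracket and V +
  fixes q w :: nat and \<pi> :: 'a and A B :: "nat \<Rightarrow> 'v" and C :: "nat \<Rightarrow> nat \<Rightarrow> 'v"
  assumes q_ge_3: "q \<ge> 3" and w_gt_1: "w > 1" and \<pi>_nonzero: "\<pi> \<noteq> 0" and two_nonzero: "(2::'a) \<noteq> 0"
    and A_in: "A t \<in> V" and B_in: "B t \<in> V" and C_in: "0 < u \<Longrightarrow> u < q - 1 \<Longrightarrow> C t u \<in> V"
    and A_eq_0: "A t = 0 \<longleftrightarrow> chain_coeff w \<pi> t = 0"
    and B_eq_0: "B t = 0 \<longleftrightarrow> chain_coeff w (2 * \<pi>) t = 0"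
    and C_nonzero: "0 < u \<Longrightarrow> u < q - 1 \<Longrightarrow> C t u \<noteq> 0"
    and A_B_independent: "scale c (A t) + scale d (B t) = 0 \<Longrightarrow> scale c (A t) = 0"
    and A_A: "bracket (A t) (A 0) = 0"
    and A_B: "bracket (A t) (B 0) = scale (- chain_coeff w \<pi> t) (C t 1)"
    and B_A: "chain_coeff w (2 * \<pi>) t \<noteq> 0 \<Longrightarrow> bracket (B t) (A 0) = C t 1"
    and B_B: "bracket (B t) (B 0) = 0"
    and C_A: "0 < u \<Longrightarrow> u < q - 2 \<Longrightarrow> bracket (C t u) (A 0) = C t (u + 1)"
    and C_A_last: "bracket (C t (q - 2)) (A 0) = A (t + 1)"
    and C_B: "0 < u \<Longrightarrow> u < q - 2 \<Longrightarrow> bracket (C t u) (B 0) = 0"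
    and C_B_last: "bracket (C t (q - 2)) (B 0) = scale (chain_coeff w (2 * \<pi>) (t + 1)) (B (t + 1))"
begin

abbreviation a :: "nat \<Rightarrow> 'a" where "a \<equiv> chain_coeff w \<pi>"
abbreviation b :: "nat \<Rightarrow> 'a" where "b \<equiv> chain_coeff w (2 * \<pi>)"
abbreviation component :: "nat \<Rightarrow> 'v set" where "component \<equiv> chain_component scale q A B C"

section \<open>Components of a chain and their brackets with degree one\<close>

lemma component_diamond: "component (t * (q - 1) + 1) = span {A t, B t}"
  using q_ge_3 by (simp add: chain_component_def)

lemma component_diamond_elements:
  "component (t * (q - 1) + 1) = {scale c (A t) + scale d (B t) | c d. True}"
  by (simp only: component_diamond span_pair)

lemma component_one: "component 1 = {scale c (A 0) + scale d (B 0) | c d. True}"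
  using component_diamond_elements[of 0] by simp

lemma image_component_one:
  "f ` component 1 = {f (scale g (A 0) + scale h (B 0)) | g h. True}"
  unfolding component_one by blast

lemma component_line:
  assumes "0 < u" "u < q - 1"
  shows "component (t * (q - 1) + 1 + u) = span {C t u}"
  using assms by (simp add: chain_component_def)

lemma component_line_elements:
  assumes "0 < u" "u < q - 1"
  shows "component (t * (q - 1) + 1 + u) = range (\<lambda>c. scale c (C t u))"
  using component_line[OF assms] by (simp add: span_singleton)

lemma degree_cases:
  assumes "i \<ge> (1::nat)"
  obtains (diamond) t where "i = t * (q - 1) + 1"
  | (line) t u where "i = t * (q - 1) + 1 + u" "0 < u" "u < q - 1"
proof (cases "(i - 1) mod (q - 1) = 0")
  case True
  then have "i = (i - 1) div (q - 1) * (q - 1) + 1"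
    using assms by (metis add.commute add.right_neutral div_mult_mod_eq le_add_diff_inverse)
  then show ?thesis by (rule diamond)
next
  case False
  have "i = (i - 1) div (q - 1) * (q - 1) + 1 + (i - 1) mod (q - 1)"
    using assms div_mult_mod_eq[of "i - 1" "q - 1"] by linarith
  then show ?thesis
    using False q_ge_3 by (intro line) auto
qed

lemma a_0: "a 0 = 1" and b_0: "b 0 = 1"
  using w_gt_1 by (auto simp: chain_coeff_def)

lemma coeff_1: "chain_coeff w c (Suc 0) = c"
  using w_gt_1 by (simp add: chain_coeff_def)

lemma b_minus_a: "b t - a t = (if t mod w = 1 then \<pi> else 0)"
  by (simp add: chain_coeff_def)

text \<open>The two scalars differ by \<pi> if t mod w = 1 and are both 1 otherwise. So a diamond
  never loses both of its generators.\<close>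

lemma a_b_not_both_0: "a t \<noteq> 0 \<or> b t \<noteq> 0"
  using \<pi>_nonzero by (auto simp: chain_coeff_def)

lemma bracket_comb:
  assumes "v \<in> V" "v' \<in> V" "x \<in> V" "y \<in> V"
  shows "bracket (scale c v + scale d v') (scale g x + scale h y) =
    scale (c * g) (bracket v x) + scale (c * h) (bracket v y) +
    scale (d * g) (bracket v' x) + scale (d * h) (bracket v' y)"
  using assms subspace_V
  by (simp add: bracket_add_left bracket_add_right bracket_scale_left bracket_scale_right
      subspace_scale subspace_add scale_right_distrib algebra_simps)

text \<open>The coefficient of d * g is an indicator rather than \<open>b t\<close>: B_t is
  normalised to have bracket exactly \<open>C t 1\<close> with A_0, except where B_t itself is
  0.\<close>

lemma bracket_diamond:
  "bracket (scale c (A t) + scale d (B t)) (scale g (A 0) + scale h (B 0)) =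
   scale (d * g * (if b t = 0 then 0 else 1) - c * h * a t) (C t 1)"
proof (cases "b t = 0")
  case True
  then have "B t = 0" using B_eq_0 by simp
  moreover have "bracket 0 x = 0" if "x \<in> V" for x
    using bracket_scale_left[OF subspace_0[OF subspace_V] that, of 0] by simp
  ultimately show ?thesis
    using True bracket_comb[OF A_in[of t] B_in[of t] A_in[of 0] B_in[of 0]] A_A A_B A_in B_in
    by (simp add: mult.commute mult.left_commute)
next
  case False
  then show ?thesis
    using bracket_comb[OF A_in[of t] B_in[of t] A_in[of 0] B_in[of 0]]
    by (simp add: A_A A_B B_A B_B scale_left_diff_distrib)
qed

lemma bracket_line:
  assumes "0 < u" "u < q - 2"
  shows "bracket (scale c (C t u)) (scale g (A 0) + scale h (B 0)) = scale (c * g) (C t (u + 1))"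
  using bracket_comb[of "C t u" 0 "A 0" "B 0" c 0 g h] C_A C_B A_in B_in C_in assms subspace_0[OF subspace_V]
  by simp

lemma bracket_line_last:
  "bracket (scale c (C t (q - 2))) (scale g (A 0) + scale h (B 0)) =
   scale (c * g) (A (t + 1)) + scale (c * h * b (t + 1)) (B (t + 1))"
  using bracket_comb[of "C t (q - 2)" 0 "A 0" "B 0" c 0 g h] C_A_last C_B_last A_in B_in
    C_in[of "q - 2"] q_ge_3 subspace_0[OF subspace_V]
  by simp

text \<open>All types are read off from this formula. The factor \<open>b (t + 1)\<close> of
  \<open>C_B_last\<close> absorbs the indicator of \<open>bracket_diamond\<close>, since both vanish
  together, so the two orders of A_0 and B_0 yield -a and b times the same vector.\<close>

lemma bracket_line_last_twice:
  "bracket (bracket (scale c (C t (q - 2))) (scale g (A 0) + scale h (B 0)))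
     (scale g' (A 0) + scale h' (B 0)) =
   scale (c * (g' * h * b (t + 1) - g * h' * a (t + 1))) (C (t + 1) 1)"
  by (simp add: bracket_line_last bracket_diamond algebra_simps)

lemma component_subset: "i \<ge> 1 \<Longrightarrow> component i \<subseteq> V"
proof (erule degree_cases)
  fix t assume "i = t * (q - 1) + 1"
  then show ?thesis
    using component_diamond span_minimal[OF _ subspace_V] A_in B_in by auto
next
  fix t u assume "i = t * (q - 1) + 1 + u" "0 < u" "u < q - 1"
  then show ?thesis
    using component_line[of u t] span_minimal[OF _ subspace_V, of "{C t u}"] C_in by auto
qed

lemma subspace_component: "subspace (component i)"
  by (simp add: chain_component_def)

lemma component_nontrivial: assumes "i \<ge> 1" shows "\<exists>v\<in>component i. v \<noteq> 0"
  using assms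
proof (cases rule: degree_cases)
  case (diamond t)
  have "A t \<in> span {A t, B t}" "B t \<in> span {A t, B t}" by (auto intro: span_base)
  then show ?thesis
    using a_b_not_both_0[of t] A_eq_0 B_eq_0 component_diamond[of t] diamond by metis
next
  case (line t u)
  then show ?thesis
    using component_line[of u t] C_nonzero span_base[of "C t u" "{C t u}"] by auto
qed

text \<open>Out of a diamond, the image lies in a line, and it fills the line because a nonzero v
  has a nonzero coefficient at A_t or B_t with a nonzero scalar attached. Along a line only A_0
  acts, until the last step, where A_0 and B_0 produce the two generators of the next diamond
  separately.\<close>

lemma covering:
  assumes "i \<ge> 1" "v \<in> component i" "v \<noteq> 0"
  shows "component (i + 1) = bracket v ` component 1"
  using assms(1)
proof (cases rule: degree_cases)
  case (diamond t)
  obtain c d where v: "v = scale c (A t) + scale d (B t)"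
    using assms(2) diamond component_diamond_elements by auto
  define \<beta> where "\<beta> = (if b t = 0 then 0 else (1::'a))"
  have nz: "c * a t \<noteq> 0 \<or> d * \<beta> \<noteq> 0"
    using assms(3) v A_eq_0[of t] B_eq_0[of t] by (auto simp: \<beta>_def split: if_splits)
  have image: "bracket v ` component 1 = {scale (d * g * \<beta> - c * h * a t) (C t 1) | g h. True}"
    unfolding image_component_one v \<beta>_def bracket_diamond ..
  have surj: "\<exists>g h. e = d * g * \<beta> - c * h * a t" for e
  proof (cases "d * \<beta> = 0")
    case True
    then show ?thesis
      using nz by (intro exI[of _ 0] exI[of _ "- e / (c * a t)"]) (auto simp: field_simps)
  next
    case False
    then show ?thesis
      by (intro exI[of _ "e / (d * \<beta>)"] exI[of _ 0]) (auto simp: field_simps)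
  qed
  have "component (i + 1) = range (\<lambda>e. scale e (C t 1))"
    using component_line_elements[of 1 t] q_ge_3 diamond by simp
  also have "\<dots> = bracket v ` component 1"
    unfolding image
  proof (intro equalityI subsetI)
    fix x assume "x \<in> range (\<lambda>e. scale e (C t 1))"
    then obtain e where "x = scale e (C t 1)" by blast
    moreover obtain g h where "e = d * g * \<beta> - c * h * a t" using surj by blast
    ultimately show "x \<in> {scale (d * g * \<beta> - c * h * a t) (C t 1) | g h. True}" by blast
  qed blast
  finally show ?thesis .
next
  case (line t u)
  obtain c where v: "v = scale c (C t u)"
    using assms(2) line component_line_elements by auto
  have c: "c \<noteq> 0" using v assms(3) by auto
  show ?thesis
  proof (cases "u < q - 2")
    case True
    have "component (i + 1) = range (\<lambda>e. scale e (C t (u + 1)))"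
      using component_line_elements[of "u + 1" t] line True by simp
    also have "\<dots> = {scale (c * g) (C t (u + 1)) | (g::'a) (h::'a). True}"
    proof -
      have "scale e (C t (u + 1)) = scale (c * (e / c)) (C t (u + 1))" for e using c by simp
      then show ?thesis by blast
    qed
    also have "\<dots> = bracket v ` component 1"
      unfolding image_component_one v using line True by (simp only: bracket_line)
    finally show ?thesis .
  next
    case False
    then have u: "u = q - 2" using line by simp
    have i: "i + 1 = (t + 1) * (q - 1) + 1" using line u q_ge_3 by simp
    have "component (i + 1) = {scale g (A (t + 1)) + scale h (B (t + 1)) | g h. True}"
      using component_diamond_elements[of "t + 1"] i by simp
    also have "\<dots> = {scale (c * g) (A (t + 1)) + scale (c * h * b (t + 1)) (B (t + 1)) | g h. True}"
      (is "_ = ?R")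
    proof -
      have "scale g (A (t + 1)) + scale h (B (t + 1)) \<in> ?R" for g h
      proof -
        \<comment> \<open>If \<open>b (t + 1)\<close> is 0, the quotient is the default value 0,
          which does no harm as \<open>B (t + 1)\<close> is 0 too.\<close>
        have "scale g (A (t + 1)) + scale h (B (t + 1)) =
          scale (c * (g / c)) (A (t + 1)) + scale (c * (h / (c * b (t + 1))) * b (t + 1)) (B (t + 1))"
          using c B_eq_0[of "t + 1"] by (cases "b (t + 1) = 0") auto
        then show ?thesis by blast
      qed
      then show ?thesis by blast
    qed
    also have "\<dots> = bracket v ` component 1"
      unfolding image_component_one v u bracket_line_last ..
    finally show ?thesis .
  qed
qed

section \<open>Dimensions, second diamond and thinness\<close>

lemma dim_line:
  assumes "0 < u" "u < q - 1"
  shows "dim (component (t * (q - 1) + 1 + u)) = 1"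
  using component_line[OF assms] C_nonzero[OF assms] dim_span_eq_card_independent[of "{C t u}"] by simp

lemma dim_diamond:
  "dim (component (t * (q - 1) + 1)) = (if a t = 0 \<or> b t = 0 then 1 else 2)"
proof -
  consider "a t = 0" "b t \<noteq> 0" | "a t \<noteq> 0" "b t = 0" | "a t \<noteq> 0" "b t \<noteq> 0"
    using a_b_not_both_0[of t] by blast
  then show ?thesis
  proof cases
    case 1
    then show ?thesis
      using A_eq_0[of t] B_eq_0[of t] component_diamond[of t] dim_span_eq_card_independent[of "{B t}"]
      by (simp del: dim_span)
  next
    case 2
    then show ?thesis
      using A_eq_0[of t] B_eq_0[of t] component_diamond[of t] dim_span_eq_card_independent[of "{A t}"]
      by (simp add: insert_commute del: dim_span)
  next
    case 3
    then have nz: "A t \<noteq> 0" "B t \<noteq> 0" using A_eq_0 B_eq_0 by auto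
    have "A t \<notin> span {B t}"
    proof
      assume "A t \<in> span {B t}"
      then obtain k where "A t = scale k (B t)" by (auto simp: span_singleton)
      then have "scale 1 (A t) + scale (- k) (B t) = 0" by simp
      then show False using A_B_independent nz by fastforce
    qed
    then have "independent {A t, B t}" "A t \<noteq> B t"
      using nz by (auto simp: independent_insert span_base)
    then show ?thesis
      using 3 component_diamond[of t] dim_span_eq_card_independent[of "{A t, B t}"] by simp
  qed
qed

lemma dim_component_eq_2: 
  assumes "i \<ge> 1" "dim (component i) = 2" shows "\<exists>t. i = t * (q - 1) + 1"
  using assms(1)
proof (cases rule: degree_cases)
  case (line t u)
  then show ?thesis using assms(2) dim_line[of u t] by simp
qed blast

lemma dim_one: "dim (component 1) = 2"
  using dim_diamond[of 0] by (simp add: a_0 b_0)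

lemma dim_q: "dim (component q) = 2"
  using dim_diamond[of 1] q_ge_3 \<pi>_nonzero two_nonzero by (simp add: coeff_1)

lemma chain_second_diamond: "second_diamond scale component q"
  unfolding second_diamond_def
proof (intro conjI allI impI)
  fix i assume i: "1 < i \<and> i < q"
  then have "0 * (q - 1) + 1 + (i - 1) = i" by simp
  then have "dim (component i) = 1"
    using dim_line[of "i - 1" 0] i by (metis diff_less_mono less_imp_le zero_less_diff)
  then show "dim (component i) \<noteq> 2" by simp
qed (use q_ge_3 dim_q in auto)

text \<open>The two assumptions fail in the Hamiltonian algebra, which is finite dimensional and
  graded only modulo N; the loop algebra supplies them.\<close>

lemma chain_thin:
  assumes "lie_grading scale bracket V {1..} (+) component"
    and "\<nexists>B. finite B \<and> V \<subseteq> span B"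
  shows "thin scale bracket V component"
  unfolding thin_def using assms covering dim_one dim_q q_ge_3
  by (intro conjI) (auto intro!: exI[of _ q])

section \<open>The generators X and Y of a thin algebra\<close>

lemma diamond_generators_A_B: "diamond_generators scale bracket component q (A 0) (B 0)"
proof -
  have nz: "A 0 \<noteq> 0" "B 0 \<noteq> 0" using A_eq_0 B_eq_0 a_0 b_0 by auto
  have *: "A 0 \<notin> span {B 0}"
  proof
    assume "A 0 \<in> span {B 0}"
    then obtain k where "A 0 = scale k (B 0)" by (auto simp: span_singleton)
    then have "scale 1 (A 0) + scale (- k) (B 0) = 0" by simp
    then show False using A_B_independent nz by fastforce
  qed
  have c1: "component (Suc 0) = span {A 0, B 0}" using component_diamond[of 0] by simp
  have L2: "bracket W (B 0) = 0" if q: "q > 3" and W: "W \<in> component 2" for W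
  proof -
    obtain c where "W = scale c (C 0 1)"
      using q W component_line_elements[of 1 0] by (auto simp: numeral_2_eq_2 less_diff_conv)
    then show ?thesis
      using bracket_line[of 1 c 0 0 1] q B_in C_in[of 1 0] C_B[of 1 0] by (simp add: bracket_scale_left)
  qed
  \<comment> \<open>The factor -2 is the ratio of b_1 = 2 \<pi> to -a_1 = -\<pi>.\<close>
  have rel: "bracket (bracket W (A 0)) (A 0) = 0 \<and> bracket (bracket W (B 0)) (B 0) = 0 \<and>
      bracket (bracket W (B 0)) (A 0) = scale (- 2) (bracket (bracket W (A 0)) (B 0))"
    if W: "W \<in> component (q - 1)" for W
  proof -
    have "q - 1 = 0 * (q - 1) + 1 + (q - 2)" using q_ge_3 by simp
    then obtain c where "W = scale c (C 0 (q - 2))"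
      using W component_line_elements[of "q - 2" 0] q_ge_3 by auto
    then show ?thesis
      using bracket_line_last_twice[of c 0 1 0 1 0] bracket_line_last_twice[of c 0 0 1 0 1]
        bracket_line_last_twice[of c 0 0 1 1 0] bracket_line_last_twice[of c 0 1 0 0 1]
      by (simp add: coeff_1)
  qed
  show ?thesis
    unfolding diamond_generators_def using nz * c1 L2 rel by (auto intro: span_base)
qed

text \<open>\<open>X\<close> and \<open>Y\<close> can only be interchanged for \<open>q = 3\<close>, where the second diamond does not
  determine \<open>Y\<close>.\<close>

lemma diamond_generators_cases:
  assumes "diamond_generators scale bracket component q X Y"
  obtains g h where "X = scale g (A 0)" "Y = scale h (B 0)" "g \<noteq> 0" "h \<noteq> 0"
  | g h where "X = scale h (B 0)" "Y = scale g (A 0)" "g \<noteq> 0" "h \<noteq> 0" "q = 3"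
proof -
  have X1: "X \<in> component 1" and Y1: "Y \<in> component 1" and Y0: "Y \<noteq> 0" and XY: "X \<notin> span {Y}"
    and L2: "q > 3 \<Longrightarrow> \<forall>W\<in>component 2. bracket W Y = 0"
    and rel: "\<forall>V\<in>component (q - 1). V \<noteq> 0 \<longrightarrow>
        bracket (bracket V X) X = 0 \<and> bracket (bracket V Y) Y = 0 \<and>
        bracket (bracket V Y) X = scale (- 2) (bracket (bracket V X) Y)"
    using assms unfolding diamond_generators_def by blast+
  obtain x y where X: "X = scale x (A 0) + scale y (B 0)" using X1 component_one by auto
  obtain x' y' where Y: "Y = scale x' (A 0) + scale y' (B 0)" using Y1 component_one by auto
  let ?C = "C 0 (q - 2)"
  have q1: "q - 1 = 0 * (q - 1) + 1 + (q - 2)" using q_ge_3 by simp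
  have C: "?C \<in> component (q - 1)" "?C \<noteq> 0"
    using component_line[of "q - 2" 0] q1 q_ge_3 span_base[of ?C "{?C}"] C_nonzero[of "q - 2" 0] by auto
  have C1: "C 1 1 \<noteq> 0" using C_nonzero[of 1 1] q_ge_3 by simp
  \<comment> \<open>At the second diamond [V,X,X] has the scalar x y (b_1 - a_1) = x y \<pi>, and
    \<pi> is nonzero.\<close>
  have "x * y = 0"
    using rel C bracket_line_last_twice[of 1 0 x y x y] C1 \<pi>_nonzero unfolding X
    by (simp add: coeff_1 algebra_simps)
  moreover have "x' * y' = 0"
    using rel C bracket_line_last_twice[of 1 0 x' y' x' y'] C1 \<pi>_nonzero unfolding Y
    by (simp add: coeff_1 algebra_simps)
  \<comment> \<open>For q > 3 degree 3 is still a line, spanned by \<open>C 0 2\<close>, and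
    [C 0 1, Y] = x' C 0 2 because B_0 annihilates \<open>C 0 1\<close>.\<close>
  moreover have "x' = 0" if "q > 3"
  proof -
    have "C 0 1 \<in> component 2"
      using component_line[of 1 0] that span_base[of "C 0 1"] by (simp add: numeral_2_eq_2)
    then have "bracket (C 0 1) Y = 0" using L2 that by blast
    then have "scale x' (C 0 2) = 0"
      using bracket_line[of 1 1 0 x' y'] that Y by (simp add: numeral_2_eq_2)
    then show ?thesis using C_nonzero[of 2 0] that by simp
  qed
  moreover have "x \<noteq> 0" if "x' = 0"
  proof
    assume "x = 0"
    then have "X = scale (y / y') Y" using X Y Y0 that by auto
    then show False using XY span_singleton by auto
  qed
  moreover have "y \<noteq> 0" if "y' = 0"
  proof
    assume "y = 0"
    then have "X = scale (x / x') Y" using X Y Y0 that by auto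
    then show False using XY span_singleton by auto
  qed
  moreover have "x' \<noteq> 0 \<or> y' \<noteq> 0" using Y Y0 by auto
  moreover have "x' = 0 \<or> q = 3" using \<open>q > 3 \<Longrightarrow> x' = 0\<close> q_ge_3 by linarith
  ultimately show thesis
    using that(1)[of x y'] that(2)[of y x'] X Y by (cases "x' = 0") auto
qed

section \<open>Types of the diamonds\<close>

lemma before_diamond:
  assumes "t \<ge> 1"
  shows "component (t * (q - 1) + 1 - 1) = range (\<lambda>c. scale c (C (t - 1) (q - 2)))"
    and "dim (component (t * (q - 1) + 1 - 1)) = 1"
proof -
  have *: "t * (q - 1) + 1 - 1 = (t - 1) * (q - 1) + 1 + (q - 2)"
    using assms q_ge_3 by (cases t) auto
  show "component (t * (q - 1) + 1 - 1) = range (\<lambda>c. scale c (C (t - 1) (q - 2)))"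
    unfolding * using q_ge_3 by (intro component_line_elements) auto
  show "dim (component (t * (q - 1) + 1 - 1)) = 1"
    unfolding * using q_ge_3 by (intro dim_line) auto
qed

lemma ball_before_diamond:
  assumes "t \<ge> 1"
  shows "(\<forall>W\<in>component (t * (q - 1) + 1 - 1). P W) \<longleftrightarrow> (\<forall>c. P (scale c (C (t - 1) (q - 2))))"
  unfolding before_diamond(1)[OF assms] by blast

lemma diamond_degree_gt_1: "t \<ge> 1 \<Longrightarrow> t * (q - 1) + 1 > 1"
  using q_ge_3 by simp

context
  fixes x y x' y' :: 'a and X Y :: 'v
  assumes X: "X = scale x (A 0) + scale y (B 0)" and Y: "Y = scale x' (A 0) + scale y' (B 0)"
    and xy: "x * y = 0" and xy': "x' * y' = 0"
begin

text \<open>The conditions x y = 0 and x' y' = 0 cover both cases of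
  \<open>diamond_generators_cases\<close>, so the two orders of the generators share one
  computation.\<close>

lemma diamond_brackets:
  assumes "t \<ge> 1" and W: "W = scale c (C (t - 1) (q - 2))"
  shows "bracket (bracket W X) X = 0" "bracket (bracket W Y) Y = 0"
    "bracket (bracket W X) Y = scale (c * (x' * y * b t - x * y' * a t)) (C t 1)"
    "bracket (bracket W Y) X = scale (c * (x * y' * b t - x' * y * a t)) (C t 1)"
  unfolding X Y W bracket_line_last_twice using assms(1) xy xy' by (auto simp: algebra_simps)

lemma finite_type_relations_iff:
  assumes "t \<ge> 1"
  shows "finite_type_relations scale bracket component X Y (t * (q - 1) + 1) \<mu> \<longleftrightarrow>
    (1 - \<mu>) * (x' * y * b t - x * y' * a t) = \<mu> * (x * y' * b t - x' * y * a t)"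
    (is "?L \<longleftrightarrow> (1 - \<mu>) * ?P = \<mu> * ?Q")
proof -
  have C1: "C t 1 \<noteq> 0" "C (t - 1) (q - 2) \<noteq> 0"
    using C_nonzero q_ge_3 by auto
  have "?L \<longleftrightarrow> (\<forall>c. c \<noteq> 0 \<longrightarrow> scale ((1 - \<mu>) * (c * ?P)) (C t 1) = scale (\<mu> * (c * ?Q)) (C t 1))"
    unfolding finite_type_relations_def ball_before_diamond[OF assms] diamond_brackets[OF assms refl]
    using diamond_degree_gt_1[OF assms] before_diamond(2)[OF assms] C1 by simp
  also have "\<dots> \<longleftrightarrow> (\<forall>c. c \<noteq> 0 \<longrightarrow> c * ((1 - \<mu>) * ?P) = c * (\<mu> * ?Q))"
    using C1 by (simp add: mult.left_commute)
  also have "\<dots> \<longleftrightarrow> (1 - \<mu>) * ?P = \<mu> * ?Q"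
    by (metis mult_cancel_left one_neq_zero)
  finally show ?thesis .
qed

lemma has_infinite_type_iff:
  assumes "t \<ge> 1"
  shows "has_infinite_type scale bracket component X Y (t * (q - 1) + 1) \<longleftrightarrow>
    a t \<noteq> 0 \<and> b t \<noteq> 0 \<and> - (x' * y * b t - x * y' * a t) = x * y' * b t - x' * y * a t"
    (is "?L \<longleftrightarrow> _ \<and> _ \<and> - ?P = ?Q")
proof -
  have C1: "C t 1 \<noteq> 0" "C (t - 1) (q - 2) \<noteq> 0"
    using C_nonzero q_ge_3 by auto
  have "?L \<longleftrightarrow> a t \<noteq> 0 \<and> b t \<noteq> 0 \<and> (\<forall>c. c \<noteq> 0 \<longrightarrow> scale (- (c * ?P)) (C t 1) = scale (c * ?Q) (C t 1))"
    unfolding has_infinite_type_def ball_before_diamond[OF assms] diamond_brackets[OF assms refl]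
    using diamond_degree_gt_1[OF assms] before_diamond(2)[OF assms] dim_diamond[of t] C1 by simp
  also have "\<dots> \<longleftrightarrow> a t \<noteq> 0 \<and> b t \<noteq> 0 \<and> (\<forall>c. c \<noteq> 0 \<longrightarrow> c * (- ?P) = c * ?Q)"
    using C1 by (simp only: scale_cancel_right mult_minus_right) simp
  also have "\<dots> \<longleftrightarrow> a t \<noteq> 0 \<and> b t \<noteq> 0 \<and> - ?P = ?Q"
    by (metis mult_cancel_left one_neq_zero)
  finally show ?thesis .
qed

end

lemma diamond_degree_cong: "[t * (q - 1) + 1 = 1] (mod (q - 1))"
  using cong_add_rcancel_0_nat[of "t * (q - 1)" 1 "q - 1"] by (simp add: cong_0_iff)

lemma has_finite_type_iff:
  "has_finite_type scale bracket component q X Y (t * (q - 1) + 1) \<mu> \<longleftrightarrow>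
    finite_type_relations scale bracket component X Y (t * (q - 1) + 1) \<mu> \<and>
    (a t = 0 \<or> b t = 0 \<longrightarrow> \<mu> \<in> {0, 1})"
  using dim_diamond[of t] diamond_degree_cong[of t]
  by (auto simp: has_finite_type_def fake_diamond_def)

lemma cong_1_iff: "[t = 1] (mod w) \<longleftrightarrow> t mod w = 1"
  using w_gt_1 by (simp add: cong_def)

text \<open>After division by the scalars of X and Y, type \<mu> means \<mu> (b - a) = -a. If t mod
  w = 1, then b - a = \<pi> and \<mu> = -a/\<pi> solves this. Otherwise a = b = 1: no \<mu> does,
  but the relation of infinite type holds. For exchanged generators the solution is 1 + a/\<pi> =
  b/\<pi>.\<close>

lemma types:
  assumes gen: "diamond_generators scale bracket component q X Y" and t: "t \<ge> 1"
  shows "(\<exists>\<mu>. has_finite_type scale bracket component q X Y (t * (q - 1) + 1) \<mu>) \<longleftrightarrow> [t = 1] (mod w)"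
      (is ?fin)
    and "has_infinite_type scale bracket component X Y (t * (q - 1) + 1) \<longleftrightarrow> \<not> [t = 1] (mod w)"
      (is ?inf)
proof -
  have "?fin \<and> ?inf"
    using gen
  proof (cases rule: diamond_generators_cases)
    case (1 g h)
    have eq: "X = scale g (A 0) + scale 0 (B 0)" "Y = scale 0 (A 0) + scale h (B 0)"
      using 1 by simp_all
    have fin: "has_finite_type scale bracket component q X Y (t * (q - 1) + 1) \<mu> \<longleftrightarrow>
      - (1 - \<mu>) * a t = \<mu> * b t \<and> (a t = 0 \<or> b t = 0 \<longrightarrow> \<mu> \<in> {0, 1})" for \<mu>
    proof -
      have "(1 - \<mu>) * (0 * 0 * b t - g * h * a t) = \<mu> * (g * h * b t - 0 * 0 * a t) \<longleftrightarrow>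
        (g * h) * (- (1 - \<mu>) * a t) = (g * h) * (\<mu> * b t)" by (simp add: algebra_simps)
      also have "\<dots> \<longleftrightarrow> - (1 - \<mu>) * a t = \<mu> * b t" using 1 by simp
      finally show ?thesis
        unfolding has_finite_type_iff finite_type_relations_iff[OF eq mult_zero_right mult_zero_left t] by simp
    qed
    have inf: "has_infinite_type scale bracket component X Y (t * (q - 1) + 1) \<longleftrightarrow>
      a t \<noteq> 0 \<and> b t \<noteq> 0 \<and> a t = b t"
      unfolding has_infinite_type_iff[OF eq mult_zero_right mult_zero_left t] using 1 by simp
    show ?thesis
    proof (cases "t mod w = 1")
      case True
      then have ba: "b t = a t + \<pi>" using b_minus_a[of t] by (simp add: algebra_simps)
      \<comment> \<open>The values required of fake diamonds come out: a = 0 gives type 0, and b =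
        0, that is a = -\<pi>, gives type 1.\<close>
      have "has_finite_type scale bracket component q X Y (t * (q - 1) + 1) (- a t / \<pi>)"
        unfolding fin ba using \<pi>_nonzero by (auto simp: field_simps add_eq_0_iff)
      then show ?thesis
        using True ba \<pi>_nonzero inf cong_1_iff by auto
    next
      case False
      then have "a t = 1" "b t = 1" by (auto simp: chain_coeff_def)
      then show ?thesis using False fin inf cong_1_iff by auto
    qed
  next
    case (2 h g)
    have eq: "X = scale 0 (A 0) + scale g (B 0)" "Y = scale h (A 0) + scale 0 (B 0)"
      using 2 by simp_all
    have fin: "has_finite_type scale bracket component q X Y (t * (q - 1) + 1) \<mu> \<longleftrightarrow>
      (1 - \<mu>) * b t = - \<mu> * a t \<and> (a t = 0 \<or> b t = 0 \<longrightarrow> \<mu> \<in> {0, 1})" for \<mu>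
    proof -
      have "(1 - \<mu>) * (h * g * b t - 0 * 0 * a t) = \<mu> * (0 * 0 * b t - h * g * a t) \<longleftrightarrow>
        (g * h) * ((1 - \<mu>) * b t) = (g * h) * (- \<mu> * a t)" by (simp add: algebra_simps)
      also have "\<dots> \<longleftrightarrow> (1 - \<mu>) * b t = - \<mu> * a t" using 2 by (simp only: mult_cancel_left) simp
      finally show ?thesis
        unfolding has_finite_type_iff finite_type_relations_iff[OF eq mult_zero_left mult_zero_right t] by simp
    qed
    have inf: "has_infinite_type scale bracket component X Y (t * (q - 1) + 1) \<longleftrightarrow>
      a t \<noteq> 0 \<and> b t \<noteq> 0 \<and> a t = b t"
      unfolding has_infinite_type_iff[OF eq mult_zero_left mult_zero_right t] using 2 by auto
    show ?thesis
    proof (cases "t mod w = 1")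
      case True
      then have ba: "b t = a t + \<pi>" using b_minus_a[of t] by (simp add: algebra_simps)
      have "has_finite_type scale bracket component q X Y (t * (q - 1) + 1) (b t / \<pi>)"
        unfolding fin ba using \<pi>_nonzero by (auto simp: field_simps)
      then show ?thesis
        using True ba \<pi>_nonzero inf cong_1_iff by auto
    next
      case False
      then have "a t = 1" "b t = 1" by (auto simp: chain_coeff_def)
      then show ?thesis using False fin inf cong_1_iff by auto
    qed
  qed
  then show ?fin ?inf by blast+
qed

lemma coeff_progression:
  "a (1 + r * w) = \<pi> - of_nat r" "b (1 + r * w) = 2 * \<pi> - of_nat r"
proof -
  have "(1 + r * w) mod w = 1" "(1 + r * w) div w = r"
    using w_gt_1 div_mult_self1[of w 1 r] by (auto simp: mod_Suc)
  then show "a (1 + r * w) = \<pi> - of_nat r" "b (1 + r * w) = 2 * \<pi> - of_nat r"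
    unfolding chain_coeff_def by auto
qed

text \<open>The type is -a/\<pi> for a = \<pi> - r.\<close>

lemma progression:
  assumes X: "X = scale g (A 0)" and Y: "Y = scale h (B 0)"
  shows "has_finite_type scale bracket component q X Y ((1 + r * w) * (q - 1) + 1)
      (- 1 + of_nat r * (1 / \<pi>))"
proof -
  have eq: "X = scale g (A 0) + scale 0 (B 0)" "Y = scale 0 (A 0) + scale h (B 0)"
    using X Y by simp_all
  have t: "1 + r * w \<ge> 1" by simp
  show ?thesis
    unfolding has_finite_type_iff finite_type_relations_iff[OF eq mult_zero_right mult_zero_left t]
      coeff_progression
    using \<pi>_nonzero by (auto simp: field_simps)
qed

text \<open>The value is 1 - \<mu> for the type \<mu> = -1 + r/\<pi> that belongs to the other order
  of the generators.\<close>

lemma progression_swapped: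
  assumes X: "X = scale h (B 0)" and Y: "Y = scale g (A 0)"
  shows "has_finite_type scale bracket component q X Y ((1 + r * w) * (q - 1) + 1)
      (2 + of_nat r * (- (1 / \<pi>)))"
proof -
  have eq: "X = scale 0 (A 0) + scale h (B 0)" "Y = scale g (A 0) + scale 0 (B 0)"
    using X Y by simp_all
  have t: "1 + r * w \<ge> 1" by simp
  show ?thesis
    unfolding has_finite_type_iff finite_type_relations_iff[OF eq mult_zero_left mult_zero_right t]
      coeff_progression
    using \<pi>_nonzero by (auto simp: field_simps)
qed

lemma finite_type_progression:
  assumes "diamond_generators scale bracket component q X Y"
  shows "(\<forall>r. has_finite_type scale bracket component q X Y ((1 + r * w) * (q - 1) + 1)
      (- 1 + of_nat r * (1 / \<pi>))) \<or>
    q = 3 \<and> (\<forall>r. has_finite_type scale bracket component q X Y ((1 + r * w) * (q - 1) + 1)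
      (2 + of_nat r * (- (1 / \<pi>))))"
  using assms
proof (cases rule: diamond_generators_cases)
  case (1 g h)
  then show ?thesis using progression by blast
next
  case 2
  then show ?thesis using progression_swapped by blast
qed

lemma A_B_types:
  "has_finite_type scale bracket component q (A 0) (B 0) ((1 + r * w) * (q - 1) + 1)
    (- 1 + of_nat r * (1 / \<pi>))"
  by (rule progression[of _ 1 _ 1]) simp_all

text \<open>A one-dimensional component at a diamond position has a = 0 or b = 0, which happens only
  for t mod w = 1; there a finite type exists, and it makes the component a fake diamond.
  Conversely, the degree of a fake diamond is 1 modulo q - 1 by definition, and genuine ones are
  excluded elsewhere by dimension.\<close>

lemma diamonds:
  assumes gen: "diamond_generators scale bracket component q X Y"
  shows "{i. is_diamond scale bracket component q X Y i} = {t * (q - 1) + 1 | t. True}"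
proof -
  have "is_diamond scale bracket component q X Y (t * (q - 1) + 1)" for t
  proof (cases "a t = 0 \<or> b t = 0")
    case True
    have m: "t mod w = 1" using True by (auto simp: chain_coeff_def split: if_splits)
    then have t: "t \<ge> 1" using w_gt_1 by (cases t) auto
    obtain \<mu> where "has_finite_type scale bracket component q X Y (t * (q - 1) + 1) \<mu>"
      using types(1)[OF gen t] m cong_1_iff by auto
    then have "fake_diamond scale bracket component q X Y (t * (q - 1) + 1) \<mu>"
      using True dim_diamond[of t] by (auto simp: has_finite_type_def)
    then show ?thesis unfolding is_diamond_def by auto
  next
    case False
    then show ?thesis unfolding is_diamond_def using dim_diamond[of t] by auto
  qed
  moreover have "\<exists>t. i = t * (q - 1) + 1" if i_diamond: "is_diamond scale bracket component q X Y i" for i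
  proof -
    have i: "i \<ge> 1" using i_diamond is_diamond_def by blast
    consider "dim (component i) = 2" | "[i = 1] (mod (q - 1))"
      using i_diamond unfolding is_diamond_def fake_diamond_def by blast
    then show ?thesis
    proof cases
      case 1
      then show ?thesis using dim_component_eq_2 i by blast
    next
      case 2
      from i show ?thesis
      proof (cases rule: degree_cases)
        case (line t u)
        then have "[1 + u = 1 + 0] (mod (q - 1))"
          using 2 by (simp add: cong_def mod_simps add.assoc)
        then have "[u = 0] (mod (q - 1))" using cong_add_lcancel_nat by blast
        then show ?thesis using line by (simp add: cong_def)
      qed blast
    qed
  qed
  ultimately show ?thesis by blast
qed

end

section \<open>Loop algebras of chains\<close>

context vector_space
begin

lemma coeff_poly_scale [simp]: "coeff (poly_scale scale c f) i = scale c (coeff f i)"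
  by (simp add: poly_scale_def coeff_map_poly)

lemma poly_scale_monom [simp]: "poly_scale scale c (monom v i) = monom (scale c v) i"
  by (rule poly_eqI) (simp add: coeff_monom)

lemma degree_poly_scale_le: "degree (poly_scale scale c f) \<le> degree f"
  by (rule degree_le) (simp add: coeff_eq_0)

lemma vector_space_poly_scale: "vector_space (poly_scale scale)"
  by unfold_locales (auto intro!: poly_eqI simp: scale_right_distrib scale_left_distrib)

lemma linear_monom: "Vector_Spaces.linear scale (poly_scale scale) (\<lambda>v. monom v i)"
  unfolding Vector_Spaces.linear_iff
  by (auto simp: add_monom vector_space_poly_scale vector_space_axioms)

lemma span_image_monom:
  "module.span (poly_scale scale) ((\<lambda>v. monom v i) ` S) = (\<lambda>v. monom v i) ` span S"
proof -
  interpret m: Vector_Spaces.linear scale "poly_scale scale" "\<lambda>v. monom v i" by (rule linear_monom)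
  show ?thesis by (rule m.span_image)
qed

end

section \<open>The Lie algebra of polynomials over V\<close>

context lie_algebra
begin

lemma bracket_0_left [simp]: "y \<in> V \<Longrightarrow> bracket 0 y = 0"
  using bracket_scale_left[OF subspace_0[OF subspace_V], of y 0] by simp

lemma bracket_0_right [simp]: "y \<in> V \<Longrightarrow> bracket y 0 = 0"
  using bracket_scale_right[OF _ subspace_0[OF subspace_V], of y 0] by simp

lemma zero_in_V [simp]: "0 \<in> V"
  using subspace_0[OF subspace_V] .

lemma poly_extension_coeff: "f \<in> poly_extension V \<Longrightarrow> coeff f i \<in> V"
  by (simp add: poly_extension_def)

lemma monom_poly_extension: "v \<in> V \<Longrightarrow> monom v i \<in> poly_extension V"
  by (simp add: poly_extension_def coeff_monom)

lemma subspace_poly_extension: "module.subspace (poly_scale scale) (poly_extension V)"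
proof -
  interpret P: vector_space "poly_scale scale" by (rule vector_space_poly_scale)
  show ?thesis
    using subspace_V by (auto simp: P.subspace_def subspace_def poly_extension_def)
qed

text \<open>Reduces statements that are additive in a polynomial to monomials with coefficient in V;
  membership in V is carried along because the bracket is known to be bilinear only there.\<close>

lemma poly_extension_induct [consumes 1, case_names zero monom add]:
  assumes "f \<in> poly_extension V" and "P 0" and "\<And>v i. v \<in> V \<Longrightarrow> P (monom v i)"
    and "\<And>f g. f \<in> poly_extension V \<Longrightarrow> g \<in> poly_extension V \<Longrightarrow> P f \<Longrightarrow> P g \<Longrightarrow> P (f + g)"
  shows "P f"
proof -
  interpret P: vector_space "poly_scale scale" by (rule vector_space_poly_scale)
  have "(\<Sum>i\<in>I. monom (coeff f i) i) \<in> poly_extension V \<and> P (\<Sum>i\<in>I. monom (coeff f i) i)"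
    if "finite I" for I
    using that
  proof (induction I)
    case empty
    then show ?case using assms(2) P.subspace_0[OF subspace_poly_extension] by simp
  next
    case (insert i I)
    have "coeff f i \<in> V" using assms(1) by (rule poly_extension_coeff)
    then show ?case
      using insert assms(3,4) monom_poly_extension P.subspace_add[OF subspace_poly_extension] by simp
  qed
  from this[of "{..degree f}"] show ?thesis by (simp add: poly_as_sum_of_monoms)
qed

text \<open>The summation range in the definition depends on the degrees of the arguments, which
  obstructs additivity; a common bound for all summands removes the dependence.\<close>

lemma poly_bracket_bound:
  assumes "f \<in> poly_extension V" "g \<in> poly_extension V" "degree f \<le> m" "degree g \<le> k"
  shows "poly_bracket bracket f g = (\<Sum>i\<le>m. \<Sum>j\<le>k. monom (bracket (coeff f i) (coeff g j)) (i + j))"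
proof -
  have "poly_bracket bracket f g =
      (\<Sum>i\<le>m. \<Sum>j\<le>degree g. monom (bracket (coeff f i) (coeff g j)) (i + j))"
    unfolding poly_bracket_def using assms
    by (intro sum.mono_neutral_left) (auto simp: coeff_eq_0 poly_extension_coeff)
  also have "\<dots> = (\<Sum>i\<le>m. \<Sum>j\<le>k. monom (bracket (coeff f i) (coeff g j)) (i + j))"
    using assms by (intro sum.cong refl sum.mono_neutral_left) (auto simp: coeff_eq_0 poly_extension_coeff)
  finally show ?thesis .
qed

lemma poly_bracket_monom:
  assumes "u \<in> V" "v \<in> V"
  shows "poly_bracket bracket (monom u i) (monom v j) = monom (bracket u v) (i + j)"
proof -
  have "poly_bracket bracket (monom u i) (monom v j) =
      (\<Sum>i'\<le>i. \<Sum>j'\<le>j. monom (bracket (coeff (monom u i) i') (coeff (monom v j) j')) (i' + j'))"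
    using assms by (intro poly_bracket_bound monom_poly_extension degree_monom_le)
  also have "\<dots> = (\<Sum>i'\<le>i. \<Sum>j'\<le>j. if i' = i \<and> j' = j then monom (bracket u v) (i + j) else 0)"
    using assms by (intro sum.cong refl) (auto simp: coeff_monom)
  also have "\<dots> = (\<Sum>i'\<le>i. if i' = i then (\<Sum>j'\<le>j. if j' = j then monom (bracket u v) (i + j) else 0) else 0)"
    by (intro sum.cong refl) auto
  also have "\<dots> = monom (bracket u v) (i + j)" by simp
  finally show ?thesis .
qed

lemma poly_bracket_add_left:
  assumes "f \<in> poly_extension V" "g \<in> poly_extension V" "h \<in> poly_extension V"
  shows "poly_bracket bracket (f + g) h = poly_bracket bracket f h + poly_bracket bracket g h"
proof -
  interpret P: vector_space "poly_scale scale" by (rule vector_space_poly_scale)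
  define m where "m = max (degree f) (degree g)"
  have "degree (f + g) \<le> m" unfolding m_def by (rule degree_add_le_max)
  moreover have "f + g \<in> poly_extension V"
    using assms P.subspace_add[OF subspace_poly_extension] by blast
  ultimately show ?thesis
    using assms poly_bracket_bound[of _ h m "degree h"]
    by (simp add: m_def bracket_add_left poly_extension_coeff flip: add_monom sum.distrib)
qed

lemma poly_bracket_add_right:
  assumes "f \<in> poly_extension V" "g \<in> poly_extension V" "h \<in> poly_extension V"
  shows "poly_bracket bracket h (f + g) = poly_bracket bracket h f + poly_bracket bracket h g"
proof -
  interpret P: vector_space "poly_scale scale" by (rule vector_space_poly_scale)
  define m where "m = max (degree f) (degree g)"
  have "degree (f + g) \<le> m" unfolding m_def by (rule degree_add_le_max)
  moreover have "f + g \<in> poly_extension V"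
    using assms P.subspace_add[OF subspace_poly_extension] by blast
  ultimately show ?thesis
    using assms poly_bracket_bound[of h _ "degree h" m]
    by (simp add: m_def bracket_add_right poly_extension_coeff flip: add_monom sum.distrib)
qed

lemma poly_bracket_scale_left:
  assumes "f \<in> poly_extension V" "g \<in> poly_extension V"
  shows "poly_bracket bracket (poly_scale scale c f) g = poly_scale scale c (poly_bracket bracket f g)"
proof -
  interpret P: vector_space "poly_scale scale" by (rule vector_space_poly_scale)
  have "poly_scale scale c f \<in> poly_extension V"
    using assms P.subspace_scale[OF subspace_poly_extension] by blast
  then show ?thesis
    using assms poly_bracket_bound[of _ g "degree f" "degree g"] degree_poly_scale_le
    by (simp add: bracket_scale_left poly_extension_coeff P.scale_sum_right)
qed

lemma poly_bracket_scale_right: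
  assumes "f \<in> poly_extension V" "g \<in> poly_extension V"
  shows "poly_bracket bracket g (poly_scale scale c f) = poly_scale scale c (poly_bracket bracket g f)"
proof -
  interpret P: vector_space "poly_scale scale" by (rule vector_space_poly_scale)
  have "poly_scale scale c f \<in> poly_extension V"
    using assms P.subspace_scale[OF subspace_poly_extension] by blast
  then show ?thesis
    using assms poly_bracket_bound[of g _ "degree g" "degree f"] degree_poly_scale_le
    by (simp add: bracket_scale_right poly_extension_coeff P.scale_sum_right)
qed

lemma poly_bracket_in:
  assumes "module.subspace (poly_scale scale) W"
    and "\<And>i j. monom (bracket (coeff f i) (coeff g j)) (i + j) \<in> W"
  shows "poly_bracket bracket f g \<in> W"
proof -
  interpret P: vector_space "poly_scale scale" by (rule vector_space_poly_scale)
  show ?thesis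
    unfolding poly_bracket_def using assms by (intro P.subspace_sum)
qed

lemma poly_bracket_closed:
  assumes "f \<in> poly_extension V" "g \<in> poly_extension V"
  shows "poly_bracket bracket f g \<in> poly_extension V"
  using assms
  by (intro poly_bracket_in subspace_poly_extension monom_poly_extension bracket_closed poly_extension_coeff)

lemma bracket_antisymmetric:
  assumes "x \<in> V" "y \<in> V" shows "bracket x y + bracket y x = 0"
  using assms bracket_alternating[of "x + y"] bracket_alternating[of x] bracket_alternating[of y]
    subspace_add[OF subspace_V]
  by (simp add: bracket_add_left bracket_add_right add.commute)

lemma poly_bracket_0 [simp]:
  assumes "f \<in> poly_extension V"
  shows "poly_bracket bracket f 0 = 0" "poly_bracket bracket 0 f = 0"
  using assms by (simp_all add: poly_bracket_def poly_extension_coeff)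

lemma add_eq_0_interchange:
  fixes x :: "'g::ab_group_add"
  assumes "x + z = 0" "y + w = 0"
  shows "(x + y) + (z + w) = 0"
proof -
  have "(x + y) + (z + w) = (x + z) + (y + w)" by (simp only: ac_simps)
  then show ?thesis using assms by simp
qed

lemma poly_bracket_antisymmetric:
  assumes "f \<in> poly_extension V" "g \<in> poly_extension V"
  shows "poly_bracket bracket f g + poly_bracket bracket g f = 0"
  using assms(1)
proof (induction rule: poly_extension_induct)
  case zero
  then show ?case using assms by simp
next
  case (monom v i)
  show ?case
    using assms(2)
  proof (induction rule: poly_extension_induct)
    case zero
    then show ?case using monom monom_poly_extension by simp
  next
    case m: (monom w j)
    then show ?case
      using monom bracket_antisymmetric by (simp add: poly_bracket_monom add.commute[of j] add_monom)
  next
    case (add f g)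
    then show ?case
      using monom_poly_extension[OF monom, of i]
      by (simp add: poly_bracket_add_left poly_bracket_add_right add_eq_0_interchange)
  qed
next
  case (add f h)
  then show ?case
    using assms(2)
    by (simp add: poly_bracket_add_left poly_bracket_add_right add_eq_0_interchange)
qed

text \<open>The condition is quadratic in f, so in the induction the cross terms of a sum must
  cancel; they do by antisymmetry, which is bilinear and was obtained by an induction in each
  argument.\<close>

lemma poly_bracket_alternating:
  assumes "f \<in> poly_extension V"
  shows "poly_bracket bracket f f = 0"
  using assms
proof (induction rule: poly_extension_induct)
  case zero
  then show ?case by (simp add: poly_bracket_def)
next
  case (monom v i)
  then show ?case by (simp add: poly_bracket_monom bracket_alternating)
next
  case (add f g)
  interpret P: vector_space "poly_scale scale" by (rule vector_space_poly_scale)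
  show ?case
    using add poly_bracket_antisymmetric[of f g] P.subspace_add[OF subspace_poly_extension]
    by (simp add: poly_bracket_add_left poly_bracket_add_right add.commute)
qed

text \<open>The Jacobi sum is additive in its first argument and invariant under cyclic shifts. So
  each argument can be moved to the front in turn and reduced to monomials there.\<close>

lemma poly_jacobi:
  assumes "f \<in> poly_extension V" "g \<in> poly_extension V" "h \<in> poly_extension V"
  shows "poly_bracket bracket (poly_bracket bracket f g) h +
    poly_bracket bracket (poly_bracket bracket g h) f +
    poly_bracket bracket (poly_bracket bracket h f) g = 0" (is "?J f g h = 0")
proof -
  note add = poly_bracket_add_left poly_bracket_add_right poly_bracket_closed
  have J_add: "?J (f + f') g h = ?J f g h + ?J f' g h"
    if "f \<in> poly_extension V" "f' \<in> poly_extension V" "g \<in> poly_extension V" "h \<in> poly_extension V"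
    for f f' g h
    using that by (simp add: add)
  have J_cycle: "?J f g h = ?J g h f" for f g h by simp
  have J_0: "?J 0 g h = 0" if "g \<in> poly_extension V" "h \<in> poly_extension V" for g h
    using that by (simp add: poly_bracket_closed)
  have J_monom: "?J (monom u i) (monom v j) (monom w k) = 0"
    if "u \<in> V" "v \<in> V" "w \<in> V" for u v w i j k
    using that jacobi[of u v w]
    by (simp add: poly_bracket_monom bracket_closed add_monom add.commute add.left_commute)
  have 1: "?J f (monom v j) (monom w k) = 0"
    if "f \<in> poly_extension V" "v \<in> V" "w \<in> V" for f v w j k
    using that(1)
  proof (induction rule: poly_extension_induct)
    case (add f g)
    then show ?case
      using J_add[of f g "monom v j" "monom w k"] that monom_poly_extension by simp
  qed (use that J_monom J_0 monom_poly_extension in auto)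
  have 2: "?J f g (monom w k) = 0"
    if "f \<in> poly_extension V" "g \<in> poly_extension V" "w \<in> V" for f g w k
    using that(1)
  proof -
    have "?J g (monom w k) f = 0"
      using that(2)
    proof (induction rule: poly_extension_induct)
      case (add g g')
      then show ?case
        using J_add[of g g' "monom w k" f] that monom_poly_extension by simp
    next
      case (monom v j)
      then show ?case using 1[of f v w j k] that J_cycle by metis
    qed (use that J_0 monom_poly_extension in auto)
    then show ?thesis using J_cycle by metis
  qed
  have "?J h f g = 0"
    using assms(3)
  proof (induction rule: poly_extension_induct)
    case (add h h')
    then show ?case
      using J_add[of h h' f g] assms by simp
  next
    case (monom w k)
    then show ?case using 2[of f g w k] assms J_cycle by metis
  qed (use assms J_0 in auto)
  then show ?thesis using J_cycle by metis
qed

lemma lie_algebra_subalgebra: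
  assumes "subspace W" "W \<subseteq> V" "\<And>x y. x \<in> W \<Longrightarrow> y \<in> W \<Longrightarrow> bracket x y \<in> W"
  shows "lie_algebra scale bracket W"
  using assms(2)
  by unfold_locales
    (auto simp: assms subset_iff bracket_add_left bracket_add_right bracket_scale_left
      bracket_scale_right bracket_alternating jacobi)

lemma lie_algebra_poly:
  "lie_algebra (poly_scale scale) (poly_bracket bracket) (poly_extension V)"
proof -
  interpret P: vector_space "poly_scale scale" by (rule vector_space_poly_scale)
  show ?thesis
    by unfold_locales
      (auto intro: subspace_poly_extension poly_bracket_closed poly_bracket_add_left
        poly_bracket_add_right poly_bracket_scale_left poly_bracket_scale_right
        poly_bracket_alternating poly_jacobi)
qed

text \<open>The covering property makes the degree one part generate.\<close>

context
  fixes S :: "nat \<Rightarrow> 'v set" and W :: "'v poly set"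
  assumes S_0: "S 0 = {0}" and S_subset: "\<And>i. S i \<subseteq> V" and subspace_S: "\<And>i. subspace (S i)"
    and bracket_S: "\<And>i j x y. i \<ge> 1 \<Longrightarrow> j \<ge> 1 \<Longrightarrow> x \<in> S i \<Longrightarrow> y \<in> S j \<Longrightarrow> bracket x y \<in> S (i + j)"
    and covering_S: "\<And>i u. i \<ge> 1 \<Longrightarrow> u \<in> S i \<Longrightarrow> u \<noteq> 0 \<Longrightarrow> S (i + 1) = bracket u ` S 1"
    and nontrivial_S: "\<And>i. i \<ge> 1 \<Longrightarrow> \<exists>u\<in>S i. u \<noteq> 0"
  defines "W \<equiv> {f. \<forall>i. coeff f i \<in> S i}"
begin

lemma monom_W: "v \<in> S i \<Longrightarrow> monom v i \<in> W"
  using subspace_0[OF subspace_S] by (auto simp: W_def coeff_monom)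

lemma W_coeff_0: "f \<in> W \<Longrightarrow> coeff f 0 = 0"
  using S_0 by (auto simp: W_def dest: spec[of _ 0])

lemma W_subset: "W \<subseteq> poly_extension V"
  using S_subset by (auto simp: W_def poly_extension_def)

lemma subspace_W: "module.subspace (poly_scale scale) W"
proof -
  interpret P: vector_space "poly_scale scale" by (rule vector_space_poly_scale)
  show ?thesis
    using subspace_S by (auto simp: P.subspace_def subspace_def W_def)
qed

lemma W_closed:
  assumes "f \<in> W" "g \<in> W" shows "poly_bracket bracket f g \<in> W"
proof (rule poly_bracket_in[OF subspace_W])
  fix i j
  have V: "coeff f i \<in> V" "coeff g j \<in> V" using assms W_subset poly_extension_coeff by auto
  have S: "coeff f i \<in> S i" "coeff g j \<in> S j" using assms by (auto simp: W_def)
  show "monom (bracket (coeff f i) (coeff g j)) (i + j) \<in> W"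
  \<comment> \<open>\<open>bracket_S\<close> speaks of positive degrees only; a factor of degree 0
    is 0.\<close>
  proof (cases "i = 0 \<or> j = 0")
    case True
    then have "coeff f i = 0 \<or> coeff g j = 0" using S S_0 by (metis singletonD)
    then have "bracket (coeff f i) (coeff g j) = 0"
      using bracket_0_left[OF V(2)] bracket_0_right[OF V(1)] by metis
    then show ?thesis using subspace_0[OF subspace_S] by (auto simp: W_def)
  next
    case False
    then show ?thesis using S by (intro monom_W bracket_S) auto
  qed
qed

text \<open>By induction on the degree: with one nonzero u in \<open>S i\<close>, every element of
  \<open>S (i + 1)\<close> is [u, x] with x in \<open>S 1\<close>, so a subalgebra that contains
  \<open>S 1\<close> in degree one contains each \<open>S i\<close> in degree i.\<close>

lemma loop_algebra_eq: "loop_algebra scale bracket V (S 1) = W"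
proof -
  interpret P: lie_algebra "poly_scale scale" "poly_bracket bracket" "poly_extension V"
    by (rule lie_algebra_poly)
  have "lie_subalgebra (poly_scale scale) (poly_bracket bracket) (poly_extension V) W"
    unfolding lie_subalgebra_def using W_subset subspace_W W_closed by blast
  moreover have "(\<lambda>v. monom v 1) ` S 1 \<subseteq> W" using monom_W by auto
  moreover have "W \<subseteq> U"
    if U: "lie_subalgebra (poly_scale scale) (poly_bracket bracket) (poly_extension V) U"
      "(\<lambda>v. monom v 1) ` S 1 \<subseteq> U" for U
  proof -
    have sub: "P.subspace U" and closed: "\<And>f g. f \<in> U \<Longrightarrow> g \<in> U \<Longrightarrow> poly_bracket bracket f g \<in> U"
      using U by (auto simp: lie_subalgebra_def)
    have mon: "monom v (Suc i) \<in> U" if "v \<in> S (Suc i)" for v i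
      using that
    proof (induction i arbitrary: v)
      case 0
      then show ?case using U by auto
    next
      case (Suc i)
      obtain u where u: "u \<in> S (Suc i)" "u \<noteq> 0" using nontrivial_S[of "Suc i"] by auto
      then obtain x where x: "x \<in> S 1" "v = bracket u x"
        using covering_S[of "Suc i" u] Suc.prems by auto
      have "monom v (Suc (Suc i)) = poly_bracket bracket (monom u (Suc i)) (monom x 1)"
        using x(2) poly_bracket_monom[OF subsetD[OF S_subset u(1)] subsetD[OF S_subset x(1)], of "Suc i" 1] by simp
      then show ?case using closed Suc.IH[OF u(1)] x U by auto
    qed
    show ?thesis
    proof
      fix f assume "f \<in> W"
      then have "monom (coeff f i) i \<in> U" for i
        using mon W_coeff_0 P.subspace_0[OF sub] by (cases i) (auto simp: W_def)
      then have "(\<Sum>i\<le>degree f. monom (coeff f i) i) \<in> U"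
        by (intro P.subspace_sum[OF sub])
      then show "f \<in> U" by (simp add: poly_as_sum_of_monoms)
    qed
  qed
  ultimately show ?thesis
    unfolding loop_algebra_def generated_lie_subalgebra_def by (intro equalityI Inter_lower Inter_greatest) auto
qed

lemma loop_component_eq: "loop_component W i = (\<lambda>v. monom v i) ` S i"
proof -
  have "v \<in> S i" if "monom v i \<in> W" for v
    using that by (auto simp: W_def coeff_monom dest: spec[of _ i])
  then show ?thesis
    unfolding loop_component_def using monom_W by auto
qed

lemma lie_algebra_W: "lie_algebra (poly_scale scale) (poly_bracket bracket) W"
proof -
  interpret P: lie_algebra "poly_scale scale" "poly_bracket bracket" "poly_extension V"
    by (rule lie_algebra_poly)
  show ?thesis
    by (rule P.lie_algebra_subalgebra[OF subspace_W W_subset W_closed])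
qed

lemma loop_grading:
  "lie_grading (poly_scale scale) (poly_bracket bracket) W {1..} (+) (loop_component W)"
proof -
  interpret P: lie_algebra "poly_scale scale" "poly_bracket bracket" W
    by (rule lie_algebra_W)
  have sub: "P.subspace (loop_component W i)" for i
    using span_image_monom[of i "S i"] span_eq_iff[THEN iffD2, OF subspace_S[of i]] loop_component_eq[of i]
    by (metis P.subspace_span)
  have "P.span (\<Union>i\<in>{1..}. loop_component W i) = W"
  proof
    show "P.span (\<Union>i\<in>{1..}. loop_component W i) \<subseteq> W"
      by (rule P.span_minimal[OF _ subspace_W]) (auto simp: loop_component_def)
    show "W \<subseteq> P.span (\<Union>i\<in>{1..}. loop_component W i)"
    proof
      fix f assume f: "f \<in> W"
      have "monom (coeff f i) i \<in> P.span (\<Union>i\<in>{1..}. loop_component W i)" for i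
      proof (cases "i = 0")
        case True
        then show ?thesis using W_coeff_0[OF f] P.span_zero by simp
      next
        case False
        moreover have "monom (coeff f i) i \<in> loop_component W i"
          unfolding loop_component_eq using f by (auto simp: W_def)
        ultimately show ?thesis
          by (intro P.span_base UN_I[of i]) auto
      qed
      then have "(\<Sum>i\<le>degree f. monom (coeff f i) i) \<in> P.span (\<Union>i\<in>{1..}. loop_component W i)"
        by (intro P.span_sum)
      then show "f \<in> P.span (\<Union>i\<in>{1..}. loop_component W i)" by (simp add: poly_as_sum_of_monoms)
    qed
  qed
  moreover have "f i = 0"
    if "finite J" "\<forall>i\<in>J. f i \<in> loop_component W i" "(\<Sum>i\<in>J. f i) = 0" "i \<in> J" for J f i
  proof -
    have mon: "f j = monom (coeff (f j) j) j" if "j \<in> J" for j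
      using that \<open>\<forall>i\<in>J. f i \<in> loop_component W i\<close> by (auto simp: loop_component_def)
    have "coeff (f j) i = (if j = i then coeff (f i) i else 0)" if "j \<in> J" for j
      using mon[OF that] by (metis coeff_monom)
    then have "coeff (\<Sum>j\<in>J. f j) i = (\<Sum>j\<in>J. if j = i then coeff (f i) i else 0)"
      unfolding coeff_sum by (intro sum.cong) auto
    also have "\<dots> = coeff (f i) i" using that by simp
    finally have "coeff (f i) i = 0" using that by simp
    then show ?thesis using mon[OF \<open>i \<in> J\<close>] by simp
  qed
  moreover have "poly_bracket bracket f g \<in> loop_component W (i + j)"
    if "i \<ge> 1" "j \<ge> 1" "f \<in> loop_component W i" "g \<in> loop_component W j" for i j f g
    using that S_subset bracket_S by (auto simp: loop_component_eq poly_bracket_monom subset_iff)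
  ultimately show ?thesis
    unfolding lie_grading_def internal_direct_sum_def using lie_algebra_W sub by auto
qed

text \<open>A finite set bounds the degrees of its span, but there are nonzero components in all
  positive degrees.\<close>

lemma loop_infinite_dimensional: "\<nexists>B. finite B \<and> W \<subseteq> module.span (poly_scale scale) B"
proof
  interpret P: vector_space "poly_scale scale" by (rule vector_space_poly_scale)
  assume "\<exists>B. finite B \<and> W \<subseteq> P.span B"
  then obtain B where B: "finite B" "W \<subseteq> P.span B" by blast
  define m where "m = Max (insert 0 (degree ` B))"
  have m: "degree f \<le> m" if "f \<in> B" for f
    unfolding m_def using B that by (intro Max_ge) auto
  have "P.subspace {f. degree f \<le> m}"
    unfolding P.subspace_def by (auto intro: degree_add_le order_trans[OF degree_poly_scale_le])
  then have "P.span B \<subseteq> {f. degree f \<le> m}"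
    using m by (intro P.span_minimal) auto
  moreover obtain u where "u \<in> S (Suc m)" "u \<noteq> 0" using nontrivial_S[of "Suc m"] by auto
  ultimately have "degree (monom u (Suc m)) \<le> m" using B(2) monom_W by blast
  then show False using \<open>u \<noteq> 0\<close> by (simp add: degree_monom_eq)
qed

end

end

text \<open>The powers of T record the degree as a natural number, and the chain carries over with
  the same scalars. The assumption \<open>graded\<close> is about all pairs of components, whereas
  the chain axioms describe brackets with A_0 and B_0.\<close>

lemma (in diamond_chain) loop_chain:
  assumes graded: "\<And>i j x y. i \<ge> 1 \<Longrightarrow> j \<ge> 1 \<Longrightarrow> x \<in> component i \<Longrightarrow> y \<in> component j \<Longrightarrow>
      bracket x y \<in> component (i + j)"
  defines "L \<equiv> loop_algebra scale bracket V (component 1)"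
    and "A' \<equiv> \<lambda>t. monom (A t) (t * (q - 1) + 1)"
    and "B' \<equiv> \<lambda>t. monom (B t) (t * (q - 1) + 1)"
    and "C' \<equiv> \<lambda>t u. monom (C t u) (t * (q - 1) + 1 + u)"
  shows "diamond_chain (poly_scale scale) (poly_bracket bracket) L q w \<pi> A' B' C'"
    and "loop_component L = chain_component (poly_scale scale) q A' B' C'"
    and "lie_grading (poly_scale scale) (poly_bracket bracket) L {1..} (+) (loop_component L)"
    and "\<nexists>B. finite B \<and> L \<subseteq> module.span (poly_scale scale) B"
proof -
  have S_0: "component 0 = {0}" by (simp add: chain_component_def)
  have S_sub: "component i \<subseteq> V" for i
    using S_0 component_subset[of i] by (cases "i = 0") auto
  note S = S_0 S_sub subspace_component graded covering component_nontrivial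
  define W where "W = {f. \<forall>i. coeff f i \<in> component i}"
  have L: "L = W"
    unfolding L_def W_def by (rule loop_algebra_eq[OF S])
  show "lie_grading (poly_scale scale) (poly_bracket bracket) L {1..} (+) (loop_component L)"
    unfolding L W_def by (rule loop_grading[OF S])
  show "\<nexists>B. finite B \<and> L \<subseteq> module.span (poly_scale scale) B"
    unfolding L W_def by (rule loop_infinite_dimensional[OF S])
  have comp: "loop_component L i = (\<lambda>v. monom v i) ` component i" for i
    unfolding L W_def by (rule loop_component_eq[OF S])
  show "loop_component L = chain_component (poly_scale scale) q A' B' C'"
  proof
    fix i
    show "loop_component L i = chain_component (poly_scale scale) q A' B' C' i"
    proof (cases "i = 0")
      case True
      then show ?thesis by (simp add: comp chain_component_def)
    next
      case False
      then have i: "i = (i - 1) div (q - 1) * (q - 1) + 1 + (i - 1) mod (q - 1)"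
        using div_mult_mod_eq[of "i - 1" "q - 1"] by linarith
      show ?thesis
      proof (cases "(i - 1) mod (q - 1) = 0")
        case True
        define t where "t = (i - 1) div (q - 1)"
        have "i = t * (q - 1) + 1" using i True t_def by simp
        then show ?thesis
          using False True span_image_monom[of i "{A t, B t}"] t_def
          by (simp add: comp chain_component_def A'_def B'_def)
      next
        case mod: False
        define t u where "t = (i - 1) div (q - 1)" and "u = (i - 1) mod (q - 1)"
        have "i = t * (q - 1) + 1 + u" using i t_def u_def by simp
        then show ?thesis
          using False mod span_image_monom[of i "{C t u}"] t_def u_def
          by (simp add: comp chain_component_def C'_def)
      qed
    qed
  qed
  interpret P: lie_algebra "poly_scale scale" "poly_bracket bracket" L
    unfolding L W_def by (rule lie_algebra_W[OF S])
  have mon: "monom v i \<in> L" if "v \<in> component i" for v i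
    using that comp[of i] by (auto simp: loop_component_def)
  have A: "A t \<in> component (t * (q - 1) + 1)" and B: "B t \<in> component (t * (q - 1) + 1)" for t
    unfolding component_diamond by (auto intro: span_base)
  have C: "C t u \<in> component (t * (q - 1) + 1 + u)" if "0 < u" "u < q - 1" for t u
    unfolding component_line[OF that] by (auto intro: span_base)
  \<comment> \<open>The step after u = q - 2 does not lead to u = q - 1 but to the next diamond, so
    the exponents of T have to be matched there.\<close>
  have last: "t * (q - 1) + 1 + (q - 2) + (0 * (q - 1) + 1) = (t + 1) * (q - 1) + 1" for t
    using q_ge_3 by simp
  note pb = poly_bracket_monom
  show "diamond_chain (poly_scale scale) (poly_bracket bracket) L q w \<pi> A' B' C'"
  proof
    show "q \<ge> 3" "w > 1" "\<pi> \<noteq> 0" "(2::'a) \<noteq> 0"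
      using q_ge_3 w_gt_1 \<pi>_nonzero two_nonzero by auto
    show "A' t \<in> L" "B' t \<in> L" for t unfolding A'_def B'_def using mon A B by auto
    show "C' t u \<in> L" if "0 < u" "u < q - 1" for t u unfolding C'_def using that by (intro mon C)
    show "A' t = 0 \<longleftrightarrow> a t = 0" "B' t = 0 \<longleftrightarrow> b t = 0" for t
      unfolding A'_def B'_def using A_eq_0 B_eq_0 by auto
    show "C' t u \<noteq> 0" if "0 < u" "u < q - 1" for t u
      unfolding C'_def using that C_nonzero by auto
    show "poly_scale scale c (A' t) = 0"
      if "poly_scale scale c (A' t) + poly_scale scale d (B' t) = 0" for c d t
      using that A_B_independent[of c t d] unfolding A'_def B'_def by (simp add: add_monom)
    show "poly_bracket bracket (A' t) (A' 0) = 0" for t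
      unfolding A'_def by (simp add: pb A_in A_A)
    show "poly_bracket bracket (B' t) (B' 0) = 0" for t
      unfolding B'_def by (simp add: pb B_in B_B)
    show "poly_bracket bracket (A' t) (B' 0) = poly_scale scale (- a t) (C' t 1)" for t
      unfolding A'_def B'_def C'_def using A_B[of t] by (simp add: pb A_in B_in)
    show "poly_bracket bracket (B' t) (A' 0) = C' t 1" if "b t \<noteq> 0" for t
      unfolding A'_def B'_def C'_def using B_A[of t] that by (simp add: pb A_in B_in)
    show "poly_bracket bracket (C' t u) (A' 0) = C' t (u + 1)" if "0 < u" "u < q - 2" for t u
      unfolding A'_def C'_def using C_A[of u t] that by (simp add: pb A_in C_in)
    show "poly_bracket bracket (C' t u) (B' 0) = 0" if "0 < u" "u < q - 2" for t u
      unfolding B'_def C'_def using C_B[of u t] that by (simp add: pb B_in C_in)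
    show "poly_bracket bracket (C' t (q - 2)) (A' 0) = A' (t + 1)" for t
      unfolding A'_def C'_def using C_A_last[of t] q_ge_3 by (simp only: pb A_in C_in last)
    show "poly_bracket bracket (C' t (q - 2)) (B' 0) = poly_scale scale (b (t + 1)) (B' (t + 1))" for t
      unfolding B'_def C'_def using C_B_last[of t] q_ge_3 by (simp only: pb B_in C_in last) (simp add: pb B_in C_in)
  qed
qed

section \<open>Hurwitz series\<close>

text \<open>Series in the divided powers of one variable, without truncation.  In two variables,
  the divided power algebra of characteristic \<open>p\<close> is a subalgebra of this ring.\<close>

typedef 'a hurwitz = "UNIV :: (nat \<Rightarrow> 'a) set"
  morphisms hnth Hurwitz ..

lemma hnth_Hurwitz [simp]: "hnth (Hurwitz f) = f"
  by (simp add: Hurwitz_inverse)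

lemma hurwitz_eqI: "(\<And>n. hnth f n = hnth g n) \<Longrightarrow> f = g"
  by (metis hnth_inject ext)

instantiation hurwitz :: (ab_group_add) ab_group_add
begin

definition "0 = Hurwitz (\<lambda>n. 0)"
definition "f + g = Hurwitz (\<lambda>n. hnth f n + hnth g n)"
definition "f - g = Hurwitz (\<lambda>n. hnth f n - hnth g n)"
definition "- f = Hurwitz (\<lambda>n. - hnth f n)"

instance
  by standard
    (auto intro!: hurwitz_eqI simp: zero_hurwitz_def plus_hurwitz_def minus_hurwitz_def
      uminus_hurwitz_def algebra_simps)

end

lemma hnth_simps [simp]:
  "hnth 0 n = 0" "hnth (f + g) n = hnth f n + hnth g n" "hnth (f - g) n = hnth f n - hnth g n"
  "hnth (- f) n = - hnth f n"
  by (simp_all add: zero_hurwitz_def plus_hurwitz_def minus_hurwitz_def uminus_hurwitz_def)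

lemma hnth_sum: "hnth (\<Sum>i\<in>I. f i) n = (\<Sum>i\<in>I. hnth (f i) n)"
  by (induction I rule: infinite_finite_induct) auto

text \<open>This is the derivation of the ring: it lowers a divided power by one without a factor,
  hence only shifts coefficients.\<close>

definition hshift :: "'a hurwitz \<Rightarrow> 'a hurwitz" where
  "hshift f = Hurwitz (\<lambda>n. hnth f (Suc n))"

lemma hnth_hshift [simp]: "hnth (hshift f) n = hnth f (Suc n)"
  by (simp add: hshift_def)

lemma hshift_simps [simp]:
  fixes f g :: "'a::ab_group_add hurwitz"
  shows "hshift 0 = (0 :: 'a hurwitz)" "hshift (f + g) = hshift f + hshift g"
    "hshift (f - g) = hshift f - hshift g" "hshift (- f) = - hshift f"
  by (auto intro: hurwitz_eqI)

lemma hshift_sum: "hshift (\<Sum>i\<in>I. f i) = (\<Sum>i\<in>I. hshift (f i))"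
  by (induction I rule: infinite_finite_induct) auto

instantiation hurwitz :: (comm_ring_1) comm_ring_1
begin

definition "1 = Hurwitz (\<lambda>n. if n = 0 then 1 else 0)"
definition "f * g =
  Hurwitz (\<lambda>n. \<Sum>i\<le>n. of_nat (n choose i) * hnth f i * hnth g (n - i))"

lemma hnth_times:
  fixes f g :: "'a hurwitz"
  shows "hnth (f * g) n = (\<Sum>i\<le>n. of_nat (n choose i) * hnth f i * hnth g (n - i))"
  by (simp add: times_hurwitz_def)

lemma hnth_times_0:
  fixes f g :: "'a hurwitz"
  shows "hnth (f * g) 0 = hnth f 0 * hnth g 0"
  by (simp add: hnth_times)

text \<open>The Leibniz rule is Pascal's rule for the binomial coefficients in the product.\<close>

lemma hshift_times:
  fixes f g :: "'a hurwitz"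
  shows "hshift (f * g) = hshift f * g + f * hshift g"
proof (rule hurwitz_eqI)
  fix n
  have "hnth (hshift (f * g)) n =
      hnth f 0 * hnth g (Suc n) +
      (\<Sum>i\<le>n. of_nat (Suc n choose Suc i) * hnth f (Suc i) * hnth g (n - i))"
    by (simp add: hnth_times sum.atMost_Suc_shift del: sum.atMost_Suc binomial_Suc_Suc)
  also have "\<dots> = hnth f 0 * hnth g (Suc n) +
      ((\<Sum>i\<le>n. of_nat (n choose i) * hnth f (Suc i) * hnth g (n - i)) +
       (\<Sum>i\<le>n. of_nat (n choose Suc i) * hnth f (Suc i) * hnth g (n - i)))"
    by (simp add: distrib_right sum.distrib)
  also have "\<dots> = (\<Sum>i\<le>n. of_nat (n choose i) * hnth f (Suc i) * hnth g (n - i)) +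
      (\<Sum>i\<le>Suc n. of_nat (n choose i) * hnth f i * hnth g (Suc n - i))"
    by (subst sum.atMost_Suc_shift) (simp add: algebra_simps)
  also have "(\<Sum>i\<le>Suc n. of_nat (n choose i) * hnth f i * hnth g (Suc n - i)) =
      (\<Sum>i\<le>n. of_nat (n choose i) * hnth f i * hnth g (Suc (n - i)))"
    by (simp add: Suc_diff_le binomial_eq_0)
  finally show "hnth (hshift (f * g)) n = hnth (hshift f * g + f * hshift g) n"
    by (simp add: hnth_times)
qed

lemma hnth_times_Suc:
  fixes f g :: "'a hurwitz"
  shows "hnth (f * g) (Suc n) = hnth (hshift f * g) n + hnth (f * hshift g) n"
  using hshift_times[of f g] by (metis hnth_hshift hnth_simps(2))

instance
proof
  fix f g h :: "'a hurwitz"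
  have distrib: "(f + g) * h = f * h + g * h" for f g h :: "'a hurwitz"
    by (rule hurwitz_eqI) (simp add: hnth_times algebra_simps sum.distrib)
  have distrib': "h * (f + g) = h * f + h * g" for f g h :: "'a hurwitz"
    by (rule hurwitz_eqI) (simp add: hnth_times algebra_simps sum.distrib)
  show "(f + g) * h = f * h + g * h" by (rule distrib)
  \<comment> \<open>A series is determined by the constant terms of its iterated derivatives. By the
    Leibniz rule, coefficient n + 1 of a product is coefficient n of products with one factor
    differentiated, so the ring laws follow by induction on n for all series at once.\<close>
  have "hnth (f * g) n = hnth (g * f) n" for n and f g :: "'a hurwitz"
  proof (induction n arbitrary: f g)
    case (Suc n)
    show ?case
      by (simp add: hnth_times_Suc Suc.IH[of "hshift f"] Suc.IH[of f])
  qed (simp add: hnth_times_0 mult.commute)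
  then show "f * g = g * f" by (rule hurwitz_eqI)
  have "hnth (f * g * h) n = hnth (f * (g * h)) n" for n and f g h :: "'a hurwitz"
  proof (induction n arbitrary: f g h)
    case (Suc n)
    show ?case
      by (simp add: hnth_times_Suc hshift_times distrib distrib' Suc.IH)
  qed (simp add: hnth_times_0 mult.assoc)
  then show "f * g * h = f * (g * h)" by (rule hurwitz_eqI)
  have one: "hshift (1 :: 'a hurwitz) = 0" by (rule hurwitz_eqI) (simp add: one_hurwitz_def)
  have zero: "0 * f = 0" for f :: "'a hurwitz" by (rule hurwitz_eqI) (simp add: hnth_times)
  have "hnth (1 * f) n = hnth f n" for n and f :: "'a hurwitz"
  proof (induction n arbitrary: f)
    case 0
    show ?case by (simp add: hnth_times_0 one_hurwitz_def)
  next
    case (Suc n)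
    then show ?case by (simp add: hnth_times_Suc one zero)
  qed
  then show "1 * f = f" by (rule hurwitz_eqI)
  have "hnth (0 :: 'a hurwitz) 0 \<noteq> hnth 1 0" by (simp add: one_hurwitz_def)
  then show "(0 :: 'a hurwitz) \<noteq> 1" by metis
qed

end

definition hconst :: "'a::comm_ring_1 \<Rightarrow> 'a hurwitz" where
  "hconst c = Hurwitz (\<lambda>n. if n = 0 then c else 0)"

lemma hnth_hconst: "hnth (hconst c) n = (if n = 0 then c else 0)"
  by (simp add: hconst_def)

lemma hnth_hconst_times [simp]: "hnth (hconst c * f) n = c * hnth f n"
proof -
  have "hnth (hconst c * f) n = (\<Sum>i\<le>n. if i = 0 then c * hnth f n else 0)"
    unfolding hnth_times by (intro sum.cong) (auto simp: hnth_hconst)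
  then show ?thesis by simp
qed

lemma hconst_0 [simp]: "hconst 0 = 0"
  by (rule hurwitz_eqI) (simp add: hnth_hconst)

lemma hconst_1 [simp]: "hconst 1 = 1"
  by (rule hurwitz_eqI) (simp add: hnth_hconst one_hurwitz_def)

lemma hconst_add: "hconst (c + d) = hconst c + hconst d"
  by (rule hurwitz_eqI) (simp add: hnth_hconst)

lemma hconst_minus: "hconst (- c) = - hconst c"
  by (rule hurwitz_eqI) (simp add: hnth_hconst)

lemma hconst_times: "hconst (c * d) = hconst c * hconst d"
  by (rule hurwitz_eqI) (simp add: hnth_hconst)

lemma hconst_of_nat: "hconst (of_nat n) = of_nat n"
  by (induction n) (simp_all add: hconst_add)

lemma hnth_of_nat_times [simp]: "hnth (of_nat c * f) n = of_nat c * hnth f n"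
  by (simp flip: hconst_of_nat)

lemma hshift_hconst [simp]: "hshift (hconst c) = 0"
  by (rule hurwitz_eqI) (simp add: hnth_hconst)

lemma hshift_of_nat [simp]: "hshift (of_nat n) = 0"
  by (simp flip: hconst_of_nat)

definition hmon :: "nat \<Rightarrow> 'a::comm_ring_1 hurwitz" where
  "hmon k = Hurwitz (\<lambda>n. if n = k then 1 else 0)"

lemma hnth_hmon: "hnth (hmon k) n = (if n = k then 1 else 0)"
  by (simp add: hmon_def)

lemma hmon_0 [simp]: "hmon 0 = 1"
  by (rule hurwitz_eqI) (simp add: hnth_hmon one_hurwitz_def)

lemma hshift_hmon: "hshift (hmon k) = (if k = 0 then 0 else hmon (k - 1))"
  by (rule hurwitz_eqI) (auto simp: hnth_hmon)

lemma hmon_times: "hmon i * hmon j = of_nat (i + j choose i) * hmon (i + j)"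
proof (rule hurwitz_eqI)
  fix n
  have "hnth (hmon i * hmon j :: 'a hurwitz) n =
      (\<Sum>l\<le>n. if l = i then (if n = i + j then of_nat (i + j choose i) else 0) else 0)"
    unfolding hnth_times by (intro sum.cong) (auto simp: hnth_hmon)
  then show "hnth (hmon i * hmon j :: 'a hurwitz) n = hnth (of_nat (i + j choose i) * hmon (i + j)) n"
    by (simp add: hnth_hmon)
qed

subsection \<open>Two variables\<close>

text \<open>A series in two variables is a series in x with coefficients that are series in y:
  differentiation in x shifts the outer index, differentiation in y acts on each
  coefficient.\<close>

definition dx :: "'a::comm_ring_1 hurwitz hurwitz \<Rightarrow> 'a hurwitz hurwitz" where
  "dx = hshift"

definition dy :: "'a::comm_ring_1 hurwitz hurwitz \<Rightarrow> 'a hurwitz hurwitz" where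
  "dy f = Hurwitz (\<lambda>i. hshift (hnth f i))"

lemma hnth_dy [simp]: "hnth (dy f) i = hshift (hnth f i)"
  by (simp add: dy_def)

lemma dx_times: "dx (f * g) = dx f * g + f * dx g"
  unfolding dx_def by (rule hshift_times)

lemma dy_times: "dy (f * g) = dy f * g + f * dy g"
proof (rule hurwitz_eqI)
  fix n
  show "hnth (dy (f * g)) n = hnth (dy f * g + f * dy g) n"
    by (simp add: hnth_times hshift_sum hshift_times distrib_left distrib_right sum.distrib mult.assoc)
qed

lemma dx_linear [simp]: "dx 0 = 0" "dx (f + g) = dx f + dx g" "dx (f - g) = dx f - dx g" "dx (- f) = - dx f"
  by (simp_all add: dx_def)

lemma dy_linear [simp]: "dy 0 = 0" "dy (f + g) = dy f + dy g" "dy (f - g) = dy f - dy g" "dy (- f) = - dy f"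
  by (auto intro!: hurwitz_eqI)

lemma dx_dy: "dx (dy f) = dy (dx f)"
  by (rule hurwitz_eqI) (simp add: dx_def)

definition poisson ::
  "'a::comm_ring_1 hurwitz hurwitz \<Rightarrow> 'a hurwitz hurwitz \<Rightarrow> 'a hurwitz hurwitz" where
  "poisson f g = dy f * dx g - dx f * dy g"

lemma poisson_add: "poisson (f + f') g = poisson f g + poisson f' g"
  "poisson g (f + f') = poisson g f + poisson g f'"
  by (simp_all add: poisson_def algebra_simps)

lemma poisson_self: "poisson f f = 0"
  by (simp add: poisson_def mult.commute)

lemma poisson_jacobi: "poisson (poisson f g) h + poisson (poisson g h) f + poisson (poisson h f) g = 0"
  unfolding poisson_def dx_linear dy_linear dx_times dy_times dx_dy by (simp add: algebra_simps)

lemma poisson_divergence: "poisson f g = dx (dy f * g) - dy (dx f * g)"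
  by (simp add: poisson_def dx_times dy_times dx_dy algebra_simps)

section \<open>Divided powers in positive characteristic\<close>

definition hcoeff :: "'a hurwitz hurwitz \<Rightarrow> nat \<Rightarrow> nat \<Rightarrow> 'a" where
  "hcoeff F i j = hnth (hnth F i) j"

definition hseries :: "(nat \<Rightarrow> nat \<Rightarrow> 'a) \<Rightarrow> 'a hurwitz hurwitz" where
  "hseries f = Hurwitz (\<lambda>i. Hurwitz (f i))"

definition hscalar :: "'a::comm_ring_1 \<Rightarrow> 'a hurwitz hurwitz" where
  "hscalar c = hconst (hconst c)"

definition hx :: "nat \<Rightarrow> 'a::comm_ring_1 hurwitz hurwitz" where
  "hx i = hmon i"

definition hy :: "nat \<Rightarrow> 'a::comm_ring_1 hurwitz hurwitz" where
  "hy j = hconst (hmon j)"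

lemma hcoeff_hseries [simp]: "hcoeff (hseries f) = f"
  by (intro ext) (simp add: hcoeff_def hseries_def)

lemma hseries_hcoeff [simp]: "hseries (hcoeff F) = F"
  by (intro hurwitz_eqI) (simp add: hcoeff_def hseries_def)

lemma hseries_eqI: "(\<And>i j. hcoeff F i j = hcoeff G i j) \<Longrightarrow> F = G"
  by (intro hurwitz_eqI) (simp add: hcoeff_def)

lemma hseries_inject: "hseries f = hseries g \<longleftrightarrow> f = g"
  by (metis hcoeff_hseries)

lemma hcoeff_linear [simp]:
  fixes F G :: "'a::comm_ring_1 hurwitz hurwitz"
  shows "hcoeff (0::'a hurwitz hurwitz) i j = 0" "hcoeff (F + G) i j = hcoeff F i j + hcoeff G i j"
    "hcoeff (F - G) i j = hcoeff F i j - hcoeff G i j" "hcoeff (- F) i j = - hcoeff F i j"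
    "hcoeff (hscalar c * F) i j = c * hcoeff F i j"
  by (simp_all add: hcoeff_def hscalar_def)

lemma hcoeff_sum: "hcoeff (\<Sum>k\<in>I. F k) i j = (\<Sum>k\<in>I. hcoeff (F k) i j)"
  by (simp add: hcoeff_def hnth_sum)

lemma hseries_linear [simp]:
  fixes f g :: "nat \<Rightarrow> nat \<Rightarrow> 'a::field"
  shows "hseries (0::nat \<Rightarrow> nat \<Rightarrow> 'a) = 0" "hseries (f + g) = hseries f + hseries g"
    "hseries (f - g) = hseries f - hseries g" "hseries (fun_scale c f) = hscalar c * hseries f"
  by (auto intro!: hseries_eqI simp: fun_scale_def)

lemma hseries_sum: "hseries (\<Sum>k\<in>I. f k) = (\<Sum>k\<in>I. hseries (f k :: nat \<Rightarrow> nat \<Rightarrow> 'a::field))"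
  by (induction I rule: infinite_finite_induct)
    (simp_all only: sum.infinite sum.empty sum.insert hseries_linear not_False_eq_True)

lemma hscalar_simps:
  "hscalar 0 = 0" "hscalar 1 = 1" "hscalar (c + d) = hscalar c + hscalar d"
  "hscalar (c * d) = hscalar c * hscalar d" "hscalar (- c) = - hscalar c"
  "hscalar (of_nat n) = of_nat n"
  by (simp_all add: hscalar_def hconst_add hconst_times hconst_of_nat hconst_minus)

lemma hcoeff_hx_hy: "hcoeff (hx i * hy j) a b = (if a = i \<and> b = j then 1 else 0)"
  by (simp add: hcoeff_def hx_def hy_def mult.commute[of "hmon i"] hnth_hmon)

lemma hx_0 [simp]: "hx 0 = 1" and hy_0 [simp]: "hy 0 = 1"
  by (simp_all add: hx_def hy_def)

lemma hx_times: "hx i * hx k = of_nat (i + k choose i) * hx (i + k)"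
  by (simp add: hx_def hmon_times)

lemma hy_times: "hy j * hy l = of_nat (j + l choose j) * hy (j + l)"
  by (simp add: hy_def hmon_times hconst_times hconst_of_nat flip: hconst_times)
    (simp add: hconst_times hconst_of_nat)

lemma dx_hx: "dx (hx i) = (if i = 0 then 0 else hx (i - 1))"
  by (simp add: dx_def hx_def hshift_hmon)

lemma dx_hy [simp]: "dx (hy j) = 0" and dx_hscalar [simp]: "dx (hscalar c) = 0"
  by (simp_all add: dx_def hy_def hscalar_def)

lemma dy_hconst: "dy (hconst f) = hconst (hshift f)"
  by (rule hurwitz_eqI) (simp add: hnth_hconst)

lemma dy_hy: "dy (hy j) = (if j = 0 then 0 else hy (j - 1))"
  by (simp add: hy_def dy_hconst hshift_hmon)

lemma dy_hscalar [simp]: "dy (hscalar c) = 0"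
  by (simp add: hscalar_def dy_hconst)

lemma dy_hx [simp]: "dy (hx i) = 0"
proof (rule hurwitz_eqI)
  fix n
  have "hshift (1::'a hurwitz) = 0" using hshift_hconst[of "1::'a"] by simp
  then show "hnth (dy (hx i :: 'a hurwitz hurwitz)) n = hnth 0 n" by (simp add: hx_def hnth_hmon)
qed

lemma poisson_sum:
  "poisson (\<Sum>i\<in>I. f i) g = (\<Sum>i\<in>I. poisson (f i) g)"
  "poisson g (\<Sum>i\<in>I. f i) = (\<Sum>i\<in>I. poisson g (f i))"
  by (induction I rule: infinite_finite_induct; simp add: poisson_add; simp add: poisson_def)+

lemma poisson_scalar:
  "poisson (hscalar c * f) g = hscalar c * poisson f g"
  "poisson f (hscalar c * g) = hscalar c * poisson f g"
  by (simp_all add: poisson_def dx_times dy_times algebra_simps)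

interpretation V: vector_space "fun_scale :: 'a::field \<Rightarrow> _"
  by unfold_locales (auto simp: fun_scale_def algebra_simps fun_eq_iff)

locale truncated_divided_powers =
  fixes T :: "'a::field itself" and n1 n2 P1 P2 :: nat
  assumes CHAR_positive: "CHAR('a) > 0" and P1_def: "P1 = CHAR('a) ^ n1" and P2_def: "P2 = CHAR('a) ^ n2"
begin

section \<open>Binomial coefficients in characteristic p\<close>

lemma prime_CHAR: "prime CHAR('a)"
  using CHAR_positive by (rule prime_CHAR_semidom)

lemma CHAR_gt_1: "CHAR('a) > 1"
  using prime_CHAR prime_gt_1_nat by blast

text \<open>With P the given power of p, l (P choose l) = P (P - 1 choose l - 1). If p did not
  divide the binomial coefficient, P would divide l, which is too small.\<close>

lemma of_nat_choose_power_CHAR: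
  assumes "0 < l" "l < CHAR('a) ^ k"
  shows "of_nat (CHAR('a) ^ k choose l) = (0::'a)"
proof (rule ccontr)
  assume "of_nat (CHAR('a) ^ k choose l) \<noteq> (0::'a)"
  then have "\<not> CHAR('a) dvd (CHAR('a) ^ k choose l)" by (simp add: of_nat_eq_0_iff_char_dvd)
  then have "coprime (CHAR('a) ^ k) (CHAR('a) ^ k choose l)"
    using prime_CHAR by (simp add: prime_imp_coprime)
  moreover have "l * (CHAR('a) ^ k choose l) = CHAR('a) ^ k * (CHAR('a) ^ k - 1 choose (l - 1))"
    using assms times_binomial_minus1_eq[of l "CHAR('a) ^ k"] by simp
  ultimately have "CHAR('a) ^ k dvd l"
    by (metis coprime_dvd_mult_left_iff dvd_triv_left)
  then show False using assms by (simp add: nat_dvd_not_less)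
qed

text \<open>Coefficient form of (1 + X)^(P + c) = (1 + X^P) (1 + X)^c: only two terms of
  Vandermonde's sum survive.\<close>

lemma of_nat_choose_add:
  "of_nat (CHAR('a) ^ k + c choose i) =
   of_nat (c choose i) + (if CHAR('a) ^ k \<le> i then of_nat (c choose (i - CHAR('a) ^ k)) else (0::'a))"
proof -
  let ?P = "CHAR('a) ^ k"
  have P: "?P > 0" using CHAR_positive by simp
  have eq: "of_nat (?P choose l) * of_nat (c choose (i - l)) =
      (if l = 0 then of_nat (c choose i) else 0) + (if l = ?P then of_nat (c choose (i - ?P)) else (0::'a))" for l
    using P of_nat_choose_power_CHAR[of l k] by (cases "l < ?P") (auto simp: binomial_eq_0)
  have "of_nat (?P + c choose i) = (\<Sum>l\<le>i. of_nat (?P choose l) * of_nat (c choose (i - l)) :: 'a)"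
    by (simp flip: vandermonde)
  also have "\<dots> = of_nat (c choose i) + (if ?P \<le> i then of_nat (c choose (i - ?P)) else 0)"
    unfolding eq by (simp add: sum.distrib)
  finally show ?thesis .
qed

text \<open>A case of Kummer's theorem. If i + j = P + c, then c < i because j < P, and i < P, so
  both terms of \<open>of_nat_choose_add\<close> vanish.\<close>

lemma of_nat_choose_carry:
  assumes "i < CHAR('a) ^ k" "j < CHAR('a) ^ k" "CHAR('a) ^ k \<le> i + j"
  shows "of_nat (i + j choose i) = (0::'a)"
  using of_nat_choose_add[of k "i + j - CHAR('a) ^ k" i] assms by (simp add: binomial_eq_0)

lemma of_nat_choose_no_carry:
  assumes "r < CHAR('a) ^ k"
  shows "of_nat (t * CHAR('a) ^ k + r choose r) = (1::'a)"
proof (induction t)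
  case (Suc t)
  then show ?case
    using of_nat_choose_add[of k "t * CHAR('a) ^ k + r" r] assms by (simp add: algebra_simps)
qed simp

lemma of_nat_choose_multiple: "of_nat (t * CHAR('a) ^ k choose CHAR('a) ^ k) = (of_nat t :: 'a)"
proof (induction t)
  case 0
  then show ?case using CHAR_positive by (simp add: binomial_eq_0)
next
  case (Suc t)
  then show ?case
    using of_nat_choose_add[of k "t * CHAR('a) ^ k" "CHAR('a) ^ k"] by (simp add: algebra_simps)
qed

lemma of_nat_series_eq: "of_nat k = (of_nat l :: 'a) \<Longrightarrow> of_nat k = (of_nat l :: 'a hurwitz hurwitz)"
  by (metis hscalar_simps(6))

section \<open>The truncated algebra as a set of series\<close>

definition dp_support :: "(nat \<Rightarrow> nat \<Rightarrow> 'a) set" where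
  "dp_support = {f. \<forall>i j. f i j \<noteq> 0 \<longrightarrow> i < P1 \<and> j < P2}"

lemma P1_pos: "P1 > 0" and P2_pos: "P2 > 0"
  using CHAR_positive by (simp_all add: P1_def P2_def)

lemma subspace_dp_support: "V.subspace dp_support"
  by (auto simp: V.subspace_def dp_support_def fun_scale_def) (metis add.right_neutral)+

lemma dp_monom_support: "dp_monom n1 n2 i j \<in> dp_support"
  by (auto simp: dp_support_def dp_monom_def simp flip: P1_def P2_def)

lemma hseries_dp_monom:
  "hseries (dp_monom n1 n2 (int i) (int j) :: nat \<Rightarrow> nat \<Rightarrow> 'a) =
   (if i < P1 \<and> j < P2 then hx i * hy j else 0)"
  by (rule hseries_eqI) (auto simp: hcoeff_hx_hy dp_monom_def simp flip: P1_def P2_def)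

lemma dp_monom_negative: "i < 0 \<or> j < 0 \<Longrightarrow> dp_monom n1 n2 i j = (0 :: nat \<Rightarrow> nat \<Rightarrow> 'a)"
  by (auto simp: dp_monom_def fun_eq_iff)

lemma hseries_expansion:
  assumes "f \<in> dp_support"
  shows "hseries f = (\<Sum>i<P1. \<Sum>j<P2. hscalar (f i j) * (hx i * hy j))"
proof (rule hseries_eqI)
  fix a b
  have "hcoeff (\<Sum>i<P1. \<Sum>j<P2. hscalar (f i j) * (hx i * hy j)) a b =
      (\<Sum>i<P1. \<Sum>j<P2. if i = a \<and> j = b then f a b else 0)"
    unfolding hcoeff_sum by (intro sum.cong refl) (auto simp: hcoeff_hx_hy)
  also have "\<dots> = (\<Sum>i<P1. if i = a then (\<Sum>j<P2. if j = b then f a b else 0) else 0)"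
    by (intro sum.cong refl) auto
  also have "\<dots> = f a b"
    using assms by (auto simp: dp_support_def)
  finally show "hcoeff (hseries f) a b = hcoeff (\<Sum>i<P1. \<Sum>j<P2. hscalar (f i j) * (hx i * hy j)) a b"
    by simp
qed

lemma dp_mult_support: "dp_mult n1 n2 f g \<in> dp_support"
  unfolding dp_mult_def
  by (intro V.subspace_sum V.subspace_scale subspace_dp_support dp_monom_support)

text \<open>No truncation is needed: products of monomials that exceed the bounds vanish because of
  the carry in the binomial coefficient.\<close>

lemma hseries_dp_mult:
  assumes f: "f \<in> dp_support" and g: "g \<in> dp_support"
  shows "hseries (dp_mult n1 n2 f g) = hseries f * hseries g"
proof -
  have term_eq: "hseries (fun_scale (f i j * g k l * of_nat (i + k choose i) * of_nat (j + l choose j))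
        (dp_monom n1 n2 (int i + int k) (int j + int l))) =
      hscalar (f i j) * (hx i * hy j) * (hscalar (g k l) * (hx k * hy l))"
    if "i < P1" "j < P2" "k < P1" "l < P2" for i j k l
  proof -
    have "hscalar (f i j) * (hx i * hy j) * (hscalar (g k l) * (hx k * hy l)) =
        hscalar (f i j) * hscalar (g k l) * ((hx i * hx k) * (hy j * hy l))" by simp
    also have "\<dots> = hscalar (f i j * g k l * of_nat (i + k choose i) * of_nat (j + l choose j)) *
        (hx (i + k) * hy (j + l))"
      by (simp only: hx_times hy_times) (simp add: hscalar_simps)
    also have "\<dots> = hseries (fun_scale (f i j * g k l * of_nat (i + k choose i) * of_nat (j + l choose j))
        (dp_monom n1 n2 (int i + int k) (int j + int l)))"
      using of_nat_choose_carry[of i n1 k, folded P1_def] of_nat_choose_carry[of j n2 l, folded P2_def] that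
        hseries_dp_monom[of "i + k" "j + l"]
      by (cases "i + k < P1 \<and> j + l < P2") (auto simp: hscalar_simps(1))
    finally show ?thesis by simp
  qed
  have "hseries (dp_mult n1 n2 f g) =
      (\<Sum>i<P1. \<Sum>j<P2. \<Sum>k<P1. \<Sum>l<P2.
        hscalar (f i j) * (hx i * hy j) * (hscalar (g k l) * (hx k * hy l)))"
    unfolding dp_mult_def P1_def[symmetric] P2_def[symmetric] hseries_sum by (intro sum.cong refl term_eq) auto
  also have "\<dots> = hseries f * hseries g"
    unfolding hseries_expansion[OF f] hseries_expansion[OF g] sum_distrib_right
    by (simp only: sum_distrib_left)
  finally show ?thesis .
qed

text \<open>A product formed by \<open>dp_mult\<close> is in range by construction, and it agrees
  with the product of series.\<close>

lemma hcoeff_times_support: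
  assumes "hcoeff F \<in> dp_support" "hcoeff G \<in> dp_support"
  shows "hcoeff (F * G) \<in> dp_support"
  using hseries_dp_mult[OF assms] dp_mult_support[of "hcoeff F" "hcoeff G"]
  by (metis hcoeff_hseries hseries_hcoeff)

lemma hcoeff_dx_support: "hcoeff F \<in> dp_support \<Longrightarrow> hcoeff (dx F) \<in> dp_support"
  using Suc_lessD by (fastforce simp: dp_support_def hcoeff_def dx_def)

lemma hcoeff_dy_support: "hcoeff F \<in> dp_support \<Longrightarrow> hcoeff (dy F) \<in> dp_support"
  using Suc_lessD by (fastforce simp: dp_support_def hcoeff_def)

lemma hcoeff_poisson_support:
  assumes "hcoeff F \<in> dp_support" "hcoeff G \<in> dp_support"
  shows "hcoeff (poisson F G) \<in> dp_support"
proof -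
  have "hcoeff (poisson F G) = hcoeff (dy F * dx G) - hcoeff (dx F * dy G)"
    by (intro ext) (simp add: poisson_def)
  then show ?thesis
    using assms by (simp add: V.subspace_diff[OF subspace_dp_support] hcoeff_times_support
        hcoeff_dx_support hcoeff_dy_support)
qed

text \<open>In a derivative by x the exponent P1 - 1 could only come from P1, which is out of range,
  and likewise for y. Both summands of the divergence are derivatives of elements that are in
  range.\<close>

lemma hcoeff_poisson_top:
  assumes "hcoeff F \<in> dp_support" "hcoeff G \<in> dp_support"
  shows "hcoeff (poisson F G) (P1 - 1) (P2 - 1) = 0"
proof -
  have x: "hcoeff (dx h) (P1 - 1) j = 0" if "hcoeff h \<in> dp_support" for h j
    using that P1_pos by (auto simp: dp_support_def hcoeff_def dx_def)
  have y: "hcoeff (dy h) i (P2 - 1) = 0" if "hcoeff h \<in> dp_support" for h i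
    using that P2_pos by (auto simp: dp_support_def hcoeff_def)
  show ?thesis
    unfolding poisson_divergence
    using assms x y by (simp add: hcoeff_times_support hcoeff_dx_support hcoeff_dy_support)
qed

section \<open>The Hamiltonian bracket as a Poisson bracket modulo constants\<close>

lemma hamiltonian_bracket_eq:
  assumes f: "f \<in> dp_support" and g: "g \<in> dp_support"
  shows "hamiltonian_bracket n1 n2 f g = mod_constants (hcoeff (poisson (hseries f) (hseries g)))"
proof -
  \<comment> \<open>For i = 0 the exponent -1, which is read as 0, matches the vanishing
    derivative.\<close>
  have dxm: "hseries (dp_monom n1 n2 (int i - 1) (int j) :: nat \<Rightarrow> nat \<Rightarrow> 'a) = dx (hx i * hy j)"
    if "i < P1" "j < P2" for i j
    using that hseries_dp_monom[of "i - 1" j] dp_monom_negative[of "int i - 1" "int j"]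
    by (cases "i = 0") (simp_all add: dx_times dx_hx of_nat_diff)
  have dym: "hseries (dp_monom n1 n2 (int i) (int j - 1) :: nat \<Rightarrow> nat \<Rightarrow> 'a) = dy (hx i * hy j)"
    if "i < P1" "j < P2" for i j
    using that hseries_dp_monom[of i "j - 1"] dp_monom_negative[of "int i" "int j - 1"]
    by (cases "j = 0") (simp_all add: dy_times dy_hy of_nat_diff)
  have term_eq: "hseries (fun_scale (f i j * g k l)
        (dp_mult n1 n2 (dp_monom n1 n2 (int i) (int j - 1)) (dp_monom n1 n2 (int k - 1) (int l)) -
         dp_mult n1 n2 (dp_monom n1 n2 (int i - 1) (int j)) (dp_monom n1 n2 (int k) (int l - 1)))) =
      poisson (hscalar (f i j) * (hx i * hy j)) (hscalar (g k l) * (hx k * hy l))"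
    if "i < P1" "j < P2" "k < P1" "l < P2" for i j k l
    using that unfolding poisson_scalar
    by (simp add: hseries_dp_mult dp_monom_support dxm dym hscalar_simps poisson_def mult.assoc)
  have "hseries (\<Sum>i<P1. \<Sum>j<P2. \<Sum>k<P1. \<Sum>l<P2.
        fun_scale (f i j * g k l)
          (dp_mult n1 n2 (dp_monom n1 n2 (int i) (int j - 1)) (dp_monom n1 n2 (int k - 1) (int l)) -
           dp_mult n1 n2 (dp_monom n1 n2 (int i - 1) (int j)) (dp_monom n1 n2 (int k) (int l - 1)))) =
      (\<Sum>i<P1. \<Sum>j<P2. \<Sum>k<P1. \<Sum>l<P2.
        poisson (hscalar (f i j) * (hx i * hy j)) (hscalar (g k l) * (hx k * hy l)))"
    unfolding hseries_sum by (intro sum.cong refl term_eq) auto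
  also have "\<dots> = poisson (hseries f) (hseries g)"
    unfolding hseries_expansion[OF f] hseries_expansion[OF g] poisson_sum(1)
    by (simp only: poisson_sum(2))
  finally show ?thesis
    unfolding hamiltonian_bracket_def P1_def[symmetric] P2_def[symmetric]
    by (rule subst) (simp only: hcoeff_hseries)
qed

lemma mod_constants_linear:
  fixes f g :: "nat \<Rightarrow> nat \<Rightarrow> 'a"
  shows "mod_constants (f + g) = mod_constants f + mod_constants g"
    "mod_constants (fun_scale c f) = fun_scale c (mod_constants f)"
    "mod_constants (0 :: nat \<Rightarrow> nat \<Rightarrow> 'a) = 0"
  by (auto simp: mod_constants_def fun_scale_def fun_eq_iff)

lemma hseries_mod_constants: "hseries (mod_constants f) = hseries f - hscalar (f 0 0 :: 'a)"
proof (rule hseries_eqI)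
  fix i j
  have "hcoeff (hscalar (f 0 0) :: 'a hurwitz hurwitz) i j = (if i = 0 \<and> j = 0 then f 0 0 else 0)"
    by (simp add: hcoeff_def hscalar_def hnth_hconst)
  then show "hcoeff (hseries (mod_constants f)) i j = hcoeff (hseries f - hscalar (f 0 0)) i j"
    by (simp add: mod_constants_def)
qed

text \<open>Constants are central for the Poisson bracket. Hence the choice of a representative
  inside an iterated bracket has no effect, and the Jacobi identity survives the reduction modulo
  constants.\<close>

lemma poisson_mod_constants:
  "poisson (hseries (mod_constants f)) G = poisson (hseries (f :: nat \<Rightarrow> nat \<Rightarrow> 'a)) G"
  "poisson G (hseries (mod_constants f)) = poisson G (hseries f)"
  by (simp_all add: hseries_mod_constants poisson_def)

lemma mod_constants_support: "f \<in> dp_support \<Longrightarrow> mod_constants f \<in> dp_support"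
  by (auto simp: dp_support_def mod_constants_def)

text \<open>Replaces the span by conditions on coefficients, so that membership becomes a matter of
  two coefficients and the range.\<close>

lemma hamiltonian_algebra_eq:
  "hamiltonian_algebra n1 n2 = {f \<in> dp_support. f 0 0 = 0 \<and> f (P1 - 1) (P2 - 1) = (0::'a)}"
    (is "?L = ?R")
proof
  have sub: "V.subspace ?R"
    using subspace_dp_support by (auto simp: V.subspace_def fun_scale_def)
  show "?L \<subseteq> ?R"
    unfolding hamiltonian_algebra_def P1_def[symmetric] P2_def[symmetric]
    using P1_pos P2_pos by (intro V.span_minimal sub) (auto simp: dp_support_def dp_monom_def simp flip: P1_def P2_def split: if_splits)
  show "?R \<subseteq> ?L"
  proof
    fix f assume f: "f \<in> ?R"
    have m: "fun_scale (f i j) (dp_monom n1 n2 (int i) (int j)) \<in> ?L" if "i < P1" "j < P2" for i j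
    proof (cases "(i, j) = (0, 0) \<or> (i, j) = (P1 - 1, P2 - 1)")
      case True
      then have "f i j = 0" using f by auto
      then show ?thesis unfolding hamiltonian_algebra_def by (simp add: V.span_zero)
    next
      case False
      then show ?thesis
        unfolding hamiltonian_algebra_def P1_def[symmetric] P2_def[symmetric]
        using that by (intro V.span_scale V.span_base) blast
    qed
    have "hseries f = hseries (\<Sum>i<P1. \<Sum>j<P2. fun_scale (f i j) (dp_monom n1 n2 (int i) (int j)))"
      using f hseries_expansion[of f] by (simp add: hseries_sum hseries_dp_monom)
    then have eq: "f = (\<Sum>i<P1. \<Sum>j<P2. fun_scale (f i j) (dp_monom n1 n2 (int i) (int j)))"
      by (simp only: hseries_inject)
    have "(\<Sum>i<P1. \<Sum>j<P2. fun_scale (f i j) (dp_monom n1 n2 (int i) (int j))) \<in> ?L"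
      unfolding hamiltonian_algebra_def
      by (intro V.span_sum m[unfolded hamiltonian_algebra_def]) auto
    then show "f \<in> ?L" using eq by simp
  qed
qed

lemma bracket_in:
  assumes "f \<in> dp_support" "g \<in> dp_support"
  shows "hamiltonian_bracket n1 n2 f g \<in> hamiltonian_algebra n1 n2"
proof -
  have "hcoeff (poisson (hseries f) (hseries g)) \<in> dp_support"
    using assms by (intro hcoeff_poisson_support) simp_all
  moreover have "hcoeff (poisson (hseries f) (hseries g)) (P1 - 1) (P2 - 1) = 0"
    using assms by (intro hcoeff_poisson_top) simp_all
  ultimately show ?thesis
    using mod_constants_support
    unfolding hamiltonian_algebra_eq hamiltonian_bracket_eq[OF assms] by (auto simp: mod_constants_def)
qed

lemma hamiltonian_lie_algebra:
  "lie_algebra fun_scale (hamiltonian_bracket n1 n2) (hamiltonian_algebra n1 n2 :: (nat \<Rightarrow> nat \<Rightarrow> 'a) set)"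
proof -
  let ?H = "hamiltonian_algebra n1 n2 :: (nat \<Rightarrow> nat \<Rightarrow> 'a) set"
  let ?br = "hamiltonian_bracket n1 n2 :: (nat \<Rightarrow> nat \<Rightarrow> 'a) \<Rightarrow> _"
  have H: "f \<in> dp_support" if "f \<in> ?H" for f using that by (simp add: hamiltonian_algebra_eq)
  have sub: "V.subspace ?H" unfolding hamiltonian_algebra_def by simp
  note br = hamiltonian_bracket_eq[OF H H]
  have fn: "hcoeff (F + G) = hcoeff F + hcoeff G" "hcoeff (hscalar c * F) = fun_scale c (hcoeff F)"
    for F G :: "'a hurwitz hurwitz" and c by (auto simp: fun_scale_def fun_eq_iff)
  show ?thesis
  proof
    fix f g h :: "nat \<Rightarrow> nat \<Rightarrow> 'a" and c
    show "V.subspace ?H" by (rule sub)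
    show "?br f g \<in> ?H" if "f \<in> ?H" "g \<in> ?H" using that H by (intro bracket_in)
    show "?br (f + g) h = ?br f h + ?br g h" if "f \<in> ?H" "g \<in> ?H" "h \<in> ?H"
      using that V.subspace_add[OF sub] by (simp add: br poisson_add fn mod_constants_linear)
    show "?br f (g + h) = ?br f g + ?br f h" if "f \<in> ?H" "g \<in> ?H" "h \<in> ?H"
      using that V.subspace_add[OF sub] by (simp add: br poisson_add fn mod_constants_linear)
    show "?br (fun_scale c f) g = fun_scale c (?br f g)" if "f \<in> ?H" "g \<in> ?H"
      using that V.subspace_scale[OF sub] by (simp add: br poisson_scalar fn mod_constants_linear)
    show "?br f (fun_scale c g) = fun_scale c (?br f g)" if "f \<in> ?H" "g \<in> ?H"
      using that V.subspace_scale[OF sub] by (simp add: br poisson_scalar fn mod_constants_linear)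
    show "?br f f = 0" if "f \<in> ?H"
      using that by (simp add: br poisson_self) (simp add: mod_constants_def fun_eq_iff)
    show "?br (?br f g) h + ?br (?br g h) f + ?br (?br h f) g = 0"
      if "f \<in> ?H" "g \<in> ?H" "h \<in> ?H"
    proof -
      have "?br (?br f g) h = mod_constants (hcoeff (poisson (poisson (hseries f) (hseries g)) (hseries h)))"
        if "f \<in> ?H" "g \<in> ?H" "h \<in> ?H" for f g h
        using that bracket_in[OF H H, of f g] by (simp add: br poisson_mod_constants)
      then show ?thesis
        using that poisson_jacobi[of "hseries f" "hseries g" "hseries h"]
        by (simp flip: mod_constants_linear(1) fn(1)) (simp add: mod_constants_def fun_eq_iff)
    qed
  qed
qed

end

section \<open>The alternative basis\<close>

lemma hscalar_of_int: "hscalar (of_int z) = of_int z"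
  by (cases z rule: int_diff_cases) (simp add: hscalar_simps diff_conv_add_uminus del: add_uminus_conv_diff)

locale hamiltonian_basis = truncated_divided_powers T "Suc s" n "p * w" q
  for T :: "'a::field itself" and s n p q w :: nat +
  fixes N :: nat and m :: int and \<pi> :: 'a
  assumes CHAR_eq: "CHAR('a) = p" and odd_p: "odd p" and n_pos: "n > 0" and s_pos: "s > 0"
    and w_def: "w = p ^ s" and N_def: "N = (q - 1) * (p * w)" and m_def: "of_int m = \<pi>"
    and \<pi>_nonzero: "\<pi> \<noteq> 0"
begin

lemma q_def: "q = p ^ n"
  using P2_def CHAR_eq by simp

lemma p_ge_3: "p \<ge> 3"
  using CHAR_gt_1 CHAR_eq odd_p by (cases "p = 2") auto

lemma w_gt_1: "w > 1"
  unfolding w_def using p_ge_3 s_pos by (intro one_less_power) auto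

lemma q_ge_3: "q \<ge> 3"
  unfolding q_def using p_ge_3 n_pos self_le_power[of p n] by linarith

lemma p_dvd_q: "p dvd q"
  unfolding q_def using n_pos by simp

lemma of_int_eq_0_iff: "of_int z = (0::'a) \<longleftrightarrow> int p dvd z"
  using of_int_eq_0_iff_char_dvd[of z, where ?'a = 'a] CHAR_eq by simp

lemma of_int_cong: "[z = z'] (mod int p) \<Longrightarrow> of_int z = (of_int z' :: 'a)"
  using of_int_eq_0_iff[of "z - z'"] by (simp add: cong_iff_dvd_diff)

lemma of_int_series_cong: "[z = z'] (mod int p) \<Longrightarrow> of_int z = (of_int z' :: 'a hurwitz hurwitz)"
  using of_int_cong by (metis hscalar_of_int)

lemma of_nat_series_0: "of_nat k = (0::'a) \<Longrightarrow> of_nat k = (0 :: 'a hurwitz hurwitz)"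
  using of_nat_series_eq[of k 0] by simp

lemma fact_nonzero: "a < p \<Longrightarrow> of_nat (fact a) \<noteq> (0::'a)"
  using prime_CHAR CHAR_eq by (simp add: of_nat_eq_0_iff_char_dvd prime_dvd_fact_iff)

section \<open>Powers of E and their products with monomials\<close>

definition E :: "'a hurwitz hurwitz" where "E = 1 + hx w"

lemma hx_w_power: "hx w ^ i = (of_nat (fact i) * hx (i * w) :: 'a hurwitz hurwitz)"
proof (induction i)
  case (Suc i)
  have "of_nat (w + i * w choose w) = (of_nat (Suc i) :: 'a hurwitz hurwitz)"
    using of_nat_choose_multiple[of "Suc i" s] CHAR_eq w_def by (intro of_nat_series_eq) simp
  then have "hx w * hx (i * w) = of_nat (Suc i) * (hx (Suc i * w) :: 'a hurwitz hurwitz)"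
    using hx_times[of w "i * w", where ?'a = 'a] by (simp only: mult_Suc)
  then show ?case
    using Suc by (simp only: power_Suc mult.left_commute[of "hx w"] fact_Suc of_nat_mult of_nat_id mult_ac)
qed simp

lemma E_power: "E ^ a = (\<Sum>i\<le>a. of_nat ((a choose i) * fact i) * hx (i * w))"
proof -
  have "E ^ a = (\<Sum>i\<le>a. of_nat (a choose i) * hx w ^ i)"
    using binomial_ring[of "hx w" 1 a] by (simp add: E_def add.commute)
  then show ?thesis by (simp add: hx_w_power mult.assoc)
qed

text \<open>For r < w there is no carry between a multiple of w and r, so the products of
  x-monomials have binomial coefficient 1.\<close>

lemma E_power_hx_hy:
  assumes "r < w"
  shows "E ^ a * (hx r * hy l) =
    (\<Sum>i\<le>a. hscalar (of_nat ((a choose i) * fact i)) * (hx (i * w + r) * hy l))"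
proof -
  have "hx (i * w) * hx r = (hx (i * w + r) :: 'a hurwitz hurwitz)" for i
  proof -
    have "of_nat (i * w + r choose i * w) = (1 :: 'a hurwitz hurwitz)"
      using of_nat_choose_no_carry[of r s i] assms CHAR_eq w_def
        of_nat_series_eq[of "i * w + r choose r" 1] binomial_symmetric[of r "i * w + r"] by simp
    then show ?thesis by (simp add: hx_times)
  qed
  then show ?thesis
    unfolding E_power sum_distrib_right hscalar_simps(6)
    by (intro sum.cong refl) (metis mult.assoc)
qed

text \<open>Modulo p, the coefficient (p choose i) i! vanishes for 0 < i < p because of the binomial
  coefficient and for i = p because of the factorial.\<close>

lemma E_power_p: "E ^ p = 1"
proof -
  have "of_nat ((p choose i) * fact i) = (0 :: 'a hurwitz hurwitz)" if "0 < i" "i \<le> p" for i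
  proof (rule of_nat_series_0)
    have "p dvd (p choose i) * fact i"
    proof (cases "i = p")
      case True
      then show ?thesis using p_ge_3 dvd_fact[of p p] by simp
    next
      case False
      then show ?thesis
        using of_nat_choose_power_CHAR[of i 1] that CHAR_eq
        by (simp add: of_nat_eq_0_iff_char_dvd)
    qed
    then show "of_nat ((p choose i) * fact i) = (0::'a)"
      using CHAR_eq of_nat_eq_0_iff_char_dvd by blast
  qed
  then have "E ^ p = (\<Sum>i\<le>p. if i = 0 then 1 else 0)"
    unfolding E_power by (intro sum.cong refl) (auto simp del: of_nat_mult of_nat_fact)
  then show ?thesis by simp
qed

text \<open>Since the p-th power of E is 1, the least nonnegative residue gives a meaning to all
  integer exponents. Negative ones arise from differentiation and in the chain.\<close>

definition Epow :: "int \<Rightarrow> 'a hurwitz hurwitz" where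
  "Epow z = E ^ nat (z mod int p)"

lemma E_power_mod: "E ^ a = E ^ (a mod p)"
proof -
  have "E ^ a = (E ^ p) ^ (a div p) * E ^ (a mod p)"
    by (simp flip: power_mult power_add)
  then show ?thesis by (simp add: E_power_p)
qed

lemma Epow_int: "Epow (int a) = E ^ a"
  by (simp add: Epow_def E_power_mod[of a] flip: zmod_int)

lemma Epow_cong: "[z = z'] (mod int p) \<Longrightarrow> Epow z = Epow z'"
  by (simp add: Epow_def cong_def)

lemma Epow_add: "Epow z * Epow z' = Epow (z + z')"
proof -
  have "Epow z * Epow z' = Epow (int (nat (z mod int p) + nat (z' mod int p)))"
    unfolding Epow_int by (simp add: Epow_def power_add)
  also have "\<dots> = Epow (z + z')"
    using p_ge_3 by (intro Epow_cong) (simp add: cong_def mod_simps)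
  finally show ?thesis .
qed

lemma dy_E_power: "dy (E ^ a) = 0"
proof (induction a)
  case 0
  show ?case using dy_hscalar[of 1] by (simp add: hscalar_simps)
next
  case (Suc a)
  have "dy E = 0" using dy_hscalar[of 1] by (simp add: E_def hscalar_simps)
  then show ?case using Suc by (simp add: dy_times)
qed

lemma dx_E_power: "dx (E ^ a) = of_nat a * E ^ (a - 1) * hx (w - 1)"
proof (induction a)
  case 0
  show ?case using dx_hscalar[of 1] by (simp add: hscalar_simps)
next
  case (Suc a)
  have "dx E = hx (w - 1)" using dx_hscalar[of 1] w_gt_1 by (simp add: E_def hscalar_simps dx_hx)
  then show ?case using Suc by (cases a) (simp_all add: dx_times algebra_simps)
qed

lemma dx_Epow: "dx (Epow z) = of_int z * Epow (z - 1) * hx (w - 1)"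
proof -
  define a where "a = nat (z mod int p)"
  have a: "int a = z mod int p" using p_ge_3 by (simp add: a_def)
  have z: "of_int z = (of_nat a :: 'a hurwitz hurwitz)"
    using of_int_series_cong[of z "int a"] unfolding a by (metis a cong_mod_left cong_refl of_int_of_nat_eq)
  have "dx (Epow z) = of_nat a * E ^ (a - 1) * hx (w - 1)"
    unfolding Epow_def a_def[symmetric] by (rule dx_E_power)
  also have "\<dots> = of_nat a * Epow (z - 1) * hx (w - 1)"
  \<comment> \<open>For a = 0 the truncated exponent a - 1 is the wrong one, but the factor in front
    vanishes.\<close>
  proof (cases "a = 0")
    case False
    have "E ^ (a - 1) = Epow (int a - 1)" using Epow_int[of "a - 1"] False by simp
    also have "\<dots> = Epow (z - 1)" using a by (intro Epow_cong) (simp add: cong_def mod_simps)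
    finally show ?thesis by simp
  qed simp
  finally show ?thesis using z by simp
qed

text \<open>The basis elements before reduction modulo constants, with r = k + 1 and l = j + 1, for
  an arbitrary integer exponent of E. Up to scalars from the prime field the family is closed under
  products, apart from exponents out of range, and under both derivations.\<close>

definition G :: "int \<Rightarrow> nat \<Rightarrow> nat \<Rightarrow> 'a hurwitz hurwitz" where
  "G z r l = Epow z * (hx r * hy l)"

lemma G_cong: "[z = z'] (mod int p) \<Longrightarrow> G z r l = G z' r l"
  using Epow_cong by (simp add: G_def)

lemma dy_G: "dy (G z r l) = (if l = 0 then 0 else G z r (l - 1))"
  by (simp add: G_def Epow_def dy_times dy_E_power dy_hy)

lemma G_times:
  "G z r l * G z' r' l' =
   of_nat (r + r' choose r) * of_nat (l + l' choose l) * G (z + z') (r + r') (l + l')"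
proof -
  have "G z r l * G z' r' l' = (Epow z * Epow z') * ((hx r * hx r') * (hy l * hy l'))"
    by (simp add: G_def mult_ac)
  also have "\<dots> = of_nat (r + r' choose r) * of_nat (l + l' choose l) * G (z + z') (r + r') (l + l')"
    unfolding Epow_add hx_times hy_times by (simp add: G_def mult_ac)
  finally show ?thesis .
qed

text \<open>The exponent r + r' is still in range, below p w, but the carry past w already makes the
  binomial coefficient divisible by p.\<close>

lemma G_overflow_x: "r < w \<Longrightarrow> r' < w \<Longrightarrow> w \<le> r + r' \<Longrightarrow> G z r l * G z' r' l' = 0"
  using of_nat_choose_carry[of r s r', unfolded CHAR_eq, folded w_def] of_nat_series_0
  by (simp add: G_times)

lemma G_overflow_y: "l < q \<Longrightarrow> l' < q \<Longrightarrow> q \<le> l + l' \<Longrightarrow> G z r l * G z' r' l' = 0"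
  using of_nat_choose_carry[of l n l', unfolded CHAR_eq, folded q_def] of_nat_series_0
  by (simp add: G_times)

text \<open>Differentiating the power of E brings in x^(w - 1). Its product with x^(r) overflows if
  r > 0; if r = 0 it is the only contribution.\<close>

lemma dx_G:
  assumes "r < w"
  shows "dx (G z r l) = (if r = 0 then of_int z * G (z - 1) (w - 1) l else G z (r - 1) l)"
proof -
  have "dx (G z r l) = of_int z * (G (z - 1) (w - 1) 0 * G 0 r l) + Epow z * (dx (hx r) * hy l)"
    by (simp add: G_def dx_times dx_Epow Epow_int[of 0, simplified] mult_ac)
  moreover have "G (z - 1) (w - 1) 0 * G 0 r l = 0" if "r > 0"
    using that assms w_gt_1 by (intro G_overflow_x) auto
  moreover have "G (z - 1) (w - 1) 0 * G 0 0 l = G (z - 1) (w - 1) l" by (simp add: G_times)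
  ultimately show ?thesis by (auto simp: dx_hx G_def)
qed

lemma G_power: "G z r l = E ^ nat (z mod int p) * (hx r * hy l)"
  by (simp add: G_def Epow_def)

text \<open>An x-exponent i w + r determines i and r by division. In particular, different pairs (r,
  l) give disjoint supports.\<close>

lemma hcoeff_G:
  assumes "r < w"
  shows "hcoeff (G z r l) x y = (if x mod w = r \<and> y = l
    then of_nat ((nat (z mod int p) choose (x div w)) * fact (x div w)) else 0)"
proof -
  let ?a = "nat (z mod int p)"
  have eq: "x = i * w + r \<longleftrightarrow> x mod w = r \<and> i = x div w" for i
    using assms by (auto simp: div_mult_mod_eq[symmetric])
  have "hcoeff (G z r l) x y = (\<Sum>i\<le>?a. if i = x div w then
     (if x mod w = r \<and> y = l then of_nat ((?a choose i) * fact i) else 0) else 0)"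
    unfolding G_power E_power_hx_hy[OF assms] hcoeff_sum
    by (intro sum.cong refl) (simp add: hcoeff_hx_hy eq del: of_nat_mult of_nat_fact)
  then show ?thesis by (auto simp: binomial_eq_0)
qed

lemma G_support:
  assumes "r < w" "l < q" shows "hcoeff (G z r l) \<in> dp_support"
proof -
  have "nat (z mod int p) < p" using p_ge_3 by (simp add: nat_less_iff)
  then have "x < p * w" if "x div w \<le> nat (z mod int p)" for x
    using that w_gt_1 by (simp add: div_less_iff_less_mult[symmetric])
  then show ?thesis
    using assms unfolding dp_support_def
    by (auto simp: hcoeff_G split: if_splits) (metis binomial_eq_0 mult_eq_0_iff not_le of_nat_0)
qed

section \<open>The elements modulo constants\<close>

definition g :: "int \<Rightarrow> nat \<Rightarrow> nat \<Rightarrow> nat \<Rightarrow> nat \<Rightarrow> 'a" where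
  "g z r l = mod_constants (hcoeff (G z r l))"

lemma g_cong: "[z = z'] (mod int p) \<Longrightarrow> g z r l = g z' r l"
  using G_cong by (simp add: g_def)

lemma g_apply:
  assumes "r < w"
  shows "g z r l x y = (if x mod w = r \<and> y = l \<and> (x, y) \<noteq> (0, 0)
    then of_nat ((nat (z mod int p) choose (x div w)) * fact (x div w)) else 0)"
  using assms by (auto simp: g_def mod_constants_def hcoeff_G simp del: of_nat_mult of_nat_fact)

lemma g_support: "r < w \<Longrightarrow> l < q \<Longrightarrow> g z r l \<in> dp_support"
  unfolding g_def by (intro mod_constants_support G_support)

text \<open>With a the residue of z, the highest term has the coefficient a!, which is nonzero since
  a < p. The excluded case is that of the constant 1.\<close>

lemma g_leading:
  assumes r: "r < w" and nz: "\<not> (r = 0 \<and> l = 0 \<and> int p dvd z)"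
  shows "g z r l (nat (z mod int p) * w + r) l \<noteq> 0"
proof -
  define a where "a = nat (z mod int p)"
  have a: "a < p" using p_ge_3 by (simp add: a_def nat_less_iff)
  have "z mod int p \<ge> 0" using p_ge_3 by simp
  then have "a = 0 \<Longrightarrow> int p dvd z" by (simp add: a_def dvd_eq_mod_eq_0)
  then have "(a * w + r, l) \<noteq> (0, 0)" using nz r by auto
  moreover have "(a * w + r) mod w = r" "(a * w + r) div w = a" using r by simp_all
  ultimately show ?thesis
    using fact_nonzero[OF a] unfolding g_apply[OF r] a_def[symmetric] by simp
qed

lemma g_eq_0_iff:
  assumes "r < w" shows "g z r l = 0 \<longleftrightarrow> r = 0 \<and> l = 0 \<and> int p dvd z"
proof
  assume "g z r l = 0"
  then show "r = 0 \<and> l = 0 \<and> int p dvd z" using g_leading[OF assms] by (metis zero_fun_apply)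
next
  assume "r = 0 \<and> l = 0 \<and> int p dvd z"
  then have "nat (z mod int p) = 0" "r = 0" "l = 0" by auto
  moreover have "x = 0" if "x mod w = 0" "x div w = 0" for x
    using that div_mult_mod_eq[of x w] by simp
  ultimately have "g z r l x y = 0" for x y
    using assms by (cases "x div w = 0") (auto simp: g_apply binomial_eq_0)
  then show "g z r l = 0" by (simp add: fun_eq_iff)
qed

abbreviation H :: "(nat \<Rightarrow> nat \<Rightarrow> 'a) set" where "H \<equiv> hamiltonian_algebra (Suc s) n"
abbreviation br where "br \<equiv> hamiltonian_bracket (Suc s) n :: (nat \<Rightarrow> nat \<Rightarrow> 'a) \<Rightarrow> _"

lemma top_div_mod: "(p * w - 1) mod w = w - 1" "(p * w - 1) div w = p - 1"
proof -
  have *: "p * w - 1 = (p - 1) * w + (w - 1)"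
    using p_ge_3 w_gt_1 by (cases p) auto
  show "(p * w - 1) mod w = w - 1" "(p * w - 1) div w = p - 1"
    unfolding * using w_gt_1 mod_mult_self3[of "p - 1" w "w - 1"] div_mult_self3[of w "p - 1" "w - 1"]
    by (simp_all only: mod_less div_less diff_less zero_less_one less_trans[OF zero_less_one w_gt_1]
        add_0_right)
qed

text \<open>Since p w - 1 = (p - 1) w + (w - 1), only the power p - 1 of E together with x^(w - 1)
  reaches the top exponent of x.\<close>

lemma g_top:
  assumes "r < w"
  shows "g z r l (p * w - 1) (q - 1) = 0 \<longleftrightarrow> \<not> (r = w - 1 \<and> l = q - 1 \<and> [z = - 1] (mod int p))"
proof -
  have "[z = -1] (mod int p) \<longleftrightarrow> z mod int p = int p - 1"
    using p_ge_3 by (simp add: cong_def zmod_minus1)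
  also have "\<dots> \<longleftrightarrow> nat (z mod int p) = p - 1"
    using p_ge_3 by (auto simp: nat_eq_iff)
  finally have 1: "[z = -1] (mod int p) \<longleftrightarrow> nat (z mod int p) = p - 1" .
  have lt: "nat (z mod int p) < p" using p_ge_3 by (simp add: nat_less_iff)
  then have 2: "nat (z mod int p) \<noteq> p - 1 \<Longrightarrow> (nat (z mod int p) choose (p - 1)) = 0"
    by (intro binomial_eq_0) linarith
  have 3: "of_nat (fact (p - 1)) \<noteq> (0::'a)" using p_ge_3 by (intro fact_nonzero) simp
  show ?thesis
    using 1 2 3 q_ge_3 unfolding g_apply[OF assms] top_div_mod
    by (auto simp: binomial_eq_0 simp del: of_nat_fact)
qed

lemma g_in_H:
  assumes "r < w" "l < q" "\<not> (r = w - 1 \<and> l = q - 1 \<and> [z = - 1] (mod int p))"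
  shows "g z r l \<in> H"
  using assms g_support g_top[OF assms(1), of z l] unfolding hamiltonian_algebra_eq
  by (auto simp: g_def mod_constants_def)

lemma br_g:
  assumes "r < w" "l < q" "r' < w" "l' < q"
  shows "br (g z r l) (g z' r' l') = mod_constants (hcoeff (poisson (G z r l) (G z' r' l')))"
  using assms g_support hamiltonian_bracket_eq[of "g z r l" "g z' r' l'"]
  by (simp add: g_def poisson_mod_constants)

lemma mod_constants_of_int:
  "mod_constants (hcoeff (of_int c * F)) = fun_scale (of_int c) (mod_constants (hcoeff F) :: _ \<Rightarrow> _ \<Rightarrow> 'a)"
  by (auto simp: fun_eq_iff fun_scale_def mod_constants_def simp flip: hscalar_of_int)

end

section \<open>Criteria for graded bases\<close>

lemma (in vector_space) family_independent:
  assumes fin: "finite I"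
    and zero: "\<And>c i. (\<Sum>i\<in>I. scale (c i) (e i)) = 0 \<Longrightarrow> i \<in> I \<Longrightarrow> c i = 0"
  shows "inj_on e I" and "independent (e ` I)"
proof -
  show inj: "inj_on e I"
  proof (rule inj_onI, rule ccontr)
    fix i j assume ij: "i \<in> I" "j \<in> I" "e i = e j" "i \<noteq> j"
    \<comment> \<open>Two equal members with coefficients 1 and -1 would form a nontrivial
      relation.\<close>
    define c where "c k = (if k = i then 1 else if k = j then - 1 else (0::'a))" for k
    have "(\<Sum>k\<in>I. scale (c k) (e k)) = (\<Sum>k\<in>{i, j}. scale (c k) (e k))"
      using ij fin by (intro sum.mono_neutral_right) (auto simp: c_def)
    also have "\<dots> = 0" using ij by (simp add: c_def)
    finally have "c i = 0" using zero ij by blast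
    then show False by (simp add: c_def)
  qed
  show "independent (e ` I)"
  proof (rule independent_if_scalars_zero)
    fix f x assume "(\<Sum>x\<in>e ` I. scale (f x) x) = 0" "x \<in> e ` I"
    then show "f x = 0"
      using zero[of "f \<circ> e"] by (auto simp: sum.reindex[OF inj])
  qed (use fin in simp)
qed

context lie_algebra
begin

lemma degree_span_cong:
  assumes "[d = d'] (mod int N)"
  shows "degree_span scale N I e deg d = degree_span scale N I e deg d'"
proof -
  have "[deg b = d] (mod int N) \<longleftrightarrow> [deg b = d'] (mod int N)" for b
    using assms by (simp add: cong_def)
  then show ?thesis unfolding degree_span_def by simp
qed

lemma degree_span_bracket:
  assumes e_in: "\<And>b. b \<in> I \<Longrightarrow> e b \<in> V"
    and bracket_e: "\<And>b b'. b \<in> I \<Longrightarrow> b' \<in> I \<Longrightarrow>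
      bracket (e b) (e b') \<in> degree_span scale N I e deg (deg b + deg b')"
    and x: "x \<in> degree_span scale N I e deg c" and y: "y \<in> degree_span scale N I e deg d"
  shows "bracket x y \<in> degree_span scale N I e deg (c + d)"
proof -
  let ?S = "degree_span scale N I e deg"
  have sub: "subspace (?S d)" for d by (simp add: degree_span_def)
  have in_V: "?S d \<subseteq> V" for d
    unfolding degree_span_def using e_in by (intro span_minimal subspace_V) auto
  have cong: "?S (deg b + deg b') = ?S (c + d)"
    if "[deg b = c] (mod int N)" "[deg b' = d] (mod int N)" for b b'
    using that by (intro degree_span_cong cong_add)
  have add: "k \<in> ?S d \<Longrightarrow> l \<in> ?S d \<Longrightarrow> scale c k + l \<in> ?S d" for c d k l
    using subspace_add[OF sub] subspace_scale[OF sub] by blast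
  have 1: "y \<in> V \<and> bracket (e b) y \<in> ?S (c + d)" if b: "b \<in> I" "[deg b = c] (mod int N)" for b
    using y unfolding degree_span_def[of scale N I e deg d]
  proof (induction rule: span_induct_alt)
    case base
    show ?case using e_in[OF b(1)] subspace_0[OF sub] by simp
  next
    case (step k v u)
    then obtain b' where b': "v = e b'" "b' \<in> I" "[deg b' = d] (mod int N)" by blast
    have v: "v \<in> V" "bracket (e b) v \<in> ?S (c + d)"
      using b' e_in bracket_e[OF b(1) b'(2)] cong[OF b(2) b'(3)] by auto
    have u: "u \<in> V" "bracket (e b) u \<in> ?S (c + d)"
      using step.IH by auto
    have "bracket (e b) (scale k v + u) = scale k (bracket (e b) v) + bracket (e b) u"
      using e_in[OF b(1)] v u by (simp add: bracket_add_right bracket_scale_right subspace_scale[OF subspace_V])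
    then show ?case
      using add v u subspace_add[OF subspace_V] subspace_scale[OF subspace_V] by simp
  qed
  have "x \<in> V \<and> bracket x y \<in> ?S (c + d)"
    using x unfolding degree_span_def[of scale N I e deg c]
  proof (induction rule: span_induct_alt)
    case base
    have "y \<in> V" using y in_V by blast
    then show ?case using subspace_0[OF sub] by simp
  next
    case (step k v u)
    then obtain b where b: "v = e b" "b \<in> I" "[deg b = c] (mod int N)" by blast
    have v: "v \<in> V" "bracket v y \<in> ?S (c + d)" and yV: "y \<in> V"
      using b e_in 1[OF b(2,3)] by auto
    have u: "u \<in> V" "bracket u y \<in> ?S (c + d)"
      using step.IH by auto
    have "bracket (scale k v + u) y = scale k (bracket v y) + bracket u y"
      using v u yV by (simp add: bracket_add_left bracket_scale_left subspace_scale[OF subspace_V])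
    then show ?case
      using add v u subspace_add[OF subspace_V] subspace_scale[OF subspace_V] by simp
  qed
  then show ?thesis by blast
qed

text \<open>For directness, coordinates with respect to the whole basis are compared: a basis vector
  has a single degree modulo N, so its coordinate is nonzero in at most one of the summands.\<close>

lemma graded_basisI:
  assumes fin: "finite I" and inj: "inj_on e I" and indep: "independent (e ` I)"
    and span: "span (e ` I) = V" and N: "N > 0"
    and bracket_e: "\<And>b b'. b \<in> I \<Longrightarrow> b' \<in> I \<Longrightarrow>
      bracket (e b) (e b') \<in> degree_span scale N I e deg (deg b + deg b')"
  shows "graded_basis scale bracket V N I e deg"
proof -
  let ?S = "degree_span scale N I e deg"
  let ?E = "\<lambda>d. {e b | b. b \<in> I \<and> [deg b = d] (mod int N)}"
  have e_in: "e b \<in> V" if "b \<in> I" for b using span span_base that by blast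
  have S: "?S d = span (?E d)" for d by (simp add: degree_span_def)
  have E: "?E d \<subseteq> e ` I" for d by auto
  have "span (\<Union>d\<in>{0..<int N}. ?S d) = V"
  proof
    show "span (\<Union>d\<in>{0..<int N}. ?S d) \<subseteq> V"
      using span_mono[OF E] span by (intro span_minimal subspace_V) (auto simp: S)
    have "e b \<in> span (\<Union>d\<in>{0..<int N}. ?S d)" if "b \<in> I" for b
    proof (rule span_base)
      have "e b \<in> ?S (deg b mod int N)"
        unfolding S using that by (intro span_base) (auto simp: cong_def)
      then show "e b \<in> (\<Union>d\<in>{0..<int N}. ?S d)"
        using N by (intro UN_I[of "deg b mod int N"]) auto
    qed
    then have "span (e ` I) \<subseteq> span (\<Union>d\<in>{0..<int N}. ?S d)"
      by (intro span_minimal) auto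
    then show "V \<subseteq> span (\<Union>d\<in>{0..<int N}. ?S d)" using span by simp
  qed
  moreover have "f i = 0"
    if J: "finite J" "J \<subseteq> {0..<int N}" "\<forall>i\<in>J. f i \<in> ?S i" "(\<Sum>i\<in>J. f i) = 0" "i \<in> J" for J f i
  proof -
    let ?r = "representation (e ` I)"
    have f_in: "f j \<in> span (e ` I)" if "j \<in> J" for j
      using J(3) that span_mono[OF E] S by blast
    have supp: "v \<in> ?E j" if "j \<in> J" "?r (f j) v \<noteq> 0" for j v
    proof -
      have "?r (f j) = representation (?E j) (f j)"
        using J(3) that S by (intro representation_extend indep E) auto
      with that(2) have "representation (?E j) (f j) v \<noteq> 0" by simp
      then show ?thesis by (rule representation_ne_zero)
    qed
    have "?r (f i) v = 0" for v
    proof (rule ccontr)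
      assume nz: "?r (f i) v \<noteq> 0"
      obtain b where b: "v = e b" "b \<in> I" "[deg b = i] (mod int N)" using supp[OF J(5) nz] by blast
      have other: "?r (f j) v = 0" if "j \<in> J" "j \<noteq> i" for j
      proof (rule ccontr)
        assume "?r (f j) v \<noteq> 0"
        then have "v \<in> ?E j" by (rule supp[OF that(1)])
        then obtain b' where b': "v = e b'" "b' \<in> I" "[deg b' = j] (mod int N)" by blast
        then have "b' = b" using b inj by (auto dest: inj_onD)
        then have "[i = j] (mod int N)" using b b' by (metis cong_sym cong_trans)
        then have "i = j" using J that(1) by (auto simp: cong_def subset_iff)
        then show False using that by simp
      qed
      have "0 = ?r (\<Sum>j\<in>J. f j) v" using J by (simp add: representation_zero)
      also have "\<dots> = (\<Sum>j\<in>J. ?r (f j) v)"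
        using representation_sum[OF indep, of J f] f_in by simp
      also have "\<dots> = (\<Sum>j\<in>J. if j = i then ?r (f i) v else 0)"
        using other by (intro sum.cong) auto
      also have "\<dots> = ?r (f i) v" using J by simp
      finally show False using nz by simp
    qed
    moreover have "(\<Sum>v | ?r (f i) v \<noteq> 0. scale (?r (f i) v) v) = f i"
      by (rule sum_nonzero_representation_eq[OF indep f_in[OF J(5)]])
    ultimately show ?thesis by simp
  qed
  moreover have "bracket x y \<in> ?S ((i + j) mod int N)" if "x \<in> ?S i" "y \<in> ?S j" for x y i j
    using degree_span_bracket[OF e_in bracket_e that] degree_span_cong[of "i + j" "(i + j) mod int N" N I e deg]
    by (simp add: cong_def)
  ultimately show ?thesis
    unfolding graded_basis_def lie_grading_def internal_direct_sum_def
    using inj indep span lie_algebra_axioms by (auto simp: S)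
qed

end

section \<open>The grading of the Hamiltonian algebra\<close>

context hamiltonian_basis
begin

abbreviation I :: "(int \<times> int \<times> nat) set" where "I \<equiv> ham_index p s n"
abbreviation e :: "int \<times> int \<times> nat \<Rightarrow> nat \<Rightarrow> nat \<Rightarrow> 'a" where "e \<equiv> ham_element s n"
abbreviation deg :: "int \<times> int \<times> nat \<Rightarrow> int" where "deg \<equiv> ham_degree p s n m"
abbreviation DS :: "int \<Rightarrow> (nat \<Rightarrow> nat \<Rightarrow> 'a) set" where "DS \<equiv> degree_span fun_scale N I e deg"

lemma dp_power_eq:
  assumes "f \<in> dp_support"
  shows "dp_power (Suc s) n f a \<in> dp_support \<and> hseries (dp_power (Suc s) n f a) = hseries f ^ a"
proof (induction a)
  case 0
  have "hseries (dp_monom (Suc s) n (int 0) (int 0)) = (1 :: 'a hurwitz hurwitz)"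
    using P1_pos P2_pos by (simp only: hseries_dp_monom) simp
  then show ?case using dp_monom_support by (simp add: dp_power_def)
next
  case (Suc a)
  have "dp_power (Suc s) n f (Suc a) = dp_mult (Suc s) n f (dp_power (Suc s) n f a)"
    by (simp add: dp_power_def)
  then show ?case using Suc assms dp_mult_support by (simp add: hseries_dp_mult)
qed

lemma ham_element_eq:
  assumes "r < w" "l < q"
  shows "e (int l - 1, int r - 1, a) = g (int a) r l"
proof -
  let ?E = "dp_monom (Suc s) n 0 0 + dp_monom (Suc s) n (int CHAR('a) ^ s) 0 :: nat \<Rightarrow> nat \<Rightarrow> 'a"
  have w: "int CHAR('a) ^ s = int w" using CHAR_eq w_def by simp
  have w_less: "w < p * w" using p_ge_3 w_gt_1 by simp
  have sup: "?E \<in> dp_support" using dp_monom_support V.subspace_add[OF subspace_dp_support] by blast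
  have "hseries ?E = E"
    using hseries_dp_monom[of 0 0] hseries_dp_monom[of w 0] P1_pos P2_pos w_less unfolding w
    by (simp add: E_def)
  then have pow: "hseries (dp_power (Suc s) n ?E a) = E ^ a" "dp_power (Suc s) n ?E a \<in> dp_support"
    using dp_power_eq[OF sup, of a] by auto
  have mon: "hseries (dp_monom (Suc s) n (int r) (int l)) = (hx r * hy l :: 'a hurwitz hurwitz)"
    using hseries_dp_monom[of r l] assms w_less by simp
  have "hseries (dp_mult (Suc s) n (dp_power (Suc s) n ?E a) (dp_monom (Suc s) n (int r) (int l))) = G (int a) r l"
    using pow mon dp_monom_support by (simp add: hseries_dp_mult G_def Epow_int)
  then have "dp_mult (Suc s) n (dp_power (Suc s) n ?E a) (dp_monom (Suc s) n (int r) (int l)) = hcoeff (G (int a) r l)"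
    by (metis hcoeff_hseries)
  then show ?thesis by (simp add: ham_element_def g_def)
qed

lemma int_powers: "int p ^ s = int w" "int p ^ n = int q"
  by (simp_all add: w_def q_def)

text \<open>The shift by one turns the indices into exponents. The excluded triples are those of the
  constant and of the element that contains the top monomial.\<close>

lemma index_cases:
  assumes "b \<in> I"
  obtains a r l where "b = (int l - 1, int r - 1, a)" "a < p" "r < w" "l < q"
    "(a, r, l) \<noteq> (0, 0, 0)" "(a, r, l) \<noteq> (p - 1, w - 1, q - 1)"
proof -
  obtain j k a where b: "b = (j, k, a)" by (cases b)
  have 1: "a < p" "-1 \<le> k" "k < int w - 1" "-1 \<le> j" "j < int q - 1"
    "(j, k, a) \<noteq> (-1, -1, 0)" "(j, k, a) \<noteq> (int q - 2, int w - 2, p - 1)"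
    using assms b by (auto simp: ham_index_def int_powers)
  then have "b = (int (nat (j + 1)) - 1, int (nat (k + 1)) - 1, a)"
    "nat (k + 1) < w" "nat (j + 1) < q" "(a, nat (k + 1), nat (j + 1)) \<noteq> (0, 0, 0)"
    "(a, nat (k + 1), nat (j + 1)) \<noteq> (p - 1, w - 1, q - 1)"
    using b by auto
  then show thesis using that 1(1) by blast
qed

lemma index_in:
  assumes "a < p" "r < w" "l < q" "(a, r, l) \<noteq> (0, 0, 0)" "(a, r, l) \<noteq> (p - 1, w - 1, q - 1)"
  shows "(int l - 1, int r - 1, a) \<in> I"
  using assms unfolding ham_index_def int_powers by (auto simp: of_nat_diff)

lemma finite_I: "finite I"
proof (rule finite_subset)
  show "I \<subseteq> {-1..<int q - 1} \<times> {-1..<int w - 1} \<times> {..<p}"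
    unfolding ham_index_def int_powers by auto
qed simp

text \<open>The degree formula in terms of exponents, for any integer exponent z of E. As z matters
  modulo p only, so does the value modulo N only.\<close>

definition gdeg :: "int \<Rightarrow> nat \<Rightarrow> nat \<Rightarrow> int" where
  "gdeg z r l = (1 - int q) * ((z + (int l - 1) * m) * int w + (int r - 1)) - (int l - 1)"

lemma deg_eq: "deg (int l - 1, int r - 1, a) = gdeg (int a) r l"
  by (simp add: ham_degree_def gdeg_def int_powers)

lemma gdeg_cong:
  assumes "[z = z'] (mod int p)" shows "[gdeg z r l = gdeg z' r l] (mod int N)"
proof -
  obtain k where k: "z - z' = int p * k" using assms by (metis cong_iff_dvd_diff dvdE)
  have "gdeg z r l - gdeg z' r l = (1 - int q) * ((z - z') * int w)"
    by (simp add: gdeg_def algebra_simps)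
  also have "\<dots> = int N * (- k)"
    using q_ge_3 unfolding k N_def by (simp add: of_nat_diff algebra_simps)
  finally show ?thesis unfolding cong_iff_dvd_diff by (metis dvd_triv_left)
qed

lemma mod_p_less: "nat (z mod int p) < p"
  using p_ge_3 by (simp add: nat_less_iff)

lemma int_mod_p: "int (nat (z mod int p)) = z mod int p"
  using p_ge_3 by simp

text \<open>Two residue triples carry no basis element. For the constant, g is 0; for the element
  with the top monomial, membership of the multiple in H forces c = 0. This is how a bracket in H is
  placed without computing its coefficient.\<close>

lemma scale_g_in_DS:
  assumes r: "r < w" and l: "l < q" and H: "fun_scale c (g z r l) \<in> H"
  shows "fun_scale c (g z r l) \<in> DS (gdeg z r l)"
proof -
  let ?a = "nat (z mod int p)"
  have zero: "0 \<in> DS d" for d unfolding degree_span_def by (rule V.span_zero)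
  have a0: "?a = 0 \<longleftrightarrow> int p dvd z"
    using int_mod_p[of z] by (metis dvd_eq_mod_eq_0 nat_0 of_nat_0)
  have a1: "?a = p - 1 \<longleftrightarrow> [z = -1] (mod int p)"
    using p_ge_3 int_mod_p[of z] by (auto simp: cong_def zmod_minus1)
  consider "(?a, r, l) = (0, 0, 0)" | "(?a, r, l) = (p - 1, w - 1, q - 1)"
    | "(?a, r, l) \<noteq> (0, 0, 0)" "(?a, r, l) \<noteq> (p - 1, w - 1, q - 1)" by blast
  then show ?thesis
  proof cases
    case 1
    then have "g z r l = 0" using g_eq_0_iff[OF r] a0 by simp
    then show ?thesis using zero by simp
  next
    case 2
    then have "g z r l (p * w - 1) (q - 1) \<noteq> 0" using g_top[OF r, of z l] a1 by simp
    moreover have "fun_scale c (g z r l) (p * w - 1) (q - 1) = 0"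
      using H unfolding hamiltonian_algebra_eq by blast
    ultimately have "c = 0" by (simp add: fun_scale_def)
    then show ?thesis using zero by simp
  next
    case 3
    let ?b = "(int l - 1, int r - 1, ?a)"
    have cong: "[int ?a = z] (mod int p)" using int_mod_p by (simp add: cong_def)
    have "?b \<in> I" using 3 by (intro index_in mod_p_less r l)
    moreover have "e ?b = g z r l" using ham_element_eq[OF r l] g_cong[OF cong] by simp
    moreover have "[deg ?b = gdeg z r l] (mod int N)"
      unfolding deg_eq by (rule gdeg_cong[OF cong])
    ultimately show ?thesis
      unfolding degree_span_def by (intro V.span_scale V.span_base) (metis (mono_tags, lifting) mem_Collect_eq)
  qed
qed

lemma dy_dx_positive:
  assumes "r < w" "r' < w" "r + r' \<ge> 1"
  shows "\<exists>c::int. dy (G z r l) * dx (G z' r' l') = of_int c * G (z + z') (r + r' - 1) (l + l' - 1)"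
proof (cases "l = 0 \<or> r' = 0")
  case True
  have "dy (G z r l) * dx (G z' r' l') = 0"
  proof (cases "l = 0")
    case False
    then have "r' = 0" using True by simp
    \<comment> \<open>With r' = 0 the derivative yields x^(w - 1), and r is positive, so the product
      overflows.\<close>
    then have "G z r (l - 1) * G (z' - 1) (w - 1) l' = 0"
      using assms w_gt_1 by (intro G_overflow_x) auto
    then show ?thesis
      using False \<open>r' = 0\<close> assms by (simp add: dy_G dx_G mult.left_commute)
  qed (simp add: dy_G)
  then show ?thesis by (intro exI[of _ 0]) simp
next
  case False
  then have "dy (G z r l) * dx (G z' r' l') = G z r (l - 1) * G z' (r' - 1) l'"
    using assms by (simp add: dy_G dx_G)
  also have "\<dots> = of_int (int ((r + (r' - 1) choose r) * (l - 1 + l' choose (l - 1)))) *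
      G (z + z') (r + r' - 1) (l + l' - 1)"
    using False by (simp add: G_times)
  finally show ?thesis by blast
qed

lemma dy_dx_zero:
  "\<exists>c::int. dy (G z 0 l) * dx (G z' 0 l') = of_int c * G (z + z' - 1) (w - 1) (l + l' - 1)"
proof (cases "l = 0")
  case False
  then have "dy (G z 0 l) * dx (G z' 0 l') = of_int z' * (G z 0 (l - 1) * G (z' - 1) (w - 1) l')"
    using w_gt_1 by (simp add: dy_G dx_G mult.left_commute)
  also have "\<dots> = of_int (z' * int (l - 1 + l' choose (l - 1))) * G (z + z' - 1) (w - 1) (l + l' - 1)"
    using False by (simp add: G_times algebra_simps)
  finally show ?thesis by blast
qed (auto simp: dy_G intro: exI[of _ 0])

lemma dy_dx_overflow_x:
  assumes "r < w" "r' < w" "r + r' - 1 \<ge> w"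
  shows "dy (G z r l) * dx (G z' r' l') = 0"
proof -
  have "G z r (l - 1) * G z' (r' - 1) l' = 0" using assms by (intro G_overflow_x) auto
  moreover have "r' > 0" using assms by linarith
  ultimately show ?thesis using assms by (simp add: dy_G dx_G)
qed

lemma dy_dx_overflow_y:
  assumes "r' < w" "l < q" "l' < q" "l + l' - 1 \<ge> q"
  shows "dy (G z r l) * dx (G z' r' l') = 0"
proof -
  have "G z r (l - 1) * G x y l' = 0" for x y using assms by (intro G_overflow_y) auto
  then show ?thesis using assms by (simp add: dy_G dx_G mult.left_commute)
qed

text \<open>A bracket adds the numbers z w + r and lowers the sum by one; r'' is the remainder, with
  a borrow from the exponent of E when r + r' = 0. The degree formula depends on z and r only
  through z w + r, hence it is additive.\<close>

lemma poisson_G: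
  assumes "r < w" "l < q" "r' < w" "l' < q"
  shows "poisson (G z r l) (G z' r' l') = 0 \<or>
    (\<exists>c z'' r''. r'' < w \<and> l + l' \<ge> 1 \<and> l + l' - 1 < q \<and>
      z'' * int w + int r'' = (z + z') * int w + int r + int r' - 1 \<and>
      poisson (G z r l) (G z' r' l') = of_int c * G z'' r'' (l + l' - 1))"
proof -
  have P: "poisson (G z r l) (G z' r' l') =
      dy (G z r l) * dx (G z' r' l') - dy (G z' r' l') * dx (G z r l)"
    by (simp add: poisson_def mult.commute)
  consider "l + l' = 0" | "l + l' - 1 \<ge> q" | "r + r' - 1 \<ge> w"
    | "l + l' \<ge> 1" "l + l' - 1 < q" "r + r' = 0"
    | "l + l' \<ge> 1" "l + l' - 1 < q" "r + r' \<ge> 1" "r + r' - 1 < w" by linarith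
  then show ?thesis
  proof cases
    case 1
    then show ?thesis unfolding P by (simp add: dy_G)
  next
    case 2
    then show ?thesis
      using assms dy_dx_overflow_y[of r' l l' z r z'] dy_dx_overflow_y[of r l' l z' r' z] by (simp add: P add.commute)
  next
    case 3
    then show ?thesis
      using assms dy_dx_overflow_x[of r r' z l z' l'] dy_dx_overflow_x[of r' r z' l' z l] by (simp add: P add.commute)
  next
    case 4
    then have r: "r = 0" "r' = 0" by auto
    obtain c d :: int where c: "dy (G z 0 l) * dx (G z' 0 l') = of_int c * G (z + z' - 1) (w - 1) (l + l' - 1)"
      and d: "dy (G z' 0 l') * dx (G z 0 l) = of_int d * G (z' + z - 1) (w - 1) (l' + l - 1)"
      using dy_dx_zero by meson
    then have "poisson (G z r l) (G z' r' l') = of_int (c - d) * G (z + z' - 1) (w - 1) (l + l' - 1)"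
      unfolding P unfolding r c d by (simp add: algebra_simps)
    moreover have "(z + z' - 1) * int w + int (w - 1) = (z + z') * int w + int r + int r' - 1"
      using r w_gt_1 by (simp add: of_nat_diff algebra_simps)
    ultimately show ?thesis using 4 w_gt_1 by (intro disjI2 exI[of _ "c - d"] exI[of _ "z + z' - 1"] exI[of _ "w - 1"]) auto
  next
    case 5
    obtain c :: int where c: "dy (G z r l) * dx (G z' r' l') = of_int c * G (z + z') (r + r' - 1) (l + l' - 1)"
      using dy_dx_positive[of r r' z l z' l'] assms 5 by auto
    obtain d :: int where d: "dy (G z' r' l') * dx (G z r l) = of_int d * G (z' + z) (r' + r - 1) (l' + l - 1)"
      using dy_dx_positive[of r' r z' l' z l] assms 5 by auto
    have "poisson (G z r l) (G z' r' l') = of_int (c - d) * G (z + z') (r + r' - 1) (l + l' - 1)"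
      unfolding P c d by (simp add: algebra_simps)
    moreover have "(z + z') * int w + int (r + r' - 1) = (z + z') * int w + int r + int r' - 1"
      using 5 by (simp add: of_nat_diff)
    ultimately show ?thesis using 5 by (intro disjI2 exI[of _ "c - d"] exI[of _ "z + z'"] exI[of _ "r + r' - 1"]) auto
  qed
qed

lemma e_in_H: "b \<in> I \<Longrightarrow> e b \<in> H"
proof (erule index_cases)
  fix a r l
  assume b: "b = (int l - 1, int r - 1, a)" "a < p" "r < w" "l < q" "(a, r, l) \<noteq> (p - 1, w - 1, q - 1)"
  have "[int a = -1] (mod int p) \<longleftrightarrow> a = p - 1"
    using b(2) p_ge_3 by (auto simp: cong_def zmod_minus1)
  then show "e b \<in> H"
    using b by (auto simp: ham_element_eq intro!: g_in_H)
qed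

lemma br_e_in_DS:
  assumes "b \<in> I" "b' \<in> I"
  shows "br (e b) (e b') \<in> DS (deg b + deg b')"
proof -
  obtain a r l where b: "b = (int l - 1, int r - 1, a)" "a < p" "r < w" "l < q"
    using assms(1) by (rule index_cases)
  obtain a' r' l' where b': "b' = (int l' - 1, int r' - 1, a')" "a' < p" "r' < w" "l' < q"
    using assms(2) by (rule index_cases)
  have br: "br (e b) (e b') = mod_constants (hcoeff (poisson (G (int a) r l) (G (int a') r' l')))"
    using b b' by (simp add: ham_element_eq br_g)
  show ?thesis
    using poisson_G[OF b(3,4) b'(3,4), of "int a" "int a'"]
  proof (elim disjE exE conjE)
    assume "poisson (G (int a) r l) (G (int a') r' l') = 0"
    then have "br (e b) (e b') = 0" unfolding br by (simp add: mod_constants_def fun_eq_iff)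
    then show ?thesis unfolding degree_span_def by (simp add: V.span_zero)
  next
    fix c z'' r''
    assume *: "r'' < w" "l + l' \<ge> 1" "l + l' - 1 < q"
      "z'' * int w + int r'' = (int a + int a') * int w + int r + int r' - 1"
      "poisson (G (int a) r l) (G (int a') r' l') = of_int c * G z'' r'' (l + l' - 1)"
    have eq: "br (e b) (e b') = fun_scale (of_int c) (g z'' r'' (l + l' - 1))"
      unfolding br * mod_constants_of_int g_def ..
    have "br (e b) (e b') \<in> H"
      using e_in_H assms by (intro bracket_in) (auto simp: hamiltonian_algebra_eq)
    then have "br (e b) (e b') \<in> DS (gdeg z'' r'' (l + l' - 1))"
      unfolding eq using *(1,3) by (intro scale_g_in_DS)
    moreover have "gdeg z'' r'' (l + l' - 1) = deg b + deg b'"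
    proof -
      have "gdeg z'' r'' (l + l' - 1) =
        (1 - int q) * ((z'' * int w + int r'') + (int l + int l' - 2) * m * int w - 1) - (int l + int l' - 2)"
        using *(2) by (simp add: gdeg_def of_nat_diff algebra_simps)
      also have "\<dots> = gdeg (int a) r l + gdeg (int a') r' l'"
        unfolding *(4) by (simp add: gdeg_def algebra_simps)
      finally show ?thesis using b b' by (simp add: deg_eq)
    qed
    ultimately show ?thesis by simp
  qed
qed

text \<open>Triangularity in a, by downward induction: at the leading monomial of a basis element,
  those with the same r and l and smaller a vanish, those with larger a already have coefficient 0,
  and all others have disjoint support.\<close>

lemma e_independent:
  assumes zero: "(\<Sum>b\<in>I. fun_scale (c b) (e b)) = 0" and "b \<in> I"
  shows "c b = 0"
proof -
  obtain a r l where b: "b = (int l - 1, int r - 1, a)" "a < p" "r < w" "l < q"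
    "(a, r, l) \<noteq> (0, 0, 0)" "(a, r, l) \<noteq> (p - 1, w - 1, q - 1)"
    using assms(2) by (rule index_cases)
  have "c (int l - 1, int r - 1, a) = 0"
    using b(2,5,6)
  proof (induction "p - a" arbitrary: a rule: less_induct)
    case less
    let ?b = "(int l - 1, int r - 1, a)"
    have b_in: "?b \<in> I" using less b by (intro index_in) auto
    have app: "(\<Sum>b\<in>J. f b) x y = (\<Sum>b\<in>J. f b x y)" for J x y and f :: "_ \<Rightarrow> nat \<Rightarrow> nat \<Rightarrow> 'a"
      by (induction J rule: infinite_finite_induct) auto
    have other: "c b' * e b' (a * w + r) l = 0" if b'_in: "b' \<in> I" and ne: "b' \<noteq> ?b" for b'
    proof -
      obtain a' r' l' where b': "b' = (int l' - 1, int r' - 1, a')" "a' < p" "r' < w" "l' < q"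
        "(a', r', l') \<noteq> (0, 0, 0)" "(a', r', l') \<noteq> (p - 1, w - 1, q - 1)"
        using b'_in by (rule index_cases)
      have val: "e b' (a * w + r) l = (if r = r' \<and> l = l' \<and> (a * w + r, l) \<noteq> (0, 0)
          then of_nat ((a' choose a) * fact a) else 0)"
      proof -
        have md: "(a * w + r) mod w = r" "(a * w + r) div w = a" "nat (int a' mod int p) = a'"
          using b(3) b'(2) by simp_all
        show ?thesis
          unfolding b'(1) ham_element_eq[OF b'(3,4)] g_apply[OF b'(3)] md ..
      qed
      show ?thesis
      proof (cases "r = r' \<and> l = l'")
        case True
        then have "a' \<noteq> a" using ne b' by auto
        then consider "a' < a" | "a < a'" by linarith
        then show ?thesis
        proof cases
          case 1
          then show ?thesis by (simp add: val binomial_eq_0)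
        next
          case 2
          then have "c b' = 0" using less.hyps[of a'] b' True by simp
          then show ?thesis by simp
        qed
      qed (auto simp: val)
    qed
    have "0 = (\<Sum>b'\<in>I. c b' * e b' (a * w + r) l)"
      using fun_cong[OF fun_cong[OF zero, of "a * w + r"], of l] by (simp add: app fun_scale_def)
    also have "\<dots> = (\<Sum>b'\<in>I. if b' = ?b then c ?b * e ?b (a * w + r) l else 0)"
      using other by (intro sum.cong) auto
    also have "\<dots> = c ?b * e ?b (a * w + r) l"
      using b_in finite_I by simp
    finally have "c ?b * e ?b (a * w + r) l = 0" by simp
    moreover have "\<not> (r = 0 \<and> l = 0 \<and> int p dvd int a)"
      using less by (auto dest: dvd_imp_le)
    then have "e ?b (a * w + r) l \<noteq> 0"
      using g_leading[of r l "int a"] b less by (simp add: ham_element_eq flip: zmod_int)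
    ultimately show "c ?b = 0" by simp
  qed
  then show ?thesis using b by simp
qed

lemma mod_constants_sum: "mod_constants (\<Sum>i\<in>J. f i) = (\<Sum>i\<in>J. mod_constants (f i :: nat \<Rightarrow> nat \<Rightarrow> 'a))"
  by (induction J rule: infinite_finite_induct)
    (simp_all only: sum.infinite sum.empty sum.insert mod_constants_linear not_False_eq_True)

lemma g_expansion:
  assumes "a < p" "r < w" "l < q"
  shows "g (int a) r l = (\<Sum>i\<le>a. fun_scale (of_nat ((a choose i) * fact i))
    (mod_constants (dp_monom (Suc s) n (int (i * w + r)) (int l))))"
proof -
  have less: "i * w + r < p * w" if "i \<le> a" for i
  proof -
    have "i * w + r < (i + 1) * w" using assms by simp
    also have "\<dots> \<le> p * w" using that assms by (intro mult_right_mono) auto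
    finally show ?thesis .
  qed
  have "G (int a) r l = hseries (\<Sum>i\<le>a. fun_scale (of_nat ((a choose i) * fact i))
      (dp_monom (Suc s) n (int (i * w + r)) (int l)))"
    unfolding hseries_sum G_def Epow_int E_power_hx_hy[OF assms(2)]
    using less assms(3) by (intro sum.cong refl) (simp only: hseries_linear hseries_dp_monom, simp)
  then show ?thesis
    by (simp only: g_def hcoeff_hseries mod_constants_sum mod_constants_linear)
qed

text \<open>The element with indices a, r, l is a! times the monomial plus monomials with smaller a,
  and a! is invertible, so upward induction on a applies.\<close>

lemma monomial_in_span:
  assumes "a < p" "r < w" "l < q" "(a, r, l) \<noteq> (p - 1, w - 1, q - 1)"
  shows "mod_constants (dp_monom (Suc s) n (int (a * w + r)) (int l)) \<in> V.span (e ` I)"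
  using assms(1,4)
proof (induction a rule: less_induct)
  case (less a)
  let ?M = "\<lambda>i. mod_constants (dp_monom (Suc s) n (int (i * w + r)) (int l)) :: nat \<Rightarrow> nat \<Rightarrow> 'a"
  let ?c = "\<lambda>i. of_nat ((a choose i) * fact i) :: 'a"
  have "g (int a) r l \<in> V.span (e ` I)"
  \<comment> \<open>The triple of zeros is not an index, but its element is 0 modulo
    constants.\<close>
  proof (cases "(a, r, l) = (0, 0, 0)")
    case True
    then have "g (int a) r l = 0" using g_eq_0_iff[of r] assms by simp
    then show ?thesis using V.span_zero by simp
  next
    case False
    then show ?thesis
      using less assms ham_element_eq[of r l a]
      by (intro V.span_base) (metis image_eqI index_in)
  qed
  moreover have "(\<Sum>i<a. fun_scale (?c i) (?M i)) \<in> V.span (e ` I)"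
    using less assms by (intro V.span_sum V.span_scale less.IH) auto
  moreover have "g (int a) r l = (\<Sum>i<a. fun_scale (?c i) (?M i)) + fun_scale (?c a) (?M a)"
    using g_expansion[of a r l] less assms by (simp only: lessThan_Suc_atMost[symmetric] sum.lessThan_Suc)
  then have "fun_scale (?c a) (?M a) = g (int a) r l - (\<Sum>i<a. fun_scale (?c i) (?M i))"
    by (simp only: add_diff_cancel_left')
  ultimately have "fun_scale (?c a) (?M a) \<in> V.span (e ` I)" by (simp only: V.span_diff)
  then have "fun_scale (inverse (?c a)) (fun_scale (?c a) (?M a)) \<in> V.span (e ` I)" by (rule V.span_scale)
  moreover have "?c a \<noteq> 0" using fact_nonzero less by simp
  ultimately show ?case by simp
qed

lemma span_e: "V.span (e ` I) = H"
proof
  show "V.span (e ` I) \<subseteq> H"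
    using e_in_H by (intro V.span_minimal) (auto simp: hamiltonian_algebra_def)
  show "H \<subseteq> V.span (e ` I)"
    unfolding hamiltonian_algebra_def P1_def[symmetric] P2_def[symmetric]
  proof (intro V.span_minimal V.subspace_span subsetI)
    fix f :: "nat \<Rightarrow> nat \<Rightarrow> 'a"
    assume "f \<in> {dp_monom (Suc s) n (int i) (int j) | i j. i < p * w \<and> j < q \<and>
        (i, j) \<noteq> (0, 0) \<and> (i, j) \<noteq> (p * w - 1, q - 1)}"
    then obtain i j where f: "f = dp_monom (Suc s) n (int i) (int j)" "i < p * w" "j < q"
        "(i, j) \<noteq> (0, 0)" "(i, j) \<noteq> (p * w - 1, q - 1)" by blast
    have i: "i = i div w * w + i mod w" by simp
    have "i div w < p" "i mod w < w" using f(2) w_gt_1 by (simp_all add: less_mult_imp_div_less)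
    moreover have "(i div w, i mod w, j) \<noteq> (p - 1, w - 1, q - 1)"
    proof
      assume *: "(i div w, i mod w, j) = (p - 1, w - 1, q - 1)"
      then have "i = (p - 1) * w + (w - 1)" using i by simp
      also have "\<dots> = p * w - 1" using p_ge_3 w_gt_1 by (cases p) auto
      finally show False using * f(5) by simp
    qed
    ultimately have "mod_constants (dp_monom (Suc s) n (int i) (int j)) \<in> V.span (e ` I)"
      using monomial_in_span[of "i div w" "i mod w" j] f(3) by simp
    moreover have "mod_constants f = f"
      using f(1,4) by (auto simp: mod_constants_def dp_monom_def fun_eq_iff)
    ultimately show "f \<in> V.span (e ` I)" using f(1) by simp
  qed
qed

lemma ham_graded_basis: "graded_basis fun_scale br H N I e deg"
proof -
  interpret L: lie_algebra fun_scale br H by (rule hamiltonian_lie_algebra)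
  have "N > 0" using N_def q_ge_3 p_ge_3 w_gt_1 by simp
  moreover have "inj_on e I" "V.independent (e ` I)"
    by (rule V.family_independent[OF finite_I], erule (1) e_independent)+
  ultimately show ?thesis
    by (intro L.graded_basisI finite_I span_e br_e_in_DS)
qed

end

section \<open>The chain of diamonds\<close>

context hamiltonian_basis
begin

text \<open>Together with \<open>kap\<close>, the expansion -t = del t w + kap t. It describes t
  successive decrements of the x-exponent, starting at 0, in which passing from 0 to w - 1 borrows
  one from the exponent of E.\<close>

definition del :: "int \<Rightarrow> int" where "del t = (- t) div int w"
definition kap :: "int \<Rightarrow> nat" where "kap t = nat ((- t) mod int w)"

lemma kap_less: "kap t < w"
  using w_gt_1 by (simp add: kap_def nat_less_iff)

lemma del_kap: "del t * int w + int (kap t) = - t"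
  using w_gt_1 by (simp add: del_def kap_def)

lemma del_kap_unique:
  assumes "d * int w + int r = - t" "r < w"
  shows "del t = d" "kap t = r"
proof -
  have "- t = int w * d + int r" using assms by (simp add: mult.commute)
  then show "del t = d" "kap t = r"
    using int_div_pos_eq[of "- t" "int w" d "int r"] int_mod_pos_eq[of "- t" "int w" d "int r"] assms(2)
    by (simp_all add: del_def kap_def)
qed

lemma del_kap_zero:
  assumes "kap (t - 1) = 0" shows "del t = del (t - 1) - 1" "kap t = w - 1"
proof -
  have "(del (t - 1) - 1) * int w + int (w - 1) = - t"
    using del_kap[of "t - 1"] assms w_gt_1 by (simp add: of_nat_diff algebra_simps)
  then show "del t = del (t - 1) - 1" "kap t = w - 1"
    using del_kap_unique[of "del (t - 1) - 1" "w - 1" t] w_gt_1 by auto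
qed

lemma del_kap_pos:
  assumes "kap (t - 1) > 0" shows "del t = del (t - 1)" "kap t = kap (t - 1) - 1"
proof -
  have "del (t - 1) * int w + int (kap (t - 1) - 1) = - t"
    using del_kap[of "t - 1"] assms by (simp add: of_nat_diff algebra_simps)
  moreover have "kap (t - 1) - 1 < w" using kap_less[of "t - 1"] by simp
  ultimately show "del t = del (t - 1)" "kap t = kap (t - 1) - 1"
    using del_kap_unique[of "del (t - 1)" "kap (t - 1) - 1" t] by auto
qed

text \<open>The x-exponent \<open>kap (t - 1)\<close> is 0 exactly if w divides t - 1, and then
  \<open>del (t - 1)\<close> is -(t div w).\<close>

lemma chain_coeff_eq:
  "chain_coeff w (of_int c) t =
    (if kap (int t - 1) = 0 then of_int (del (int t - 1) + c) else (1::'a))"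
proof (cases "t mod w = 1")
  case True
  then have t: "t = t div w * w + 1" by (metis div_mult_mod_eq)
  have "- int (t div w) * int w + int 0 = - (int t - 1)"
    using arg_cong[OF t, of int] by simp
  then have "del (int t - 1) = - int (t div w)" "kap (int t - 1) = 0"
    using del_kap_unique[of "- int (t div w)" 0 "int t - 1"] w_gt_1 by auto
  then show ?thesis using True by (simp add: chain_coeff_def)
next
  case False
  have "kap (int t - 1) \<noteq> 0"
  proof
    assume "kap (int t - 1) = 0"
    then have "int t = - del (int t - 1) * int w + 1" using del_kap[of "int t - 1"] by simp
    then have "int t mod int w = 1" using w_gt_1 by (metis mod_mult_self3 mod_pos_pos_trivial of_nat_1 of_nat_less_iff zero_le_one)
    then have "t mod w = 1" by (metis of_nat_1 of_nat_eq_iff zmod_int)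
    then show False using False by simp
  qed
  then show ?thesis using False by (simp add: chain_coeff_def)
qed

text \<open>The shift to t - 1 is due to the origin of this vector: it arises from the preceding
  line by a bracket with X, which leaves the x-exponent alone, whereas its partner arises by a
  bracket with Y, which lowers it.\<close>

definition chain_A :: "nat \<Rightarrow> nat \<Rightarrow> nat \<Rightarrow> 'a" where
  "chain_A t = g (del (int t - 1) + m) (kap (int t - 1)) 0"

text \<open>Where the coefficient vanishes, the second formula would give an element with a top
  monomial, which lies outside the Hamiltonian algebra.\<close>

definition chain_B :: "nat \<Rightarrow> nat \<Rightarrow> nat \<Rightarrow> 'a" where
  "chain_B t = (if chain_coeff w (2 * \<pi>) t = 0 then 0
     else g (del (int t) + 2 * m) (kap (int t)) (q - 1))"

text \<open>The result of u brackets with X applied to E^(del t + 2 m) x^(kap t) y^(q - 1): each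
  adds m to the exponent of E and lowers that of y by one.\<close>

definition chain_C :: "nat \<Rightarrow> nat \<Rightarrow> nat \<Rightarrow> nat \<Rightarrow> 'a" where
  "chain_C t u = g (del (int t) + (int u + 2) * m) (kap (int t)) (q - 1 - u)"

lemma coeff_a: "chain_coeff w \<pi> t =
    (if kap (int t - 1) = 0 then of_int (del (int t - 1) + m) else (1::'a))"
  using chain_coeff_eq[of m t] m_def by simp

lemma coeff_b: "chain_coeff w (2 * \<pi>) t =
    (if kap (int t - 1) = 0 then of_int (del (int t - 1) + 2 * m) else (1::'a))"
  using chain_coeff_eq[of "2 * m" t] m_def by simp

text \<open>The right-hand side is the condition of \<open>g_top\<close> for the candidate of
  \<open>chain_B\<close>: the coefficient vanishes exactly where that candidate contains the top
  monomial.\<close>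

lemma coeff_b_eq_0_iff:
  "chain_coeff w (2 * \<pi>) t = (0::'a) \<longleftrightarrow>
   kap (int t) = w - 1 \<and> [del (int t) + 2 * m = - 1] (mod int p)"
proof (cases "kap (int t - 1) = 0")
  case True
  have "[del (int t) + 2 * m = - 1] (mod int p) \<longleftrightarrow> int p dvd del (int t - 1) + 2 * m"
    unfolding del_kap_zero(1)[OF True] cong_iff_dvd_diff by (simp add: algebra_simps)
  moreover have "chain_coeff w (2 * \<pi>) t = (0::'a) \<longleftrightarrow> int p dvd del (int t - 1) + 2 * m"
    unfolding coeff_b if_P[OF True] by (rule of_int_eq_0_iff)
  ultimately show ?thesis using del_kap_zero(2)[OF True] by simp
next
  case False
  then have "kap (int t) = kap (int t - 1) - 1" by (intro del_kap_pos) simp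
  then have "kap (int t) \<noteq> w - 1" using kap_less[of "int t - 1"] False by simp
  then show ?thesis using False by (simp add: coeff_b)
qed

lemma chain_A_0: "chain_A 0 = g m 1 0"
proof -
  have "del (- 1) = 0" "kap (- 1) = 1" using del_kap_unique[of 0 1 "- 1"] w_gt_1 by auto
  then show ?thesis by (simp add: chain_A_def)
qed

lemma chain_B_0: "chain_B 0 = g (2 * m) 0 (q - 1)"
proof -
  have "del 0 = 0" "kap 0 = 0" using del_kap_unique[of 0 0 0] w_gt_1 by auto
  moreover have "chain_coeff w (2 * \<pi>) 0 = (1::'a)" by (simp add: chain_coeff_def)
  ultimately show ?thesis by (simp add: chain_B_def)
qed

section \<open>Brackets with the generators X and Y\<close>

lemma br_X:
  assumes "r < w" "l < q"
  shows "br (g z r l) (chain_A 0) = (if l = 0 then 0 else g (z + m) r (l - 1))"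
proof -
  have P: "poisson (G z r l) (G m 1 0) = (if l = 0 then 0 else G (z + m) r (l - 1))"
    using w_gt_1 by (simp add: poisson_def dy_G dx_G G_times)
  have "0 < q" "1 < w" using w_gt_1 q_ge_3 by auto
  then have "br (g z r l) (chain_A 0) = mod_constants (hcoeff (if l = 0 then 0 else G (z + m) r (l - 1)))"
    unfolding chain_A_0 P[symmetric] using assms by (intro br_g)
  then show ?thesis by (simp add: g_def) (simp add: mod_constants_def fun_eq_iff)
qed

lemma poisson_Y:
  "poisson (G z r l) (G (2 * m) 0 (q - 1)) =
    of_int (2 * m) * (dy (G z r l) * G (2 * m - 1) (w - 1) (q - 1)) - dx (G z r l) * G (2 * m) 0 (q - 2)"
  using w_gt_1 q_ge_3 by (simp add: poisson_def dy_G dx_G mult.left_commute numeral_2_eq_2)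

lemma br_Y:
  assumes "r < w" "l < q" "poisson (G z r l) (G (2 * m) 0 (q - 1)) = of_int c * G z' r' l'"
  shows "br (g z r l) (chain_B 0) = fun_scale (of_int c) (g z' r' l')"
proof -
  have "0 < w" "q - 1 < q" using w_gt_1 q_ge_3 by auto
  then show ?thesis
    unfolding chain_B_0 br_g[OF assms(1,2) \<open>0 < w\<close> \<open>q - 1 < q\<close>] assms(3) mod_constants_of_int
    unfolding g_def by simp
qed

lemma br_Y_0:
  assumes "r < w"
  shows "br (g z r 0) (chain_B 0) =
    (if r = 0 then fun_scale (of_int (- z)) (g (z + 2 * m - 1) (w - 1) (q - 2))
     else fun_scale (of_int (- 1)) (g (z + 2 * m) (r - 1) (q - 2)))"
proof (cases "r = 0")
  case True
  have P: "poisson (G z 0 0) (G (2 * m) 0 (q - 1)) = of_int (- z) * G (z + 2 * m - 1) (w - 1) (q - 2)"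
    unfolding poisson_Y using w_gt_1 by (simp add: dy_G dx_G G_times algebra_simps)
  show ?thesis using True br_Y[OF _ _ P] w_gt_1 q_ge_3 by simp
next
  case False
  have P: "poisson (G z r 0) (G (2 * m) 0 (q - 1)) = of_int (- 1) * G (z + 2 * m) (r - 1) (q - 2)"
    unfolding poisson_Y using False assms by (simp add: dy_G dx_G G_times)
  show ?thesis using False br_Y[OF assms _ P] q_ge_3 by simp
qed

text \<open>From y^(1) y^(q - 2) = (q - 1) y^(q - 1) = -y^(q - 1) the negative term of the bracket
  becomes positive. For r = 0 the derivatives of both powers of E contribute, with 2 m from Y and z
  from the other factor.\<close>

lemma br_Y_1:
  assumes "r < w"
  shows "br (g z r 1) (chain_B 0) =
    (if r = 0 then fun_scale (of_int (2 * m + z)) (g (z + 2 * m - 1) (w - 1) (q - 1))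
     else g (z + 2 * m) (r - 1) (q - 1))"
proof -
  have "1 + (q - 2) = q - 1" using q_ge_3 by simp
  then have choose: "1 + (q - 2) choose 1 = q - 1" by simp
  have "[int (q - 1) = -1] (mod int p)"
    using p_dvd_q q_ge_3 by (simp add: cong_iff_dvd_diff of_nat_diff)
  then have minus: "of_nat (q - 1) = (- 1 :: 'a hurwitz hurwitz)"
    using of_int_series_cong by fastforce
  have y: "G x r 1 * G (2 * m) 0 (q - 2) = - G (x + 2 * m) r (q - 1)" for x r
    using minus \<open>1 + (q - 2) = q - 1\<close> unfolding G_times choose by simp
  show ?thesis
  proof (cases "r = 0")
    case True
    have "dy (G z 0 1) * G (2 * m - 1) (w - 1) (q - 1) = G (z + 2 * m - 1) (w - 1) (q - 1)"
      by (simp add: dy_G G_times algebra_simps)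
    moreover have "dx (G z 0 1) * G (2 * m) 0 (q - 2) = - (of_int z * G (z + 2 * m - 1) (w - 1) (q - 1))"
      using w_gt_1 y[of "z - 1" "w - 1"] by (simp add: dx_G mult.assoc algebra_simps)
    ultimately have P: "poisson (G z 0 1) (G (2 * m) 0 (q - 1)) =
        of_int (2 * m + z) * G (z + 2 * m - 1) (w - 1) (q - 1)"
      unfolding poisson_Y by (simp add: algebra_simps)
    show ?thesis using True br_Y[OF _ _ P] w_gt_1 q_ge_3 by simp
  next
    case False
    have "dy (G z r 1) * G (2 * m - 1) (w - 1) (q - 1) = 0"
      using G_overflow_x[of r "w - 1"] False assms w_gt_1 by (simp add: dy_G)
    moreover have "dx (G z r 1) * G (2 * m) 0 (q - 2) = - G (z + 2 * m) (r - 1) (q - 1)"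
      using False assms y[of z "r - 1"] by (simp add: dx_G)
    ultimately have "poisson (G z r 1) (G (2 * m) 0 (q - 1)) = of_int 1 * G (z + 2 * m) (r - 1) (q - 1)"
      unfolding poisson_Y by simp
    then have "br (g z r 1) (chain_B 0) = fun_scale (of_int 1) (g (z + 2 * m) (r - 1) (q - 1))"
      using assms q_ge_3 by (intro br_Y) auto
    then show ?thesis using False by simp
  qed
qed

text \<open>Both products overflow in y, with exponent sum l + q - 2, which is at least q.\<close>

lemma br_Y_2:
  assumes "r < w" "2 \<le> l" "l < q"
  shows "br (g z r l) (chain_B 0) = 0"
proof -
  have "dy (G z r l) * G (2 * m - 1) (w - 1) (q - 1) = 0"
    using assms G_overflow_y[of "l - 1" "q - 1"] by (simp add: dy_G)
  moreover have "G x y l * G (2 * m) 0 (q - 2) = 0" for x y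
    using assms by (intro G_overflow_y) auto
  then have "dx (G z r l) * G (2 * m) 0 (q - 2) = 0"
    using assms by (simp add: dx_G mult.assoc)
  ultimately have "poisson (G z r l) (G (2 * m) 0 (q - 1)) = of_int 0 * G 0 0 0"
    unfolding poisson_Y by simp
  then have "br (g z r l) (chain_B 0) = fun_scale (of_int 0) (g 0 0 0)"
    using assms by (intro br_Y) auto
  then show ?thesis by simp
qed

lemma q_mult_cong: "[x + int q * y = x] (mod int p)"
  using p_dvd_q by (simp add: cong_iff_dvd_diff)

lemma chain_A_in: "chain_A t \<in> H"
  unfolding chain_A_def using kap_less q_ge_3 by (intro g_in_H) auto

lemma chain_B_in: "chain_B t \<in> H"
proof (cases "chain_coeff w (2 * \<pi>) t = 0")
  case True
  then show ?thesis
    unfolding chain_B_def hamiltonian_algebra_def by (simp add: V.span_zero)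
next
  case False
  then show ?thesis
    unfolding chain_B_def using kap_less q_ge_3 coeff_b_eq_0_iff[of t] by (auto intro!: g_in_H)
qed

lemma chain_C_in: "0 < u \<Longrightarrow> u < q - 1 \<Longrightarrow> chain_C t u \<in> H"
  unfolding chain_C_def using kap_less q_ge_3 by (intro g_in_H) auto

lemma two_nonzero: "(2::'a) \<noteq> 0"
  using of_int_eq_0_iff[of 2] p_ge_3 zdvd_imp_le[of "int p" 2] by auto

lemma chain: "diamond_chain fun_scale br H q w \<pi> chain_A chain_B chain_C"
proof -
  interpret L: lie_algebra fun_scale br H by (rule hamiltonian_lie_algebra)
  show ?thesis
  proof
    show "q \<ge> 3" "w > 1" "\<pi> \<noteq> 0" "(2::'a) \<noteq> 0"
      using q_ge_3 w_gt_1 \<pi>_nonzero two_nonzero by auto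
    show "chain_A t \<in> H" "chain_B t \<in> H" for t by (rule chain_A_in, rule chain_B_in)
    show "chain_C t u \<in> H" if "0 < u" "u < q - 1" for t u using that by (rule chain_C_in)
    show "chain_A t = 0 \<longleftrightarrow> chain_coeff w \<pi> t = 0" for t
      unfolding chain_A_def g_eq_0_iff[OF kap_less] coeff_a by (simp add: of_int_eq_0_iff del: of_int_add)
    show "chain_B t = 0 \<longleftrightarrow> chain_coeff w (2 * \<pi>) t = 0" for t
      using g_eq_0_iff[OF kap_less] q_ge_3 by (simp add: chain_B_def)
    show "chain_C t u \<noteq> 0" if "0 < u" "u < q - 1" for t u
      using g_eq_0_iff[OF kap_less] that by (auto simp: chain_C_def)
    show "fun_scale c (chain_A t) = 0"
      if zero: "fun_scale c (chain_A t) + fun_scale d (chain_B t) = 0" for c d t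
    proof (intro ext)
      fix x y
      \<comment> \<open>The y-exponents 0 and q - 1 make the supports disjoint.\<close>
      have "chain_A t x y = 0 \<or> chain_B t x y = 0"
        using q_ge_3 kap_less by (simp add: chain_A_def chain_B_def g_apply)
      moreover have "fun_scale c (chain_A t) x y + fun_scale d (chain_B t) x y = 0"
        using fun_cong[OF fun_cong[OF zero, of x], of y] by simp
      ultimately show "fun_scale c (chain_A t) x y = 0 x y" by (auto simp: fun_scale_def)
    qed
    show "br (chain_A t) (chain_A 0) = 0" for t
      unfolding chain_A_def[of t] using kap_less q_ge_3 by (simp add: br_X)
    show "br (chain_A t) (chain_B 0) = fun_scale (- chain_coeff w \<pi> t) (chain_C t 1)" for t
    proof (cases "kap (int t - 1) = 0")
      case True
      have "br (chain_A t) (chain_B 0) = fun_scale (of_int (- (del (int t - 1) + m)))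
          (g (del (int t - 1) + m + 2 * m - 1) (w - 1) (q - 2))"
        unfolding chain_A_def br_Y_0[OF kap_less] using True by simp
      moreover have "chain_C t 1 = g (del (int t - 1) + m + 2 * m - 1) (w - 1) (q - 2)"
        unfolding chain_C_def del_kap_zero[OF True] by (simp add: algebra_simps numeral_2_eq_2)
      moreover have "chain_coeff w \<pi> t = (of_int (del (int t - 1) + m) :: 'a)"
        unfolding coeff_a using True by simp
      ultimately show ?thesis by (simp only: of_int_minus)
    next
      case False
      then show ?thesis
        unfolding chain_A_def chain_C_def coeff_a using kap_less[of "int t - 1"] q_ge_3 del_kap_pos[of "int t"]
        by (simp add: br_Y_0 algebra_simps numeral_2_eq_2)
    qed
    show "br (chain_B t) (chain_A 0) = chain_C t 1" if "chain_coeff w (2 * \<pi>) t \<noteq> 0" for t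
      unfolding chain_B_def chain_C_def using kap_less[of "int t"] q_ge_3 that
      by (simp add: br_X algebra_simps)
    show "br (chain_B t) (chain_B 0) = 0" for t
      unfolding chain_B_def[of t] using kap_less[of "int t"] q_ge_3 chain_B_in[of 0] by (simp add: br_Y_2)
    show "br (chain_C t u) (chain_A 0) = chain_C t (u + 1)" if "0 < u" "u < q - 2" for t u
      unfolding chain_C_def using kap_less[of "int t"] that by (simp add: br_X algebra_simps)
    show "br (chain_C t u) (chain_B 0) = 0" if "0 < u" "u < q - 2" for t u
      unfolding chain_C_def using kap_less[of "int t"] that by (intro br_Y_2) auto
    \<comment> \<open>The exponent of E is del t + q m, and q m drops out because p divides
      q.\<close>
    have C_last: "chain_C t (q - 2) = g (del (int t)) (kap (int t)) 1" for t
      unfolding chain_C_def using q_ge_3 q_mult_cong[of "del (int t)" m]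
      by (auto simp: of_nat_diff intro: g_cong)
    show "br (chain_C t (q - 2)) (chain_A 0) = chain_A (t + 1)" for t
    proof -
      have "chain_A (t + 1) = g (del (int t) + m) (kap (int t)) 0" by (simp add: chain_A_def)
      then show ?thesis
        unfolding C_last using kap_less[of "int t"] q_ge_3 by (simp add: br_X)
    qed
    show "br (chain_C t (q - 2)) (chain_B 0) =
        fun_scale (chain_coeff w (2 * \<pi>) (t + 1)) (chain_B (t + 1))" for t
    proof (cases "kap (int t) = 0")
      case True
      have "br (chain_C t (q - 2)) (chain_B 0) =
          fun_scale (of_int (2 * m + del (int t))) (g (del (int t) + 2 * m - 1) (w - 1) (q - 1))"
        unfolding C_last br_Y_1[OF kap_less] using True by simp
      moreover have "chain_coeff w (2 * \<pi>) (t + 1) = (of_int (2 * m + del (int t)) :: 'a)"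
        using coeff_b[of "t + 1"] True by (simp add: add.commute)
      moreover have "chain_B (t + 1) = (if chain_coeff w (2 * \<pi>) (t + 1) = 0 then 0
          else g (del (int t) + 2 * m - 1) (w - 1) (q - 1))"
      proof -
        have "del (int (t + 1)) = del (int t) - 1" "kap (int (t + 1)) = w - 1"
          using del_kap_zero[of "int t + 1"] True by (simp_all add: add.commute)
        then have "del (int (t + 1)) + 2 * m = del (int t) + 2 * m - 1" "kap (int (t + 1)) = w - 1"
          by simp_all
        then show ?thesis by (simp only: chain_B_def)
      qed
      \<comment> \<open>If the coefficient is 0, both sides vanish although the element with the top
        monomial does not.\<close>
      ultimately show ?thesis by auto
    next
      case False
      have "br (chain_C t (q - 2)) (chain_B 0) = g (del (int t) + 2 * m) (kap (int t) - 1) (q - 1)"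
        unfolding C_last br_Y_1[OF kap_less] using False by simp
      moreover have "chain_coeff w (2 * \<pi>) (t + 1) = (1 :: 'a)"
        using coeff_b[of "t + 1"] False by simp
      moreover have "del (int (t + 1)) = del (int t)" "kap (int (t + 1)) = kap (int t) - 1"
        using del_kap_pos[of "int t + 1"] False by (simp_all add: add.commute)
      ultimately show ?thesis by (simp add: chain_B_def)
    qed
  qed
qed

section \<open>Homogeneous components of the grading\<close>

lemma gdeg_line:
  assumes "u \<le> q - 1"
  shows "[gdeg (del t + (int u + 2) * m) (kap t) (q - 1 - u) = t * (int q - 1) + 1 + int u] (mod int N)"
proof -
  have "gdeg (del t + (int u + 2) * m) (kap t) (q - 1 - u) =
      (1 - int q) * ((del t * int w + int (kap t)) + int q * m * int w - 1) - (int q - 2 - int u)"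
    using assms q_ge_3 by (simp add: gdeg_def of_nat_diff algebra_simps)
  also have "\<dots> = t * (int q - 1) + 1 + int u - (int q - 1) * int q * int w * m"
    unfolding del_kap by (simp add: algebra_simps)
  finally have eq: "gdeg (del t + (int u + 2) * m) (kap t) (q - 1 - u) - (t * (int q - 1) + 1 + int u) =
      - ((int q - 1) * int q * int w * m)" by simp
  \<comment> \<open>The error (q - 1) q w m is a multiple of N = (q - 1) p w because p divides
    q.\<close>
  obtain k where "q = p * k" using p_dvd_q by blast
  then have k: "int q = int p * int k" by simp
  have "int N = (int q - 1) * (int p * int w)" using q_ge_3 by (simp add: N_def of_nat_diff)
  note N = this
  have "(int q - 1) * int q * int w * m = (int q - 1) * (int p * int k) * int w * m"
    by (simp only: k)
  also have "\<dots> = (int q - 1) * (int p * int w) * (int k * m)" by (simp only: mult_ac)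
  also have "\<dots> = int N * (int k * m)" by (simp only: N)
  finally have "(int q - 1) * int q * int w * m = int N * (int k * m)" .
  then have "int N dvd (int q - 1) * int q * int w * m" by (rule dvdI)
  then show ?thesis unfolding cong_iff_dvd_diff eq by simp
qed

lemma gdeg_A: "gdeg (del (t - 1) + m) (kap (t - 1)) 0 = t * (int q - 1) + 1"
proof -
  have "gdeg (del (t - 1) + m) (kap (t - 1)) 0 =
      (1 - int q) * ((del (t - 1) * int w + int (kap (t - 1))) - 1) + 1"
    by (simp add: gdeg_def algebra_simps)
  then show ?thesis unfolding del_kap by (simp add: algebra_simps)
qed

text \<open>Modulo q - 1 the degree condition says that q - 1 divides l + u; as l + u < 2 (q - 1),
  the sum is 0 or q - 1. After division by q - 1 there remains a congruence modulo p w, which fixes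
  the x-exponent and the exponent of E modulo p by uniqueness of the expansion of -(t - 1) in the
  first case and of -t in the second.\<close>

lemma degree_decode:
  assumes b: "b \<in> I" and deg: "[deg b = int t * (int q - 1) + 1 + int u] (mod int N)" and u: "u < q - 1"
  shows "e b = chain_A t \<and> u = 0 \<or>
    e b = g (del (int t) + (int u + 2) * m) (kap (int t)) (q - 1 - u)"
proof -
  obtain a r l where b: "b = (int l - 1, int r - 1, a)" "a < p" "r < w" "l < q"
    using b by (rule index_cases)
  define Q where "Q = int q - 1"
  define k0 where "k0 = (int a + (int l - 1) * m) * int w + int r - 1 + int t"
  have Q: "Q > 0" "int N = Q * (int p * int w)"
    using q_ge_3 by (simp_all add: Q_def N_def of_nat_diff)
  have "deg b - (int t * (int q - 1) + 1 + int u) = - (Q * k0 + (int l + int u))"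
    by (simp add: b deg_eq gdeg_def k0_def Q_def algebra_simps)
  then have N: "Q * (int p * int w) dvd Q * k0 + (int l + int u)"
    using deg unfolding cong_iff_dvd_diff Q by (metis dvd_minus_iff)
  then have "Q dvd Q * k0 + (int l + int u)" by (metis dvd_mult_left)
  then have "Q dvd int l + int u" by (simp add: dvd_add_right_iff)
  then obtain c where c: "int l + int u = Q * c" by blast
  have "int l + int u < Q * 2" using b(4) u by (simp add: Q_def)
  then have "c < 2" using c Q by (metis mult_less_cancel_left_pos)
  moreover have "c \<ge> 0" using c Q by (metis of_nat_0_le_iff add_nonneg_nonneg zero_le_mult_iff not_less)
  ultimately have "c = 0 \<or> c = 1" by linarith
  then have "int p * int w dvd k0 + c"
    using N Q c by (metis distrib_left dvd_mult_cancel_left less_irrefl)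
  then obtain k where k: "k0 + c = int p * int w * k" by blast
  show ?thesis
  proof (cases "c = 0")
    case True
    then have lu: "l = 0" "u = 0" using c by auto
    have "(int a - m - int p * k) * int w + int r = - (int t - 1)"
      using k True lu by (simp add: k0_def algebra_simps)
    then have "del (int t - 1) = int a - m - int p * k" "kap (int t - 1) = r"
      using b(3) by (rule del_kap_unique)+
    then have "chain_A t = g (int a - int p * k) r 0" by (simp add: chain_A_def)
    also have "\<dots> = g (int a) r 0" by (intro g_cong) (simp add: cong_iff_dvd_diff)
    also have "\<dots> = e b" using b lu ham_element_eq[of r 0 a] q_ge_3 by simp
    finally show ?thesis using lu by simp
  next
    case False
    then have c1: "c = 1" using \<open>c = 0 \<or> c = 1\<close> by simp
    then have l: "int l = int q - 1 - int u" using c by (simp add: Q_def)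
    have "(int a + (int l - 1) * m - int p * k) * int w + int r = - int t"
      using k c1 by (simp add: k0_def algebra_simps)
    then have dk: "del (int t) = int a + (int l - 1) * m - int p * k" "kap (int t) = r"
      using b(3) by (rule del_kap_unique)+
    have lq: "l = q - 1 - u" using l u by linarith
    have "del (int t) + (int u + 2) * m - int a = int q * m - int p * k"
      unfolding dk l by (simp add: algebra_simps)
    then have "[del (int t) + (int u + 2) * m = int a] (mod int p)"
      using p_dvd_q by (simp add: cong_iff_dvd_diff)
    then have "g (del (int t) + (int u + 2) * m) (kap (int t)) (q - 1 - u) = g (int a) r l"
      using dk(2) lq g_cong by simp
    then show ?thesis using b ham_element_eq[of r l a] by simp
  qed
qed

lemma g_in_DS:
  assumes "r < w" "l < q" "g z r l \<in> H" "[gdeg z r l = d] (mod int N)"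
  shows "g z r l \<in> DS d"
proof -
  interpret L: lie_algebra fun_scale br H by (rule hamiltonian_lie_algebra)
  show ?thesis
    using scale_g_in_DS[OF assms(1,2), of 1 z] assms(3) L.degree_span_cong[OF assms(4), of I e deg] by simp
qed

lemma DS_eq_span:
  assumes "\<And>b. b \<in> I \<Longrightarrow> [deg b = d] (mod int N) \<Longrightarrow> e b \<in> V.span Z" and "Z \<subseteq> DS d"
  shows "V.span Z = DS d"
proof
  show "V.span Z \<subseteq> DS d"
    using assms(2) by (intro V.span_minimal) (auto simp: degree_span_def)
  have "{e b | b. b \<in> I \<and> [deg b = d] (mod int N)} \<subseteq> V.span Z" using assms(1) by blast
  then show "DS d \<subseteq> V.span Z"
    unfolding degree_span_def by (intro V.span_minimal) auto
qed

lemma chain_component_eq: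
  assumes "i \<ge> 1"
  shows "chain_component fun_scale q chain_A chain_B chain_C i = DS (int i)"
proof -
  interpret D: diamond_chain fun_scale br H q w \<pi> chain_A chain_B chain_C by (rule chain)
  have sub: "V.subspace (DS d)" for d by (simp add: degree_span_def)
  have qi: "int (q - 1) = int q - 1" using q_ge_3 by simp
  show ?thesis
    using assms
  proof (cases rule: D.degree_cases)
    case (diamond t)
    have i: "int i = int t * (int q - 1) + 1 + int 0" using diamond qi by simp
    have q_1: "0 < q - 1" using q_ge_3 by simp
    have comp: "D.component i = V.span {chain_A t, chain_B t}"
      using D.component_diamond[of t] diamond by simp
    have "e b \<in> V.span {chain_A t, chain_B t}" if b: "b \<in> I" "[deg b = int i] (mod int N)" for b
      using degree_decode[OF b[unfolded i] q_1]
    proof (elim disjE conjE)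
      assume e: "e b = g (del (int t) + (int 0 + 2) * m) (kap (int t)) (q - 1 - 0)"
      \<comment> \<open>A basis element has no top monomial, which excludes the case where
        \<open>chain_B\<close> was set to 0.\<close>
      have "e b (p * w - 1) (q - 1) = 0" using e_in_H[OF b(1)] by (simp add: hamiltonian_algebra_eq)
      then have "chain_coeff w (2 * \<pi>) t \<noteq> 0"
        using g_top[OF kap_less[of "int t"], of "del (int t) + 2 * m" "q - 1"] coeff_b_eq_0_iff[of t]
        unfolding e by simp
      then have "e b = chain_B t" unfolding e chain_B_def by simp
      then show ?thesis by (simp add: V.span_base)
    qed (auto intro: V.span_base)
    moreover have "chain_A t \<in> DS (int i)"
      using chain_A_in[of t] q_ge_3 kap_less gdeg_A[of "int t"] i unfolding chain_A_def
      by (intro g_in_DS) auto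
    moreover have "chain_B t \<in> DS (int i)"
    proof (cases "chain_coeff w (2 * \<pi>) t = 0")
      case True
      then show ?thesis using V.subspace_0[OF sub] by (simp add: chain_B_def)
    next
      case False
      then show ?thesis
        using chain_B_in[of t] q_ge_3 kap_less gdeg_line[of 0 "int t"] i unfolding chain_B_def
        by (auto intro!: g_in_DS)
    qed
    ultimately show ?thesis
      unfolding comp by (intro DS_eq_span) auto
  next
    case (line t u)
    have i: "int i = int t * (int q - 1) + 1 + int u" using line qi by simp
    have comp: "D.component i = V.span {chain_C t u}"
      using D.component_line[of u t] line by simp
    have "e b \<in> V.span {chain_C t u}" if b: "b \<in> I" "[deg b = int i] (mod int N)" for b
      using degree_decode[OF b[unfolded i]] line by (auto simp: chain_C_def intro: V.span_base)
    moreover have "chain_C t u \<in> DS (int i)"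
    proof -
      have "[gdeg (del (int t) + (int u + 2) * m) (kap (int t)) (q - 1 - u) = int i] (mod int N)"
        unfolding i using line by (intro gdeg_line) simp
      then show ?thesis
        using chain_C_in[of u t] line kap_less unfolding chain_C_def by (intro g_in_DS) auto
    qed
    ultimately show ?thesis
      unfolding comp by (intro DS_eq_span) auto
  qed
qed

end

lemma prime_subfield_inverse:
  assumes "prime CHAR('a::field)" "\<pi> \<in> (prime_subfield :: 'a set)" "\<pi> \<noteq> 0"
  shows "1 / \<pi> \<in> prime_subfield"
proof -
  obtain m :: int where m: "\<pi> = of_int m" using assms(2) by (auto simp: prime_subfield_def)
  have "\<not> int CHAR('a) dvd m" using m assms(3) by (simp add: of_int_eq_0_iff_char_dvd)
  then have "coprime m (int CHAR('a))"
    using assms(1) prime_imp_coprime[of "int CHAR('a)" m] by (simp add: coprime_commute)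
  then obtain x where "[m * x = 1] (mod int CHAR('a))" using cong_solve_coprime_int by blast
  then have "of_int (m * x) = (of_int 1 :: 'a)" by (simp only: of_int_eq_iff_cong_CHAR)
  then have "\<pi> * of_int x = 1" using m by simp
  then have "1 / \<pi> = of_int x" using assms(3) by (simp add: field_simps)
  then show ?thesis by (simp add: prime_subfield_def)
qed

theorem theorem6p1:
  fixes \<pi> :: "'a::field" and m :: int and p n s q N :: nat
    and H :: "(nat \<Rightarrow> nat \<Rightarrow> 'a) set"
    and br :: "(nat \<Rightarrow> nat \<Rightarrow> 'a) \<Rightarrow> (nat \<Rightarrow> nat \<Rightarrow> 'a) \<Rightarrow> (nat \<Rightarrow> nat \<Rightarrow> 'a)"
    and e :: "int \<times> int \<times> nat \<Rightarrow> (nat \<Rightarrow> nat \<Rightarrow> 'a)"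
    and L :: "(nat \<Rightarrow> nat \<Rightarrow> 'a) poly set"
    and M :: "nat \<Rightarrow> (nat \<Rightarrow> nat \<Rightarrow> 'a) poly set"
    and sc :: "'a \<Rightarrow> (nat \<Rightarrow> nat \<Rightarrow> 'a) poly \<Rightarrow> (nat \<Rightarrow> nat \<Rightarrow> 'a) poly"
    and lb :: "(nat \<Rightarrow> nat \<Rightarrow> 'a) poly \<Rightarrow> (nat \<Rightarrow> nat \<Rightarrow> 'a) poly \<Rightarrow> (nat \<Rightarrow> nat \<Rightarrow> 'a) poly"
  assumes "CHAR('a) = p" and "odd p" and "n > 0" and "s > 0" and "q = p ^ n"
    and "\<pi> \<in> prime_subfield" and "\<pi> \<noteq> 0" and "of_int m = \<pi>"
    and "N = (q - 1) * p ^ (s + 1)"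
    and "H = hamiltonian_algebra (s + 1) n"
    and "br = hamiltonian_bracket (s + 1) n"
    and "e = ham_element s n"
    and "L = loop_algebra fun_scale br H
               (degree_span fun_scale N (ham_index p s n) e (ham_degree p s n m) 1)"
    and "M = loop_component L"
    and "sc = poly_scale fun_scale"
    and "lb = poly_bracket br"
  shows "graded_basis fun_scale br H N (ham_index p s n) e (ham_degree p s n m) \<and>
    thin sc lb L M \<and>
    second_diamond sc M q \<and>
    (\<exists>X Y. diamond_generators sc lb M q X Y \<and>
           has_finite_type sc lb M q X Y ((q - 1) * (p ^ s + 1) + 1) (-1 + 1 / \<pi>)) \<and>
    (\<forall>X Y. diamond_generators sc lb M q X Y \<longrightarrow>
           {i. is_diamond sc lb M q X Y i} = {t * (q - 1) + 1 | t. True} \<and>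
           (\<forall>t\<ge>1. (\<exists>\<mu>. has_finite_type sc lb M q X Y (t * (q - 1) + 1) \<mu>) \<longleftrightarrow> [t = 1] (mod p ^ s)) \<and>
           (\<forall>t\<ge>1. has_infinite_type sc lb M X Y (t * (q - 1) + 1) \<longleftrightarrow> \<not> [t = 1] (mod p ^ s)) \<and>
           (\<exists>c\<in>prime_subfield. \<exists>d\<in>prime_subfield. \<forall>r.
              has_finite_type sc lb M q X Y ((1 + r * p ^ s) * (q - 1) + 1) (c + of_nat r * d)) \<and>
           (q > 3 \<longrightarrow>
              has_finite_type sc lb M q X Y ((q - 1) * (p ^ s + 1) + 1) (-1 + 1 / \<pi>)))"
proof -
  have char: "CHAR('a) > 0" using assms(1,2) by (cases "p = 0") auto
  interpret hamiltonian_basis "TYPE('a)" s n p q "p ^ s" N m \<pi>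
    using assms char by unfold_locales auto
  have br: "br = hamiltonian_bracket (Suc s) n" and H: "H = hamiltonian_algebra (Suc s) n"
    and e: "e = ham_element s n"
    using assms by simp_all
  interpret D: diamond_chain fun_scale br H q "p ^ s" \<pi> chain_A chain_B chain_C
    using chain unfolding br H .
  have basis: "graded_basis fun_scale br H N (ham_index p s n) e (ham_degree p s n m)"
    using ham_graded_basis unfolding br H e .
  let ?DS = "degree_span fun_scale N (ham_index p s n) e (ham_degree p s n m)"
  have comp: "D.component i = ?DS (int i)" if "i \<ge> 1" for i
    using chain_component_eq[OF that] unfolding e .
  \<comment> \<open>Equality of the chain components with the components of the graded basis
    supplies the brackets of arbitrary degrees.\<close>
  have graded: "br x y \<in> D.component (i + j)"
    if "i \<ge> 1" "j \<ge> 1" "x \<in> D.component i" "y \<in> D.component j" for i j x y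
  proof -
    have x: "x \<in> ?DS (int i)" and y: "y \<in> ?DS (int j)"
      using that comp[of i] comp[of j] by simp_all
    have "br x y \<in> ?DS (int i + int j)"
    proof (rule D.degree_span_bracket[OF _ _ x y])
      show "e b \<in> H" if "b \<in> ham_index p s n" for b
        using e_in_H[OF that] unfolding e H .
      show "br (e b) (e b') \<in> ?DS (ham_degree p s n m b + ham_degree p s n m b')"
        if "b \<in> ham_index p s n" "b' \<in> ham_index p s n" for b b'
        using br_e_in_DS[OF that] unfolding e br .
    qed
    then show ?thesis using comp[of "i + j"] that by simp
  qed
  \<comment> \<open>The generating space is the component of degree 1 modulo N, and this is the
    first diamond of the chain.\<close>
  have L: "L = loop_algebra fun_scale br H (D.component 1)"
    using assms(13) comp[of 1] by simp
  note loop = D.loop_chain[OF graded, folded L]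
  interpret LD: diamond_chain sc lb L q "p ^ s" \<pi>
    "\<lambda>t. monom (chain_A t) (t * (q - 1) + 1)" "\<lambda>t. monom (chain_B t) (t * (q - 1) + 1)"
    "\<lambda>t u. monom (chain_C t u) (t * (q - 1) + 1 + u)"
    using loop(1) assms by simp
  have M: "M = LD.component"
    using loop(2) assms by simp
  have thin: "thin sc lb L M"
    unfolding M using loop(3,4) assms loop(2) by (intro LD.chain_thin) simp_all
  have inv: "1 / \<pi> \<in> prime_subfield"
    using assms prime_CHAR by (intro prime_subfield_inverse) auto
  have minus_inv: "- (1 / \<pi>) \<in> prime_subfield"
    using inv by (auto simp: prime_subfield_def simp flip: of_int_minus)
  have ints: "- 1 \<in> (prime_subfield :: 'a set)" "2 \<in> (prime_subfield :: 'a set)"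
    unfolding prime_subfield_def
    by (rule range_eqI[of _ _ "- 1"], simp, rule range_eqI[of _ _ 2], simp)
  have degree: "(1 + 1 * p ^ s) * (q - 1) + 1 = (q - 1) * (p ^ s + 1) + 1"
    by (simp add: algebra_simps)
  have first: "has_finite_type sc lb M q X Y ((q - 1) * (p ^ s + 1) + 1) (- 1 + 1 / \<pi>)"
    if "\<forall>r. has_finite_type sc lb M q X Y ((1 + r * p ^ s) * (q - 1) + 1) (- 1 + of_nat r * (1 / \<pi>))"
    for X Y
    using spec[OF that, of 1] unfolding degree by simp
  show ?thesis
  proof (intro conjI allI impI)
    show "graded_basis fun_scale br H N (ham_index p s n) e (ham_degree p s n m)" by (rule basis)
    show "thin sc lb L M" by (rule thin)
    show "second_diamond sc M q" unfolding M by (rule LD.chain_second_diamond)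
    show "\<exists>X Y. diamond_generators sc lb M q X Y \<and>
        has_finite_type sc lb M q X Y ((q - 1) * (p ^ s + 1) + 1) (- 1 + 1 / \<pi>)"
      using LD.diamond_generators_A_B LD.A_B_types first unfolding M by blast
  next
    fix X Y assume gen: "diamond_generators sc lb M q X Y"
    note gen' = gen[unfolded M]
    show "{i. is_diamond sc lb M q X Y i} = {t * (q - 1) + 1 | t. True}"
      unfolding M by (rule LD.diamonds[OF gen'])
    show "(\<exists>\<mu>. has_finite_type sc lb M q X Y (t * (q - 1) + 1) \<mu>) \<longleftrightarrow> [t = 1] (mod p ^ s)"
      if "t \<ge> 1" for t
      unfolding M by (rule LD.types(1)[OF gen' that])
    show "has_infinite_type sc lb M X Y (t * (q - 1) + 1) \<longleftrightarrow> \<not> [t = 1] (mod p ^ s)"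
      if "t \<ge> 1" for t
      unfolding M by (rule LD.types(2)[OF gen' that])
    show "\<exists>c\<in>prime_subfield. \<exists>d\<in>prime_subfield. \<forall>r.
        has_finite_type sc lb M q X Y ((1 + r * p ^ s) * (q - 1) + 1) (c + of_nat r * d)"
      using LD.finite_type_progression[OF gen'] inv minus_inv ints unfolding M by blast
    \<comment> \<open>For q > 3 the generators cannot be exchanged, so the progression is the one
      starting at -1, taken at r = 1.\<close>
    show "has_finite_type sc lb M q X Y ((q - 1) * (p ^ s + 1) + 1) (- 1 + 1 / \<pi>)" if "q > 3"
      using LD.finite_type_progression[OF gen'] that first unfolding M by auto
  qed
qed

end
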